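(* Let $\Omega\subset\mathbb{R}^n$ be open and bounded, let $m=m_1+m_2$ with $1\le m_1\le m$, and let $F_1,\dots,F_m:\Omega\times\mathbb{R}^{m_1}\times\mathbb{R}^{m_2}\times\mathbb{R}^n\times\mathbf{S}^n\to\mathbb{R}$ be continuous, degenerate elliptic and balanced quasi-monotone. Suppose moreover that the following two conditions hold. (i') There is $\lambda>0$ such that for all $(r,s),(\rho,\sigma)\in\mathbb{R}^{m_1}\times\mathbb{R}^{m_2}$ with $$\max\Big\{\max_{1\le j\le m_1}(r_j-\rho_j),\ \max_{1\le j\le m_2}(\sigma_j-s_j)\Big\}=\theta>0$$ and all $(x,p,X)\in\Omega\times\mathbb{R}^n\times\mathbf{S}^n$: $$F_j(x,r,s,p,X)-F_j(x,\rho,\sigma,p,X)\ge\lambda(r_j-\rho_j)\quad\text{if }1\le j\le m_1\text{ and }\theta=r_j-\rho_j,$$ $$F_{m_1+j}(x,\rho,\sigma,p,X)-F_{m_1+j}(x,r,s,p,X)\ge\lambda(\sigma_j-s_j)\quad\text{if }1\le j\le m_2\text{ and }\theta=\sigma_j-s_j.$$ (ii) There is a continuous function $\omega:[0,\infty)\to[0,\infty)$ with $\omega(0)=0$ such that if $X,Y\in\mathbf{S}^n$, $\alpha>0$ and $$-3\alpha\begin{pmatrix}I&0\\0&I\end{pmatrix}\le\begin{pmatrix}X&0\\0&Y\end{pmatrix}\le3\alpha\begin{pmatrix}I&-I\\-I&I\end{pmatrix},$$ then $$F_i(y,\xi,\alpha(x-y),-Y)-F_i(x,\xi,\alpha(x-y),X)\le\omega\big(\alpha|x-y|^2+1/\alpha\big)$$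 for all $1\le i\le m$, $x,y\in\Omega$ and $\xi\in\mathbb{R}^m$. Let $(\mathbf{u}_1,\mathbf{u}_2)$ be a sub-super solution and $(\mathbf{v}_1,\mathbf{v}_2)$ a super-sub solution of the system $$F_i(x,\mathbf{u}(x),Du_i(x),D^2u_i(x))=0\quad\text{in }\Omega,\qquad i=1,\dots,m,$$ such that (componentwise) $$\mathbf{u}_1^*\le\mathbf{v}_{1*}\ \text{ on }\partial\Omega,\qquad \mathbf{v}_2^*\le\mathbf{u}_{2*}\ \text{ on }\partial\Omega.$$ Then $$\mathbf{u}_1^*\le\mathbf{v}_{1*}\ \text{ in }\Omega,\qquad \mathbf{v}_2^*\le\mathbf{u}_{2*}\ \text{ in }\Omega.$$
   Context: $\mathbf{S}^n$ is the space of real symmetric $n\times n$ matrices with the usual partial order. Inequalities between vectors are componentwise. A vector $\xi\in\mathbb{R}^m$ is written $(r,s)$ with $r\in\mathbb{R}^{m_1}$, $s\in\mathbb{R}^{m_2}$, and a function $\mathbf{u}:\Omega\to\mathbb{R}^m$ is written $\mathbf{u}=(\mathbf{u}_1,\mathbf{u}_2)=(u_{11},\dots,u_{1m_1},u_{21},\dots,u_{2m_2})$; if $m_2=0$, everything concerning the second group is void. Degenerate ellipticity: for each $i\in\{1,\dots,m\}$ and all $(x,r,s,p)$, $F_i(x,r,s,p,X)\ge F_i(x,r,s,p,Y)$ whenever $X\le Y$ in $\mathbf{S}^n$. Balanced quasi-monotonicity: for all $(x,p,X)\in\Omega\times\mathbb{R}^n\times\mathbf{S}^n$, for $1\le j\le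 m_1$: $F_j(x,r,s,p,X)\le F_j(x,r,\sigma,p,X)$ whenever $s\le\sigma$, and $F_j(x,r,s,p,X)\ge F_j(x,\rho,s,p,X)$ whenever $r\le\rho$ and $r_j=\rho_j$; for $1\le j\le m_2$: $F_{m_1+j}(x,r,s,p,X)\le F_{m_1+j}(x,\rho,s,p,X)$ whenever $r\le\rho$, and $F_{m_1+j}(x,r,s,p,X)\ge F_{m_1+j}(x,r,\sigma,p,X)$ whenever $s\le\sigma$ and $s_j=\sigma_j$. Envelopes: for $f:\Omega\to\mathbb{R}$ bounded and $x\in\overline{\Omega}$, $f^*(x)=\limsup_{y\to x,\,y\in\Omega}f(y)$ and $f_*(x)=\liminf_{y\to x,\,y\in\Omega}f(y)$ (with $y=x$ allowed if $x\in\Omega$); for vector-valued functions they are taken componentwise. In particular the envelopes on $\partial\Omega$ are the limits superior/inferior from inside $\Omega$. Touching: $\varphi$ touches $f$ from above (below) at $x\in\Omega$ if $\varphi(x)=f(x)$ and $\varphi>f$ ($\varphi<f$) in $\mathcal{N}\setminus\{x\}$ for some open neighborhood $\mathcal{N}$ of $x$. Super-sub solution: a bounded function $(\mathbf{u}_1,\mathbf{u}_2):\Omega\to\mathbb{R}^{m_1}\times\mathbb{R}^{m_2}$ such that for each $x\in\Omega$: for all $1\le j\le m_1$, $F_j(x,\mathbf{u}_{1*}(x),\mathbf{u}_2^*(x),D\varphi(x),D^2\varphi(x))\ge0$ whenever $\varphi\in C^2(\Omega)$ touches $u_{1j*}$ from below at $x$; and for all $1\le j\le m_2$, $F_{m_1+j}(x,\mathbf{u}_{1*}(x),\mathbf{u}_2^*(x),D\varphi(x),D^2\varphi(x))\le0$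 whenever $\varphi\in C^2(\Omega)$ touches $u_{2j}^*$ from above at $x$. Sub-super solution: a bounded function $(\mathbf{u}_1,\mathbf{u}_2):\Omega\to\mathbb{R}^{m_1}\times\mathbb{R}^{m_2}$ such that for each $x\in\Omega$: for all $1\le j\le m_1$, $F_j(x,\mathbf{u}_1^*(x),\mathbf{u}_{2*}(x),D\varphi(x),D^2\varphi(x))\le0$ whenever $\varphi\in C^2(\Omega)$ touches $u_{1j}^*$ from above at $x$; and for all $1\le j\le m_2$, $F_{m_1+j}(x,\mathbf{u}_1^*(x),\mathbf{u}_{2*}(x),D\varphi(x),D^2\varphi(x))\ge0$ whenever $\varphi\in C^2(\Omega)$ touches $u_{2j*}$ from below at $x$. *)

theory Defs
  imports "HOL-Analysis.Analysis"
begin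

(* Types are nonempty, so the two groups of indices cannot be two index types (m2 = 0 must be
   allowed).  Vectors of R^m are real^'m, and a set J :: 'm set singles out the indices of the first
   group: m = CARD('m), m1 = card J, m2 = card (- J).  The vector (r,s) of R^m1 x R^m2 is
   join J r s; only the components of r in J and those of s outside J matter. *)

definition join :: "'m set \<Rightarrow> real^'m \<Rightarrow> real^'m \<Rightarrow> real^'m"
  where "join J r s = (\<chi> i. if i \<in> J then r $ i else s $ i)"

definition sym_mat :: "real^'n^'n \<Rightarrow> bool"
  where "sym_mat X \<longleftrightarrow> transpose X = X"

(* The order of quadratic forms on symmetric matrices; the library order on
   real^'n^'n is the entrywise one. *)
definition loewner_le :: "real^'n^'n \<Rightarrow> real^'n^'n \<Rightarrow> bool"
  where "loewner_le X Y \<longleftrightarrow> (\<forall>v. v \<bullet> (X *v v) \<le> v \<bullet> (Y *v v))"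

definition block_mat ::
  "real^'n^'n \<Rightarrow> real^'n^'n \<Rightarrow> real^'n^'n \<Rightarrow> real^'n^'n \<Rightarrow> real^('n + 'n)^('n + 'n)"
  where "block_mat A B C D = (\<chi> i j.
    case i of
      Inl k \<Rightarrow> (case j of Inl l \<Rightarrow> A $ k $ l | Inr l \<Rightarrow> B $ k $ l)
    | Inr k \<Rightarrow> (case j of Inl l \<Rightarrow> C $ k $ l | Inr l \<Rightarrow> D $ k $ l))"

(* The functions F i are total; only their values at x in \<Omega> and at symmetric X are constrained. *)
type_synonym ('n, 'm) operator = "'m \<Rightarrow> real^'n \<Rightarrow> real^'m \<Rightarrow> real^'n \<Rightarrow> real^'n^'n \<Rightarrow> real"

definition degenerate_elliptic :: "(real^'n) set \<Rightarrow> ('n, 'm::finite) operator \<Rightarrow> bool"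
  where "degenerate_elliptic \<Omega> F \<longleftrightarrow>
    (\<forall>i. \<forall>x\<in>\<Omega>. \<forall>\<xi> p X Y. sym_mat X \<longrightarrow> sym_mat Y \<longrightarrow> loewner_le X Y
        \<longrightarrow> F i x \<xi> p X \<ge> F i x \<xi> p Y)"

definition balanced_quasi_monotone ::
  "'m::finite set \<Rightarrow> (real^'n) set \<Rightarrow> ('n, 'm) operator \<Rightarrow> bool"
  where "balanced_quasi_monotone J \<Omega> F \<longleftrightarrow>
    (\<forall>x\<in>\<Omega>. \<forall>p X. sym_mat X \<longrightarrow>
      (\<forall>j\<in>J.
        (\<forall>r s \<sigma>. (\<forall>k\<in>-J. s $ k \<le> \<sigma> $ k) \<longrightarrow>
            F j x (join J r s) p X \<le> F j x (join J r \<sigma>) p X) \<and>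
        (\<forall>r \<rho> s. (\<forall>k\<in>J. r $ k \<le> \<rho> $ k) \<and> r $ j = \<rho> $ j \<longrightarrow>
            F j x (join J r s) p X \<ge> F j x (join J \<rho> s) p X)) \<and>
      (\<forall>j\<in>-J.
        (\<forall>r \<rho> s. (\<forall>k\<in>J. r $ k \<le> \<rho> $ k) \<longrightarrow>
            F j x (join J r s) p X \<le> F j x (join J \<rho> s) p X) \<and>
        (\<forall>r s \<sigma>. (\<forall>k\<in>-J. s $ k \<le> \<sigma> $ k) \<and> s $ j = \<sigma> $ j \<longrightarrow>
            F j x (join J r s) p X \<ge> F j x (join J r \<sigma>) p X)))"

(* The filter inf (nhds x) (principal \<Omega>), unlike at x within \<Omega>, lets y = x
   take part in the limit when x is in \<Omega>.  The limits superior and inferior are taken in ereal;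
   for f bounded on \<Omega> and x in the closure of \<Omega> they are finite. *)
definition upper_env :: "(real^'n) set \<Rightarrow> (real^'n \<Rightarrow> real) \<Rightarrow> real^'n \<Rightarrow> real"
  where "upper_env \<Omega> f x =
    real_of_ereal (Limsup (inf (nhds x) (principal \<Omega>)) (\<lambda>y. ereal (f y)))"

definition lower_env :: "(real^'n) set \<Rightarrow> (real^'n \<Rightarrow> real) \<Rightarrow> real^'n \<Rightarrow> real"
  where "lower_env \<Omega> f x =
    real_of_ereal (Liminf (inf (nhds x) (principal \<Omega>)) (\<lambda>y. ereal (f y)))"

definition upper_env_vec :: "(real^'n) set \<Rightarrow> (real^'n \<Rightarrow> real^'m) \<Rightarrow> real^'n \<Rightarrow> real^'m"
  where "upper_env_vec \<Omega> u x = (\<chi> i. upper_env \<Omega> (\<lambda>y. u y $ i) x)"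

definition lower_env_vec :: "(real^'n) set \<Rightarrow> (real^'n \<Rightarrow> real^'m) \<Rightarrow> real^'n \<Rightarrow> real^'m"
  where "lower_env_vec \<Omega> u x = (\<chi> i. lower_env \<Omega> (\<lambda>y. u y $ i) x)"

definition touches_above :: "(real^'n \<Rightarrow> real) \<Rightarrow> (real^'n \<Rightarrow> real) \<Rightarrow> real^'n \<Rightarrow> bool"
  where "touches_above \<phi> f x \<longleftrightarrow>
    \<phi> x = f x \<and> (\<exists>N. open N \<and> x \<in> N \<and> (\<forall>y\<in>N - {x}. \<phi> y > f y))"

definition touches_below :: "(real^'n \<Rightarrow> real) \<Rightarrow> (real^'n \<Rightarrow> real) \<Rightarrow> real^'n \<Rightarrow> bool"
  where "touches_below \<phi> f x \<longleftrightarrow>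
    \<phi> x = f x \<and> (\<exists>N. open N \<and> x \<in> N \<and> (\<forall>y\<in>N - {x}. \<phi> y < f y))"

(* \<phi> is C^2 on the open set \<Omega>, with gradient D\<phi> and Hessian matrix H\<phi> there. *)
definition C2_on ::
  "(real^'n) set \<Rightarrow> (real^'n \<Rightarrow> real) \<Rightarrow> (real^'n \<Rightarrow> real^'n) \<Rightarrow> (real^'n \<Rightarrow> real^'n^'n) \<Rightarrow> bool"
  where "C2_on \<Omega> \<phi> D\<phi> H\<phi> \<longleftrightarrow>
    (\<forall>x\<in>\<Omega>. GDERIV \<phi> x :> D\<phi> x) \<and>
    (\<forall>x\<in>\<Omega>. (D\<phi> has_derivative (\<lambda>h. H\<phi> x *v h)) (at x)) \<and>
    continuous_on \<Omega> H\<phi>"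

definition super_sub_solution ::
  "'m::finite set \<Rightarrow> (real^'n) set \<Rightarrow> ('n, 'm) operator \<Rightarrow> (real^'n \<Rightarrow> real^'m) \<Rightarrow> bool"
  where "super_sub_solution J \<Omega> F u \<longleftrightarrow>
    bounded (u ` \<Omega>) \<and>
    (\<forall>x\<in>\<Omega>.
      (\<forall>j\<in>J. \<forall>\<phi> D\<phi> H\<phi>. C2_on \<Omega> \<phi> D\<phi> H\<phi> \<longrightarrow>
          touches_below \<phi> (lower_env \<Omega> (\<lambda>y. u y $ j)) x \<longrightarrow>
          F j x (join J (lower_env_vec \<Omega> u x) (upper_env_vec \<Omega> u x)) (D\<phi> x) (H\<phi> x) \<ge> 0) \<and>
      (\<forall>j\<in>-J. \<forall>\<phi> D\<phi> H\<phi>. C2_on \<Omega> \<phi> D\<phi> H\<phi> \<longrightarrow>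
          touches_above \<phi> (upper_env \<Omega> (\<lambda>y. u y $ j)) x \<longrightarrow>
          F j x (join J (lower_env_vec \<Omega> u x) (upper_env_vec \<Omega> u x)) (D\<phi> x) (H\<phi> x) \<le> 0))"

definition sub_super_solution ::
  "'m::finite set \<Rightarrow> (real^'n) set \<Rightarrow> ('n, 'm) operator \<Rightarrow> (real^'n \<Rightarrow> real^'m) \<Rightarrow> bool"
  where "sub_super_solution J \<Omega> F u \<longleftrightarrow>
    bounded (u ` \<Omega>) \<and>
    (\<forall>x\<in>\<Omega>.
      (\<forall>j\<in>J. \<forall>\<phi> D\<phi> H\<phi>. C2_on \<Omega> \<phi> D\<phi> H\<phi> \<longrightarrow>
          touches_above \<phi> (upper_env \<Omega> (\<lambda>y. u y $ j)) x \<longrightarrow>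
          F j x (join J (upper_env_vec \<Omega> u x) (lower_env_vec \<Omega> u x)) (D\<phi> x) (H\<phi> x) \<le> 0) \<and>
      (\<forall>j\<in>-J. \<forall>\<phi> D\<phi> H\<phi>. C2_on \<Omega> \<phi> D\<phi> H\<phi> \<longrightarrow>
          touches_below \<phi> (lower_env \<Omega> (\<lambda>y. u y $ j)) x \<longrightarrow>
          F j x (join J (upper_env_vec \<Omega> u x) (lower_env_vec \<Omega> u x)) (D\<phi> x) (H\<phi> x) \<ge> 0))"

end

(* If the conclusion fails, maximize A_i(x) - b_i(y) - (alpha/2)|x - y|^2 over the closure of Omega and over
   all indices i, where A_i is the upper envelope of u_i (first group) or v_i (second group) and b_i the
   lower envelope of the other function.  As alpha grows, the maximum points converge to an interior
   point and alpha |x - y|^2 tends to 0.  The theorem on sums gives matrices X, Y satisfying the bounds of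
   (ii) such that (alpha (x - y), X) and (alpha (x - y), -Y) are limits of second-order jets of A_i and
   b_i; the differential inequalities pass to these limits because quasi-monotonicity has the right sign
   for the semicontinuity of the other components.  Then (i') and (ii) contradict each other.

   For the theorem on sums, sup-convolution turns the problem into one for a convex function G touched
   from above by a quadratic form.  The resolvent (I + dG)^-1 is nonexpansive, hence differentiable almost
   everywhere by Rademacher's theorem, and a small perturbation q of the quadratic form is a Lipschitz
   image of the corresponding resolvent argument.  Hence for some small q the resolvent is differentiable
   at that argument, and its derivative can be inverted to obtain the Hessian of G. *)

theory Submission
  imports Defs
begin

section \<open>Rademacher's theorem\<close>

text \<open>Two obstacles shape the argument. Along the points that approximate a jet only the
  touched component converges; the other envelopes are merely semicontinuous. They are replaced by
  maxima or minima with their values at the limit point, which do converge, and quasi-monotonicity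
  pays for the change. Secondly, (i') refers to the largest difference over both groups, while the
  two groups are evaluated at opposite points. Maximizing over the indices too makes the active
  index the largest one, and the symmetry of the penalization lets x and y be exchanged for the
  other group. Replacing J by its complement turns super-sub solutions into sub-super solutions, so
  one limit argument serves both u and v. The 3 in (ii) is the number of terms in x - y = (\<xi> -
  \<eta>) + (x - \<xi>) + (\<eta> - y), where \<xi>, \<eta> are the variables of the
  sup-convolutions: with parameter 3 \<alpha> the squares of the last two terms are exactly the
  convolution penalties.\<close>

text \<open>The Vitali covering consists of image intervals \<open>{g s..g t}\<close>, so what it
  misses is a null set in the image itself and \<open>g\<close> never has to map a null set. The
  selected intervals have disjoint preimages inside \<open>U\<close>, and each is at most
  \<open>p\<close> times as long as its preimage.\<close>

lemma emeasure_image_le_of_slope_le: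
  fixes g :: "real \<Rightarrow> real"
  assumes g: "strict_mono g" "continuous_on UNIV g" and p: "0 < p" and A: "A \<in> sets lebesgue"
    and slope: "\<And>x d. x \<in> A \<Longrightarrow> 0 < d \<Longrightarrow> \<exists>y. y \<noteq> x \<and> \<bar>y - x\<bar> < d \<and> \<bar>g y - g x\<bar> \<le> p * \<bar>y - x\<bar>"
  shows "emeasure lebesgue (g ` A) \<le> ennreal p * emeasure lebesgue A"
proof (rule ennreal_le_epsilon)
  fix e :: real assume e: "0 < e"
  \<comment> \<open>The surplus \<open>e / p\<close> of \<open>U\<close> over \<open>A\<close>
    becomes \<open>e\<close> after multiplication by \<open>p\<close>.\<close>
  obtain U where U: "open U" "A \<subseteq> U" "U - A \<in> lmeasurable" "emeasure lebesgue (U - A) < ennreal (e / p)"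
    using sets_lebesgue_outer_open[OF A, of "e / p"] e p by auto
  define K where "K = {(s, t). s < t \<and> {s..t} \<subseteq> U \<and> g t - g s \<le> p * (t - s)}"
  define a where "a = (\<lambda>(s, t). (g s + g t) / 2)"
  define r where "r = (\<lambda>(s, t). (g t - g s) / 2)"
  have ball: "cball (a (s, t)) (r (s, t)) = {g s..g t}" for s t
    by (auto simp: a_def r_def cball_eq_atLeastAtMost field_simps)
  have cov: "\<exists>i. i \<in> K \<and> y \<in> cball (a i) (r i) \<and> r i < d" if y: "y \<in> g ` A" and "0 < d" for y d
  proof -
    obtain x where x: "x \<in> A" "y = g x" using y by auto
    obtain c where c: "c > 0" "ball x c \<subseteq> U" using U(1,2) x(1) by (meson openE subsetD)
    \<comment> \<open>\<open>c\<close> keeps the interval inside \<open>U\<close>;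
      \<open>d / p\<close> keeps its image shorter than \<open>d\<close>.\<close>
    obtain z where z: "z \<noteq> x" "\<bar>z - x\<bar> < min c (d / p)" "\<bar>g z - g x\<bar> \<le> p * \<bar>z - x\<bar>"
      using slope[OF x(1), of "min c (d / p)"] c \<open>0 < d\<close> p by auto
    define i where "i = (min x z, max x z)"
    have sub: "{min x z..max x z} \<subseteq> U"
      using z(2) by (intro order.trans[OF _ c(2)]) (auto simp: dist_real_def)
    have mono: "g (min x z) \<le> g x" "g x \<le> g (max x z)"
      using g(1) by (auto simp: min_def max_def strict_mono_less_eq)
    have len: "g (max x z) - g (min x z) = \<bar>g z - g x\<bar>" "max x z - min x z = \<bar>z - x\<bar>"
      using strict_mono_less_eq[OF g(1), of x z] by (auto simp: min_def max_def)
    have "p * \<bar>z - x\<bar> < d" using z(2) p by (simp add: field_simps)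
    moreover have "min x z < max x z" using z(1) by linarith
    then have "i \<in> K" unfolding i_def K_def using z sub len by simp
    moreover have "y \<in> cball (a i) (r i)" using mono by (simp add: i_def ball x(2) del: mem_cball)
    moreover have "r i \<le> p * \<bar>z - x\<bar>" using z(3) len abs_ge_zero[of "g z - g x"] by (simp add: i_def r_def; linarith)
    ultimately show ?thesis by (intro exI[of _ i]) auto
  qed
  have rpos: "0 < r i" if "i \<in> K" for i
    using that g(1) by (auto simp: K_def r_def strict_mono_def)
  obtain C where C: "countable C" "C \<subseteq> K"
     "pairwise (\<lambda>i j. disjnt (cball (a i) (r i)) (cball (a j) (r j))) C"
     "negligible (g ` A - (\<Union>i\<in>C. cball (a i) (r i)))"
    using Vitali_covering_theorem_cballs[of K r "g ` A" a, OF rpos cov] by blast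
  define I where "I = (\<lambda>i. {fst i..snd i :: real})"
  define H where "H = (\<lambda>i. {g (fst i)..g (snd i)})"
  have HC: "cball (a i) (r i) = H i" for i using ball[of "fst i" "snd i"] by (simp add: H_def)
  have gI: "g x \<in> H i" if "x \<in> I i" for i x
    using g(1) that by (auto simp: I_def H_def strict_mono_less_eq)
  have disH: "disjoint_family_on H C"
    using C(3) by (auto simp: disjoint_family_on_def pairwise_def disjnt_def HC)
  then have disI: "disjoint_family_on I C"
    unfolding disjoint_family_on_def using gI by blast
  have null: "g ` A - (\<Union>i\<in>C. H i) \<in> null_sets lebesgue"
    using C(4) by (simp add: HC negligible_iff_null_sets)
  have UH: "(\<Union>i\<in>C. H i) \<in> sets lebesgue"
    using C(1) by (intro sets.countable_UN') (auto simp: H_def)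
  have "emeasure lebesgue (g ` A) \<le> emeasure lebesgue ((\<Union>i\<in>C. H i) \<union> (g ` A - (\<Union>i\<in>C. H i)))"
    using null UH by (intro emeasure_mono sets.Un) auto
  also have "\<dots> = emeasure lebesgue (\<Union>i\<in>C. H i)"
    by (rule emeasure_Un_null_set[OF UH null])
  also have "\<dots> = (\<integral>\<^sup>+i. emeasure lebesgue (H i) \<partial>count_space C)"
    using C(1) disH by (intro emeasure_UN_countable) (auto simp: H_def)
  also have "\<dots> \<le> (\<integral>\<^sup>+i. ennreal p * emeasure lebesgue (I i) \<partial>count_space C)"
  proof (rule nn_integral_mono)
    fix i assume "i \<in> space (count_space C)"
    then have i: "fst i < snd i" "g (snd i) - g (fst i) \<le> p * (snd i - fst i)"
      using C(2) by (auto simp: K_def)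
    then show "emeasure lebesgue (H i) \<le> ennreal p * emeasure lebesgue (I i)"
      using p g(1) by (auto simp: H_def I_def strict_mono_less_eq ennreal_mult[symmetric] intro!: ennreal_leI)
  qed
  also have "\<dots> = ennreal p * (\<integral>\<^sup>+i. emeasure lebesgue (I i) \<partial>count_space C)"
    by (intro nn_integral_cmult) auto
  also have "(\<integral>\<^sup>+i. emeasure lebesgue (I i) \<partial>count_space C) = emeasure lebesgue (\<Union>i\<in>C. I i)"
    using C(1) disI by (intro emeasure_UN_countable[symmetric]) (auto simp: I_def)
  also have "\<dots> \<le> emeasure lebesgue (A \<union> (U - A))"
  proof (rule emeasure_mono)
    show "\<Union> (I ` C) \<subseteq> A \<union> (U - A)" using C(2) by (auto simp: K_def I_def subset_iff)
  qed (use A U(1) in auto)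
  also have "\<dots> \<le> emeasure lebesgue A + emeasure lebesgue (U - A)"
    using A U(3) by (intro emeasure_subadditive) auto
  also have "\<dots> \<le> emeasure lebesgue A + ennreal (e / p)"
    using U(4) by (intro add_left_mono) simp
  finally have "emeasure lebesgue (g ` A) \<le> ennreal p * (emeasure lebesgue A + ennreal (e / p))"
    by (simp add: mult_left_mono)
  also have "\<dots> = ennreal p * emeasure lebesgue A + ennreal e"
    using p e by (simp add: distrib_left ennreal_mult[symmetric])
  finally show "emeasure lebesgue (g ` A) \<le> ennreal p * emeasure lebesgue A + ennreal e" .
qed

section \<open>Oscillation of difference quotients in one direction\<close>

text \<open>A Lipschitz function can lack a derivative in direction \<open>b\<close> only where its
  difference quotients oscillate across some rational interval; these are the exceptional sets,
  countably many for rational \<open>p < q\<close>.\<close>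

definition slope_gap :: "('a::real_normed_vector \<Rightarrow> real) \<Rightarrow> 'a \<Rightarrow> real \<Rightarrow> real \<Rightarrow> 'a set"
  where "slope_gap f b p q = {x. \<forall>d>0.
    (\<exists>h. h \<noteq> 0 \<and> \<bar>h\<bar> < d \<and> (f (x + h *\<^sub>R b) - f x) / h < p) \<and>
    (\<exists>h. h \<noteq> 0 \<and> \<bar>h\<bar> < d \<and> q < (f (x + h *\<^sub>R b) - f x) / h)}"

text \<open>With \<open>d\<close> restricted to reciprocals of integers the set is a countable
  intersection of open sets: the uncountable union over \<open>h\<close> is harmless because each
  member is open.\<close>

lemma slope_gap_borel:
  assumes f: "continuous_on UNIV f"
  shows "slope_gap f b p q \<in> sets borel"
proof -
  define H where "H = (\<lambda>n::nat. {h::real. h \<noteq> 0 \<and> \<bar>h\<bar> < inverse (Suc n)})"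
  have ex: "(\<forall>d>0. \<exists>h. h \<noteq> 0 \<and> \<bar>h\<bar> < d \<and> P h) \<longleftrightarrow> (\<forall>n. \<exists>h\<in>H n. P h)" for P :: "real \<Rightarrow> bool"
  proof (intro iffI allI impI)
    fix d :: real assume "\<forall>n. \<exists>h\<in>H n. P h" "0 < d"
    then obtain n where n: "inverse (Suc n) < d" "\<exists>h\<in>H n. P h" using reals_Archimedean by blast
    then show "\<exists>h. h \<noteq> 0 \<and> \<bar>h\<bar> < d \<and> P h" unfolding H_def by (auto intro: less_trans)
  qed (auto simp: H_def)
  have eq: "slope_gap f b p q = (\<Inter>n. \<Union>h\<in>H n. {x. (f (x + h *\<^sub>R b) - f x) / h < p})
      \<inter> (\<Inter>n. \<Union>h\<in>H n. {x. q < (f (x + h *\<^sub>R b) - f x) / h})"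
    unfolding slope_gap_def all_conj_distrib imp_conjR ex by auto
  have cont: "continuous_on UNIV (\<lambda>x. (f (x + h *\<^sub>R b) - f x) / h)" if "h \<in> H n" for h n
    using that by (auto simp: H_def intro!: continuous_intros f continuous_on_compose2[OF f])
  have "open (\<Union>h\<in>H n. {x. (f (x + h *\<^sub>R b) - f x) / h < p})"
       "open (\<Union>h\<in>H n. {x. q < (f (x + h *\<^sub>R b) - f x) / h})" for n
    by (intro open_UN ballI open_Collect_less cont continuous_intros; assumption)+
  then show ?thesis unfolding eq by (intro sets.Int sets.countable_INT'') (auto intro: borel_open)
qed

text \<open>Once the slopes are shifted to be positive, slopes below \<open>p\<close> bound the
  measure of the image from above and slopes above \<open>q\<close> bound it from below. A bounded
  piece \<open>A\<close> then satisfies |A| \<le> (p + c) / (q + c) |A| with a factor less than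
  1.\<close>

lemma slope_gap_negligible_real:
  fixes g :: "real \<Rightarrow> real"
  assumes L: "L-lipschitz_on UNIV g" and pq: "p < q"
  shows "negligible (slope_gap g 1 p q)"
proof (cases "p \<le> - L")
  case True
  have "\<not> (g (x + h) - g x) / h < p" if "h \<noteq> 0" for x h
  proof -
    have "\<bar>g (x + h) - g x\<bar> \<le> L * \<bar>h\<bar>" using lipschitz_onD[OF L, of "x + h" x] by (simp add: dist_real_def)
    then have "\<bar>(g (x + h) - g x) / h\<bar> \<le> L" using that by (simp add: field_simps)
    then show ?thesis using True by linarith
  qed
  then have "slope_gap g 1 p q = {}" by (auto simp: slope_gap_def intro: exI[of _ 1])
  then show ?thesis by simp
next
  case False
  have L0: "0 \<le> L" using lipschitz_on_nonneg[OF L] .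
  text \<open>After adding a multiple of the identity, \<open>g\<close> becomes an increasing bi-Lipschitz map; the
    covering estimate is applied to it and to its inverse.\<close>
  define c where "c = L + 1"
  define k where "k s = g s + c * s" for s
  have gL: "\<bar>g y - g x\<bar> \<le> L * \<bar>y - x\<bar>" for x y
    using lipschitz_onD[OF L, of y x] by (simp add: dist_real_def)
  have kx: "y - x \<le> k y - k x \<and> k y - k x \<le> (2 * L + 1) * (y - x)" if "x \<le> y" for x y
    using gL[of y x] that unfolding k_def c_def by (auto simp: algebra_simps abs_le_iff)
  have kabs: "\<bar>y - x\<bar> \<le> \<bar>k y - k x\<bar> \<and> \<bar>k y - k x\<bar> \<le> (2 * L + 1) * \<bar>y - x\<bar>" for x y
  proof (cases "x \<le> y")
    case True then show ?thesis using kx[of x y] by auto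
  next
    case False
    then have "x - y \<le> k x - k y" "k x - k y \<le> (2 * L + 1) * (x - y)" "y < x" using kx[of y x] by auto
    then show ?thesis by auto
  qed
  have smk: "strict_mono k" using kx by (intro strict_monoI) (smt (verit))
  have gc: "continuous_on UNIV g" using L by (rule lipschitz_on_continuous_on)
  have ck: "continuous_on UNIV k" unfolding k_def by (intro continuous_intros gc)
  have "\<exists>x. k x = y" for y
  proof -
    define r where "r = \<bar>y\<bar> + \<bar>k 0\<bar>"
    have "k (- r) \<le> y" "y \<le> k r"
      using kx[of "- r" 0] kx[of 0 r] by (auto simp: r_def abs_if split: if_splits)
    then show ?thesis
      using IVT'[of k "- r" y r] continuous_on_subset[OF ck] by (auto simp: r_def)
  qed
  then have surj: "surj k" by (metis surjI)
  have inj: "inj k" using smk by (rule strict_mono_imp_inj_on)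
  define l where "l = inv k"
  have kl: "k (l y) = y" and lk: "l (k x) = x" for x y
    using surj inj by (auto simp: l_def surj_f_inv_f)
  have labs: "\<bar>l y - l x\<bar> \<le> \<bar>y - x\<bar>" for x y using kabs[of "l y" "l x"] by (simp add: kl abs_minus_commute)
  have sml: "strict_mono l" using smk by (intro strict_monoI) (metis kl strict_mono_less)
  have "1-lipschitz_on UNIV l" using labs by (intro lipschitz_onI) (auto simp: dist_real_def)
  then have cl: "continuous_on UNIV l" by (rule lipschitz_on_continuous_on)
  have slope: "(k (x + h) - k x) / h = (g (x + h) - g x) / h + c" if "h \<noteq> 0" for x h
    using that by (simp add: k_def field_simps)
  have abs_slope: "\<bar>k (x + h) - k x\<bar> = (k (x + h) - k x) / h * \<bar>h\<bar>" if "h \<noteq> 0" for x h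
    using kx[of x "x + h"] kx[of "x + h" x] that by (cases "h > 0") (auto simp: abs_if field_simps)
  have pc: "0 < p + c" using False by (simp add: c_def)
  \<comment> \<open>The cut by a ball makes the measure finite, which the final cancellation
    requires.\<close>
  have neg: "negligible (slope_gap g 1 p q \<inter> cball 0 n)" for n
  proof -
    define A where "A = slope_gap g 1 p q \<inter> cball 0 n"
    have Ab: "A \<in> sets borel" unfolding A_def by (intro sets.Int slope_gap_borel gc) auto
    have img: "k ` A = l -` A" using kl lk by (auto simp: image_iff) metis
    have kA: "k ` A \<in> sets borel"
      unfolding img using cl Ab by (metis borel_measurable_continuous_onI measurable_sets_borel)
    have "emeasure lebesgue (k ` A) \<le> ennreal (p + c) * emeasure lebesgue A"
    proof (rule emeasure_image_le_of_slope_le[OF smk ck pc])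
      fix x d :: real assume "x \<in> A" "0 < d"
      then obtain h where h: "h \<noteq> 0" "\<bar>h\<bar> < d" "(g (x + h) - g x) / h < p"
        unfolding A_def slope_gap_def by (auto simp: Ball_def)
      have "\<bar>k (x + h) - k x\<bar> \<le> (p + c) * \<bar>h\<bar>"
        unfolding abs_slope[OF h(1)] slope[OF h(1)] using h by (intro mult_right_mono) auto
      then show "\<exists>y. y \<noteq> x \<and> \<bar>y - x\<bar> < d \<and> \<bar>k y - k x\<bar> \<le> (p + c) * \<bar>y - x\<bar>"
        using h by (intro exI[of _ "x + h"]) auto
    qed (use Ab in auto)
    moreover have "emeasure lebesgue (l ` (k ` A)) \<le> ennreal (1 / (q + c)) * emeasure lebesgue (k ` A)"
    proof (rule emeasure_image_le_of_slope_le[OF sml cl])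
      fix y d :: real assume "y \<in> k ` A" "0 < d"
      then obtain x where x: "x \<in> A" "y = k x" by auto
      \<comment> \<open>\<open>k\<close> stretches distances at most by \<open>2 * L + 1\<close>, so
        this bound on \<open>h\<close> puts \<open>k (x + h)\<close> within \<open>d\<close> of
        \<open>y\<close>.\<close>
      obtain h where h: "h \<noteq> 0" "\<bar>h\<bar> < d / (2 * L + 1)" "q < (g (x + h) - g x) / h"
        using x(1) \<open>0 < d\<close> L0 unfolding A_def slope_gap_def
        by (auto simp: Ball_def dest: spec[of _ "d / (2 * L + 1)"])
      have le: "(q + c) * \<bar>h\<bar> \<le> \<bar>k (x + h) - k x\<bar>"
        unfolding abs_slope[OF h(1)] slope[OF h(1)] using h by (intro mult_right_mono) auto
      moreover have "\<bar>k (x + h) - k x\<bar> < d"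
        using kabs[of "x + h" x] h(2) L0 by (simp add: field_simps)
      moreover have "k (x + h) \<noteq> k x" using h(1) by (simp add: inj_eq[OF inj])
      moreover from le have "\<bar>h\<bar> \<le> 1 / (q + c) * \<bar>k (x + h) - k x\<bar>"
        using pc pq by (simp add: pos_le_divide_eq mult.commute)
      ultimately show "\<exists>z. z \<noteq> y \<and> \<bar>z - y\<bar> < d \<and> \<bar>l z - l y\<bar> \<le> 1 / (q + c) * \<bar>z - y\<bar>"
        by (intro exI[of _ "k (x + h)"]) (simp add: x(2) lk)
    qed (use pc pq kA in auto)
    moreover have "l ` k ` A = A" by (auto simp: image_iff lk)
    moreover have "emeasure lebesgue A < \<infinity>"
      using Ab bounded_set_imp_lmeasurable[of A]
      by (auto simp: A_def fmeasurable_def less_top intro: bounded_subset[OF bounded_cball])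
    ultimately have "emeasure lebesgue A = 0"
    proof -
      assume 1: "emeasure lebesgue (k ` A) \<le> ennreal (p + c) * emeasure lebesgue A"
        and 2: "emeasure lebesgue (l ` k ` A) \<le> ennreal (1 / (q + c)) * emeasure lebesgue (k ` A)"
        and 3: "l ` k ` A = A" and 4: "emeasure lebesgue A < \<infinity>"
      obtain m where m: "emeasure lebesgue A = ennreal m" "0 \<le> m"
        using 4 by (cases "emeasure lebesgue A") auto
      have "ennreal m \<le> ennreal (1 / (q + c)) * (ennreal (p + c) * ennreal m)"
        using 1 2 unfolding 3 m(1) by (meson mult_left_mono order_trans zero_le)
      also have "\<dots> = ennreal (1 / (q + c) * ((p + c) * m))"
        using pc pq m by (simp add: ennreal_mult[symmetric])
      finally have "m \<le> 1 / (q + c) * ((p + c) * m)"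
        using pc pq m by (simp add: ennreal_le_iff)
      then have "(q + c) * m \<le> (p + c) * m" using pc pq by (simp add: field_simps)
      then have "m \<le> 0" using pq m(2) by (simp add: mult_le_cancel_right)
      then show ?thesis using m by simp
    qed
    then have "A \<in> null_sets lebesgue" using Ab by auto
    then show ?thesis by (simp add: negligible_iff_null_sets A_def)
  qed
  then have "negligible (\<Union>n::nat. slope_gap g 1 p q \<inter> cball 0 (real n))"
    by (intro negligible_countable_Union) auto
  moreover have "slope_gap g 1 p q \<subseteq> (\<Union>n::nat. slope_gap g 1 p q \<inter> cball 0 (real n))"
    using real_arch_simple by auto
  ultimately show ?thesis by (rule negligible_subset)
qed

text \<open>Fubini is used on the product of the space with an interval of translation parameters;
  invariance of the measure under translations spares a choice of coordinates adapted to
  \<open>b\<close>.\<close>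

lemma slope_gap_negligible:
  fixes f :: "'a::euclidean_space \<Rightarrow> real"
  assumes L: "L-lipschitz_on UNIV f" and pq: "p < q"
  shows "negligible (slope_gap f b p q)"
proof -
  define A where "A = slope_gap f b p q"
  have A [measurable]: "A \<in> sets borel"
    unfolding A_def by (intro slope_gap_borel lipschitz_on_continuous_on[OF L])
  have line: "emeasure lborel {s. x + s *\<^sub>R b \<in> A} = 0" for x
  proof -
    have "{s. x + s *\<^sub>R b \<in> A} = slope_gap (\<lambda>s. f (x + s *\<^sub>R b)) 1 p q"
      by (simp add: A_def slope_gap_def algebra_simps)
    moreover have "(L * norm b)-lipschitz_on UNIV (\<lambda>s. f (x + s *\<^sub>R b))"
    proof (rule lipschitz_onI)
      fix s t :: real
      have "dist (x + s *\<^sub>R b) (x + t *\<^sub>R b) = norm b * dist s t"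
        by (simp add: dist_norm flip: scaleR_left_diff_distrib)
      then show "dist (f (x + s *\<^sub>R b)) (f (x + t *\<^sub>R b)) \<le> L * norm b * dist s t"
        using lipschitz_onD[OF L, of "x + s *\<^sub>R b" "x + t *\<^sub>R b"] by (simp only: UNIV_I mult.assoc)
    qed (use lipschitz_on_nonneg[OF L] in simp)
    ultimately have "negligible {s. x + s *\<^sub>R b \<in> A}" using slope_gap_negligible_real pq by metis
    moreover have "{s. x + s *\<^sub>R b \<in> A} \<in> sets borel" by measurable
    ultimately show ?thesis by (auto simp: negligible_iff_null_sets null_sets_def)
  qed
  have shift: "(\<integral>\<^sup>+x. indicator A (x + c) \<partial>lborel) = emeasure lborel A" for c
  proof -
    have "(\<integral>\<^sup>+x. indicator A (x + c) \<partial>lborel) = (\<integral>\<^sup>+x. indicator A x \<partial>distr lborel borel ((+) c))"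
      by (subst nn_integral_distr) (auto simp: add.commute)
    then show ?thesis by (simp add: lborel_distr_plus)
  qed
  text \<open>Averaging over translates of \<open>A\<close> in direction \<open>b\<close> reduces the claim to its sections by lines.\<close>
  have "emeasure lborel A = (\<integral>\<^sup>+s. emeasure lborel A * indicator {0..1::real} s \<partial>lborel)"
    by (simp add: nn_integral_cmult_indicator)
  also have "\<dots> = (\<integral>\<^sup>+s. (\<integral>\<^sup>+x. indicator A (x + s *\<^sub>R b) * indicator {0..1::real} s \<partial>lborel) \<partial>lborel)"
    by (subst nn_integral_multc) (auto simp: shift)
  also have "\<dots> = (\<integral>\<^sup>+x. (\<integral>\<^sup>+s. indicator A (x + s *\<^sub>R b) * indicator {0..1::real} s \<partial>lborel) \<partial>lborel)"
    by (rule lborel_pair.Fubini') measurable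
  also have "\<dots> \<le> (\<integral>\<^sup>+x. (\<integral>\<^sup>+s. indicator {s. x + s *\<^sub>R b \<in> A} s \<partial>lborel) \<partial>(lborel :: 'a measure))"
    by (intro nn_integral_mono) (auto split: split_indicator)
  also have "\<dots> = 0" by (subst nn_integral_indicator) (auto simp: line)
  finally have "A \<in> null_sets lborel" by (auto simp: null_sets_def)
  then show ?thesis by (auto simp: A_def negligible_iff_null_sets null_sets_completionI)
qed

lemma directional_derivative_if_no_slope_gap:
  assumes L: "L-lipschitz_on UNIV f"
    and gap: "\<And>p q. p \<in> \<rat> \<Longrightarrow> q \<in> \<rat> \<Longrightarrow> p < q \<Longrightarrow> x \<notin> slope_gap f b p q"
  shows "\<exists>l. \<forall>e>0. \<exists>d>0. \<forall>h. \<bar>h\<bar> < d \<longrightarrow> \<bar>f (x + h *\<^sub>R b) - f x - h * l\<bar> \<le> e * \<bar>h\<bar>"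
proof -
  define Q where "Q h = (f (x + h *\<^sub>R b) - f x) / h" for h
  define M where "M = L * norm b"
  have Qb: "\<bar>Q h\<bar> \<le> M" if "h \<noteq> 0" for h
    using lipschitz_onD[OF L, of "x + h *\<^sub>R b" x] that
    by (simp add: Q_def M_def dist_norm field_simps)
  define S where "S = {p. \<forall>d>0. \<exists>h. h \<noteq> 0 \<and> \<bar>h\<bar> < d \<and> Q h < p}"
  have up: "p' \<in> S" if "p \<in> S" "p \<le> p'" for p p'
    using that unfolding S_def by (auto; meson less_le_trans)
  have lb: "- M \<le> p" if "p \<in> S" for p
  proof -
    obtain h where "h \<noteq> 0" "Q h < p" using \<open>p \<in> S\<close> by (auto simp: S_def dest: spec[of _ 1])
    then show ?thesis using Qb[of h] by auto
  qed
  have "\<exists>h. h \<noteq> 0 \<and> \<bar>h\<bar> < d \<and> Q h < M + 1" if "d > 0" for d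
    using Qb[of "d / 2"] that by (intro exI[of _ "d / 2"]) auto
  then have ne: "M + 1 \<in> S" by (simp add: S_def)
  have bdd: "bdd_below S" by (rule bdd_belowI[OF lb])
  \<comment> \<open>The infimum of \<open>S\<close> is the lower limit of the quotients
    \<open>Q h\<close> as \<open>h\<close> tends to 0.\<close>
  define l where "l = Inf S"
  have "\<exists>d>0. \<forall>h. \<bar>h\<bar> < d \<longrightarrow> \<bar>f (x + h *\<^sub>R b) - f x - h * l\<bar> \<le> e * \<bar>h\<bar>" if e: "e > 0" for e
  proof -
    \<comment> \<open>Rational \<open>p < q\<close> are placed just above \<open>l\<close>.
      Quotients below \<open>p\<close> occur arbitrarily near 0, so in the absence of a gap they
      eventually stay at or below \<open>q\<close>.\<close>
    obtain p where p: "p \<in> \<rat>" "l < p" "p < l + e / 2"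
      using Rats_dense_in_real[of l "l + e / 2"] e by auto
    obtain q where q: "q \<in> \<rat>" "p < q" "q < l + e"
      using Rats_dense_in_real[of p "l + e"] p e by auto
    obtain s where "s \<in> S" "s < p" using cInf_lessD[of S p] p ne l_def by blast
    then have pS: "p \<in> S" using up[of s p] by simp
    then obtain d1 where d1: "d1 > 0" "\<And>h. h \<noteq> 0 \<Longrightarrow> \<bar>h\<bar> < d1 \<Longrightarrow> Q h \<le> q"
    proof -
      have "\<exists>d>0. \<forall>h. h \<noteq> 0 \<and> \<bar>h\<bar> < d \<longrightarrow> Q h \<le> q"
        using gap[OF p(1) q(1,2)] pS unfolding slope_gap_def S_def Q_def mem_Collect_eq
        by (metis not_less)
      then show ?thesis using that by blast
    qed
    have "l - e \<notin> S" using cInf_lower[OF _ bdd, of "l - e"] e by (auto simp: l_def)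
    then obtain d2 where d2: "d2 > 0" "\<And>h. h \<noteq> 0 \<Longrightarrow> \<bar>h\<bar> < d2 \<Longrightarrow> l - e \<le> Q h"
      unfolding S_def mem_Collect_eq by (metis not_less)
    have "\<bar>f (x + h *\<^sub>R b) - f x - h * l\<bar> \<le> e * \<bar>h\<bar>" if h: "\<bar>h\<bar> < min d1 d2" for h
    proof (cases "h = 0")
      case False
      then have "\<bar>Q h - l\<bar> \<le> e" using d1(2)[of h] d2(2)[of h] h q by auto
      then have "\<bar>Q h - l\<bar> * \<bar>h\<bar> \<le> e * \<bar>h\<bar>" by (intro mult_right_mono) auto
      moreover have "f (x + h *\<^sub>R b) - f x - h * l = (Q h - l) * h"
        using False by (simp add: Q_def field_simps)
      ultimately show ?thesis by (simp add: abs_mult)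
    qed auto
    then show ?thesis using d1 d2 by (intro exI[of _ "min d1 d2"]) auto
  qed
  then show ?thesis by blast
qed

section \<open>Differentiability along coordinate subspaces\<close>

text \<open>Frechet differentiability of the restriction of \<open>f\<close> to the affine space
  through \<open>x\<close> spanned by \<open>B\<close>, the span being written as the vectors
  orthogonal to the other basis vectors. For \<open>B = Basis\<close> the side condition is
  void.\<close>

definition differentiable_along :: "'a::euclidean_space set \<Rightarrow> ('a \<Rightarrow> real) \<Rightarrow> 'a \<Rightarrow> bool"
  where "differentiable_along B f x \<longleftrightarrow> (\<exists>D. linear D \<and> (\<forall>e>0. \<exists>d>0. \<forall>h.
    (\<forall>c\<in>Basis - B. h \<bullet> c = 0) \<longrightarrow> norm h < d \<longrightarrow> \<bar>f (x + h) - f x - D h\<bar> \<le> e * norm h))"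

text \<open>The distance to \<open>A\<close> is minimal at \<open>x\<close>, so its derivative
  vanishes: adding the expansions at \<open>h\<close> and \<open>- h\<close> cancels
  \<open>D h\<close>.\<close>

lemma infdist_small_along:
  assumes "differentiable_along B (\<lambda>y. infdist y A) x" "x \<in> A" "0 < e"
  shows "\<exists>d>0. \<forall>h. (\<forall>c\<in>Basis - B. h \<bullet> c = 0) \<longrightarrow> norm h < d \<longrightarrow> infdist (x + h) A \<le> e * norm h"
proof -
  obtain D where D: "linear D" and "\<And>e. e > 0 \<Longrightarrow> \<exists>d>0. \<forall>h. (\<forall>c\<in>Basis - B. h \<bullet> c = 0) \<longrightarrow> norm h < d
      \<longrightarrow> \<bar>infdist (x + h) A - infdist x A - D h\<bar> \<le> e * norm h"
    using assms(1) unfolding differentiable_along_def by blast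
  from this(2)[of "e / 2"] assms(2,3) obtain d where d: "d > 0"
    and *: "\<And>h. (\<forall>c\<in>Basis - B. h \<bullet> c = 0) \<Longrightarrow> norm h < d \<Longrightarrow> \<bar>infdist (x + h) A - D h\<bar> \<le> e / 2 * norm h"
    by auto
  have "infdist (x + h) A \<le> e * norm h" if h: "\<forall>c\<in>Basis - B. h \<bullet> c = 0" "norm h < d" for h
  proof -
    have "\<bar>infdist (x + h) A - D h\<bar> \<le> e / 2 * norm h" using *[of h] h by blast
    moreover have "\<bar>infdist (x - h) A + D h\<bar> \<le> e / 2 * norm h"
      using *[of "- h"] h by (simp add: linear_neg[OF D])
    ultimately show ?thesis using infdist_nonneg[of "x - h" A] by argo
  qed
  then show ?thesis using d by blast
qed

text \<open>Directional derivatives at a point need not combine to a differential, so some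
  uniformity near the point is required. The induction is over all Lipschitz functions because its
  hypothesis is applied to distance functions as well as to \<open>f\<close>; their
  differentiability takes the place of a density point argument.\<close>

lemma negligible_not_differentiable_along:
  fixes f :: "'a::euclidean_space \<Rightarrow> real"
  assumes "finite B" "B \<subseteq> Basis" "L-lipschitz_on UNIV f"
  shows "negligible {x. \<not> differentiable_along B f x}"
  using assms
proof (induction B arbitrary: f L rule: finite_induct)
  case empty
  have "h = 0" if "\<forall>c\<in>Basis. h \<bullet> c = 0" for h :: 'a
    using that by (simp add: euclidean_eq_iff[of h 0])
  then have "differentiable_along {} f x" for x
    unfolding differentiable_along_def
    by (intro exI[of _ "\<lambda>_. 0"]) (fastforce simp: module_hom_zero intro: exI[of _ 1])
  then show ?case by simp
next
  case (insert b B)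
  have b: "b \<in> Basis" "B \<subseteq> Basis" and L: "L-lipschitz_on UNIV f" using insert.prems by auto
  have fL: "\<bar>f y - f x\<bar> \<le> L * norm (y - x)" for x y
    using lipschitz_onD[OF L, of y x] by (simp add: dist_norm)
  have L0: "0 \<le> L" using lipschitz_on_nonneg[OF L] .
  text \<open>On the closed set \<open>A n k c\<close> the difference quotients of \<open>f\<close> in direction \<open>b\<close> are uniformly
    close to \<open>c\<close>.  Where the distance to this set is differentiable along \<open>B\<close>, its derivative at a point
    of the set vanishes, so the set contains points within \<open>o(|h|)\<close> of \<open>x + h\<close>; there the estimate in
    direction \<open>b\<close> can be combined with the expansion along \<open>B\<close>.\<close>
  define A where "A n k c = {x. \<forall>t. \<bar>t\<bar> < inverse (real (Suc k)) \<longrightarrow>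
      \<bar>f (x + t *\<^sub>R b) - f x - t * c\<bar> \<le> \<bar>t\<bar> * inverse (real (Suc n))}" for n k :: nat and c :: real
  have fc: "continuous_on UNIV f" using L by (rule lipschitz_on_continuous_on)
  have Acl: "closed (A n k c)" for n k c
  proof -
    have "A n k c = (\<Inter>t\<in>{t. \<bar>t\<bar> < inverse (real (Suc k))}.
        {x. \<bar>f (x + t *\<^sub>R b) - f x - t * c\<bar> \<le> \<bar>t\<bar> * inverse (real (Suc n))})"
      by (auto simp: A_def)
    also have "closed \<dots>"
      by (intro closed_INT ballI closed_Collect_le continuous_intros fc continuous_on_compose2[OF fc]) auto
    finally show ?thesis .
  qed
  have idL: "1-lipschitz_on UNIV (\<lambda>y. infdist y (A n k c))" for n k c
    by (intro lipschitz_onI) (auto simp: dist_real_def infdist_triangle_abs)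
  define N where "N = {x. \<not> differentiable_along B f x}
      \<union> (\<Union>(p, q)\<in>{(p, q). p \<in> \<rat> \<and> q \<in> \<rat> \<and> p < q}. slope_gap f b p q)
      \<union> (\<Union>n k. \<Union>c\<in>\<rat>. {x. \<not> differentiable_along B (\<lambda>y. infdist y (A n k c)) x})"
  have "countable {(p, q). p \<in> \<rat> \<and> q \<in> \<rat> \<and> p < (q::real)}"
    by (rule countable_subset[of _ "\<rat> \<times> \<rat>"]) (auto simp: countable_rat)
  then have "negligible N"
    unfolding N_def
    by (intro negligible_Un negligible_countable_Union countable_image)
      (auto simp: countable_rat intro!: insert.IH[OF b(2) L] insert.IH[OF b(2) idL]
        slope_gap_negligible[OF L] negligible_countable_Union)
  moreover have "differentiable_along (insert b B) f x" if "x \<notin> N" for x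
  proof -
    have dB: "differentiable_along B f x"
      and gap: "\<And>p q. p \<in> \<rat> \<Longrightarrow> q \<in> \<rat> \<Longrightarrow> p < q \<Longrightarrow> x \<notin> slope_gap f b p q"
      and dA: "\<And>n k c. c \<in> \<rat> \<Longrightarrow> differentiable_along B (\<lambda>y. infdist y (A n k c)) x"
      using \<open>x \<notin> N\<close> unfolding N_def by blast+
    obtain l where l: "\<And>e. e > 0 \<Longrightarrow> \<exists>d>0. \<forall>h. \<bar>h\<bar> < d \<longrightarrow> \<bar>f (x + h *\<^sub>R b) - f x - h * l\<bar> \<le> e * \<bar>h\<bar>"
      using directional_derivative_if_no_slope_gap[OF L gap] by blast
    obtain D where D: "linear D" "\<And>e. e > 0 \<Longrightarrow> \<exists>d>0. \<forall>h. (\<forall>c\<in>Basis - B. h \<bullet> c = 0) \<longrightarrow> norm h < d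
        \<longrightarrow> \<bar>f (x + h) - f x - D h\<bar> \<le> e * norm h"
      using dB unfolding differentiable_along_def by blast
    define E where "E h = D (h - (h \<bullet> b) *\<^sub>R b) + (h \<bullet> b) * l" for h
    have proj: "(g + h) - ((g + h) \<bullet> b) *\<^sub>R b = (g - (g \<bullet> b) *\<^sub>R b) + (h - (h \<bullet> b) *\<^sub>R b)"
      "r *\<^sub>R h - ((r *\<^sub>R h) \<bullet> b) *\<^sub>R b = r *\<^sub>R (h - (h \<bullet> b) *\<^sub>R b)" for g h r
      by (simp_all add: algebra_simps)
    have "linear E"
      unfolding E_def
      by (intro linearI) (simp_all only: proj linear_add[OF D(1)] linear_scale[OF D(1)],
          simp_all add: inner_add_left distrib_left distrib_right)
    moreover have "\<exists>d>0. \<forall>h. (\<forall>c\<in>Basis - insert b B. h \<bullet> c = 0) \<longrightarrow> norm h < d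
        \<longrightarrow> \<bar>f (x + h) - f x - E h\<bar> \<le> e * norm h" if e: "e > 0" for e
    proof -
      obtain n where n: "inverse (real (Suc n)) < e / 8" using reals_Archimedean[of "e / 8"] e by auto
      define r where "r = inverse (real (Suc n))"
      have r: "0 < r" "r < e / 8" using n by (auto simp: r_def)
      \<comment> \<open>The rational \<open>c\<close> costs \<open>r / 2\<close> and the derivative
        estimate costs another \<open>r / 2\<close>; together they put \<open>x\<close> into
        \<open>A n k c\<close>, a set from the countable family.\<close>
      obtain c where c: "c \<in> \<rat>" "\<bar>c - l\<bar> \<le> r / 2"
        using Rats_dense_in_real[of l "l + r / 2"] r by force
      obtain d0 where d0: "d0 > 0" "\<And>h. \<bar>h\<bar> < d0 \<Longrightarrow> \<bar>f (x + h *\<^sub>R b) - f x - h * l\<bar> \<le> r / 2 * \<bar>h\<bar>"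
        using l[of "r / 2"] r by auto
      obtain k where k: "inverse (real (Suc k)) < d0" using reals_Archimedean[of d0] d0 by auto
      have tc: "\<bar>t * c - t * l\<bar> \<le> r / 2 * \<bar>t\<bar>" for t
        using mult_left_mono[OF c(2), of "\<bar>t\<bar>"] by (simp add: abs_mult[symmetric] algebra_simps)
      have xA: "x \<in> A n k c"
        unfolding A_def r_def[symmetric]
      proof (clarify)
        fix t assume "\<bar>t\<bar> < inverse (real (Suc k))"
        then have "\<bar>f (x + t *\<^sub>R b) - f x - t * l\<bar> \<le> r / 2 * \<bar>t\<bar>" using d0(2)[of t] k by simp
        then show "\<bar>f (x + t *\<^sub>R b) - f x - t * c\<bar> \<le> \<bar>t\<bar> * r"
          using tc[of t] by argo
      qed
      \<comment> \<open>A point of \<open>A n k c\<close> at distance \<open>2 * e2 * norm h\<close>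
        then changes \<open>f\<close> by at most \<open>e / 8 * norm h\<close>; this price is paid
        twice below.\<close>
      define e2 where "e2 = e / (16 * (L + 1))"
      have e2: "e2 > 0" "L * e2 \<le> e / 16" using e L0 by (auto simp: e2_def field_simps)
      obtain d1 where d1: "d1 > 0" "\<And>h. (\<forall>c\<in>Basis - B. h \<bullet> c = 0) \<Longrightarrow> norm h < d1 \<Longrightarrow>
          infdist (x + h) (A n k c) \<le> e2 * norm h"
        using infdist_small_along[OF dA[OF c(1)] xA e2(1)] by blast
      obtain d2 where d2: "d2 > 0" "\<And>h. (\<forall>c\<in>Basis - B. h \<bullet> c = 0) \<Longrightarrow> norm h < d2 \<Longrightarrow>
          \<bar>f (x + h) - f x - D h\<bar> \<le> e / 8 * norm h"
        using D(2)[of "e / 8"] e by auto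
      \<comment> \<open>The halves are there because the projection \<open>g\<close> of
        \<open>h\<close> is only bounded by \<open>2 * norm h\<close>.\<close>
      define d where "d = min (inverse (real (Suc k))) (min d1 d2 / 2)"
      have "\<bar>f (x + h) - f x - E h\<bar> \<le> e * norm h"
        if h: "\<forall>c\<in>Basis - insert b B. h \<bullet> c = 0" "norm h < d" for h
      proof -
        define t where "t = h \<bullet> b"
        define g where "g = h - t *\<^sub>R b"
        have t: "\<bar>t\<bar> \<le> norm h" unfolding t_def using Basis_le_norm[OF b(1)] by simp
        have "norm g \<le> norm h + norm (t *\<^sub>R b)" unfolding g_def by (rule norm_triangle_ineq4)
        then have g2: "norm g \<le> 2 * norm h" using t b by simp
        have gB: "\<forall>c\<in>Basis - B. g \<bullet> c = 0"
          using h(1) b by (auto simp: g_def t_def inner_diff_left inner_Basis)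
        have small: "\<bar>t\<bar> < inverse (real (Suc k))" "norm g < d1" "norm g < d2"
          using h(2) t g2 by (auto simp: d_def)
        obtain y where y: "y \<in> A n k c" "infdist (x + g) (A n k c) = dist (x + g) y"
          using infdist_attains_inf[OF Acl, of n k c "x + g"] xA by blast
        have yd: "norm (x + g - y) \<le> 2 * e2 * norm h"
        proof -
          have "norm (x + g - y) \<le> e2 * norm g"
            using d1(2)[OF gB small(2)] y(2) by (simp add: dist_norm)
          also have "\<dots> \<le> e2 * (2 * norm h)" using g2 e2 by (intro mult_left_mono) auto
          finally show ?thesis by simp
        qed
        have "L * norm (x + g - y) \<le> 2 * (L * e2) * norm h"
          using mult_left_mono[OF yd L0] by (simp add: algebra_simps)
        also have "\<dots> \<le> 2 * (e / 16) * norm h" using e2 by (intro mult_right_mono) auto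
        finally have Ly: "L * norm (x + g - y) \<le> e / 8 * norm h" by simp
        have 1: "\<bar>f (x + h) - f (y + t *\<^sub>R b)\<bar> \<le> e / 8 * norm h"
          using fL[of "x + h" "y + t *\<^sub>R b"] Ly by (simp add: g_def algebra_simps)
        have 2: "\<bar>f (y + t *\<^sub>R b) - f y - t * c\<bar> \<le> e / 8 * norm h"
        proof -
          have "\<bar>f (y + t *\<^sub>R b) - f y - t * c\<bar> \<le> \<bar>t\<bar> * r" using y(1) small(1) by (auto simp: A_def r_def)
          also have "\<dots> \<le> norm h * (e / 8)" using t r by (intro mult_mono) auto
          finally show ?thesis by (simp add: mult.commute)
        qed
        have 3: "\<bar>f y - f (x + g)\<bar> \<le> e / 8 * norm h"
          using fL[of y "x + g"] Ly by (simp add: norm_minus_commute)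
        have 4: "\<bar>f (x + g) - f x - D g\<bar> \<le> e / 4 * norm h"
        proof -
          have "e / 8 * norm g \<le> e / 8 * (2 * norm h)" using g2 e by (intro mult_left_mono) auto
          then show ?thesis using d2(2)[OF gB small(3)] by argo
        qed
        have 5: "\<bar>t * c - t * l\<bar> \<le> e / 8 * norm h"
        proof -
          have "r / 2 * \<bar>t\<bar> \<le> e / 8 * norm h" using t r by (intro mult_mono) auto
          then show ?thesis using tc[of t] by simp
        qed
        \<comment> \<open>The path leads from \<open>x + h\<close> to
          \<open>y + t *\<^sub>R b\<close>, along \<open>b\<close> to \<open>y\<close>, to
          \<open>x + g\<close>, and within the span of \<open>B\<close> to \<open>x\<close>. The
          move along \<open>b\<close> starts from the point \<open>y\<close> of
          \<open>A n k c\<close>, where it is controlled uniformly; the errors add up to 3/4 of the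
          allowance.\<close>
        have "f (x + h) - f x - E h = (f (x + h) - f (y + t *\<^sub>R b)) + (f (y + t *\<^sub>R b) - f y - t * c)
            + (f y - f (x + g)) + (f (x + g) - f x - D g) + (t * c - t * l)"
          by (simp add: E_def g_def t_def)
        moreover have "0 \<le> e * norm h" using e by simp
        ultimately show ?thesis using 1 2 3 4 5 by linarith
      qed
      moreover have "d > 0" using d1 d2 by (simp add: d_def)
      ultimately show ?thesis by blast
    qed
    ultimately show ?thesis unfolding differentiable_along_def by blast
  qed
  ultimately show ?case by (elim negligible_subset) auto
qed

theorem rademacher:
  fixes f :: "'a::euclidean_space \<Rightarrow> 'b::euclidean_space"
  assumes L: "L-lipschitz_on UNIV f"
  shows "negligible {x. \<not> f differentiable (at x)}"
proof -
  have comp: "L-lipschitz_on UNIV (\<lambda>x. f x \<bullet> i)" if "i \<in> Basis" for i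
  proof (rule lipschitz_onI)
    fix x y
    have "dist (f x \<bullet> i) (f y \<bullet> i) = \<bar>(f x - f y) \<bullet> i\<bar>" by (simp add: dist_real_def inner_diff_left)
    also have "\<dots> \<le> dist (f x) (f y)" using Basis_le_norm[OF that] by (simp add: dist_norm)
    also have "\<dots> \<le> L * dist x y" using lipschitz_onD[OF L] by simp
    finally show "dist (f x \<bullet> i) (f y \<bullet> i) \<le> L * dist x y" .
  qed (rule lipschitz_on_nonneg[OF L])
  have "(\<lambda>x. f x \<bullet> i) differentiable (at x)" if d: "differentiable_along Basis (\<lambda>x. f x \<bullet> i) x" for i x
  proof -
    obtain D where D: "linear D" "\<forall>e>0. \<exists>d>0. \<forall>h. norm h < d \<longrightarrow>
        \<bar>f (x + h) \<bullet> i - f x \<bullet> i - D h\<bar> \<le> e * norm h"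
      using d by (auto simp: differentiable_along_def)
    have "((\<lambda>x. f x \<bullet> i) has_derivative D) (at x)"
      unfolding has_derivative_at_alt
    proof (intro conjI allI impI)
      fix e :: real assume "0 < e"
      then obtain d where d: "d > 0" "\<And>h. norm h < d \<Longrightarrow>
        \<bar>f (x + h) \<bullet> i - f x \<bullet> i - D h\<bar> \<le> e * norm h" using D(2) by blast
      then show "\<exists>d>0. \<forall>y. norm (y - x) < d \<longrightarrow> norm (f y \<bullet> i - f x \<bullet> i - D (y - x)) \<le> e * norm (y - x)"
        using d(2)[of "y - x" for y] by (intro exI[of _ d]) auto
    qed (use D(1) in \<open>simp add: linear_conv_bounded_linear\<close>)
    then show ?thesis by (auto simp: differentiable_def)
  qed
  then have "{x. \<not> f differentiable (at x)} \<subseteq> (\<Union>i\<in>Basis. {x. \<not> differentiable_along Basis (\<lambda>x. f x \<bullet> i) x})"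
    using differentiable_componentwise_within[of f _ UNIV] by auto
  moreover have "negligible (\<Union>i\<in>Basis. {x. \<not> differentiable_along Basis (\<lambda>x. f x \<bullet> i) x})"
    using negligible_not_differentiable_along[OF finite_Basis order_refl comp]
    by (intro negligible_Union) auto
  ultimately show ?thesis using negligible_subset by blast
qed

section \<open>Second-order expansions of convex functions\<close>

definition subgradient :: "('a::real_inner \<Rightarrow> real) \<Rightarrow> 'a \<Rightarrow> 'a \<Rightarrow> bool"
  where "subgradient G z g \<longleftrightarrow> (\<forall>w. G z + g \<bullet> (w - z) \<le> G w)"

lemma subgradientD: "subgradient G z g \<Longrightarrow> G z + g \<bullet> (w - z) \<le> G w"
  by (simp add: subgradient_def)

lemma convex_on_if_subgradients:
  fixes G :: "'a::real_inner \<Rightarrow> real"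
  assumes "\<And>z. \<exists>g. subgradient G z g"
  shows "convex_on UNIV G"
proof (rule convex_onI)
  fix t :: real and x y :: 'a assume t: "0 < t" "t < 1"
  define w where "w = (1 - t) *\<^sub>R x + t *\<^sub>R y"
  obtain g where g: "subgradient G w g" using assms by blast
  have "(1 - t) * (G w + g \<bullet> (x - w)) + t * (G w + g \<bullet> (y - w)) \<le> (1 - t) * G x + t * G y"
    using t by (intro add_mono mult_left_mono subgradientD[OF g]) auto
  moreover have "(1 - t) * (G w + g \<bullet> (x - w)) + t * (G w + g \<bullet> (y - w)) = G w"
    unfolding w_def by (simp add: algebra_simps)
  ultimately show "G ((1 - t) *\<^sub>R x + t *\<^sub>R y) \<le> (1 - t) * G x + t * G y" by (simp add: w_def)
qed auto

text \<open>This is surjectivity of identity plus subdifferential: \<open>z\<close> minimizes G +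
  |.|^2 / 2 - y. Comparing with \<open>z + t *\<^sub>R d\<close>, convexity makes the gain linear in
  \<open>t\<close> while the error is quadratic, so dividing by \<open>t\<close> and letting
  \<open>t\<close> tend to 0 leaves the subgradient inequality.\<close>

lemma prox_exists:
  fixes G :: "'a::euclidean_space \<Rightarrow> real"
  assumes sub: "\<And>z. \<exists>g. subgradient G z g"
  shows "\<exists>z. subgradient G z (y - z)"
proof -
  have cvx: "convex_on UNIV G" using sub by (rule convex_on_if_subgradients)
  have contG: "continuous_on UNIV G" using convex_on_continuous[OF open_UNIV cvx] .
  define h where "h z = G z + (norm z)\<^sup>2 / 2 - y \<bullet> z" for z
  obtain g0 where g0: "subgradient G 0 g0" using sub by blast
  \<comment> \<open>The affine minorant at 0 bounds \<open>h z - h 0\<close> below by |z|^2 / 2 - (y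
    - g0) z, which is nonnegative once |z| \<ge> \<open>r\<close>.\<close>
  define r where "r = 2 * norm (y - g0)"
  have out: "h 0 \<le> h z" if "r \<le> norm z" for z
  proof -
    have "(y - g0) \<bullet> z \<le> norm (y - g0) * norm z" by (rule norm_cauchy_schwarz)
    also have "\<dots> \<le> norm z / 2 * norm z" using that unfolding r_def by (intro mult_right_mono) auto
    finally have "(y - g0) \<bullet> z \<le> (norm z)\<^sup>2 / 2" by (simp add: power2_eq_square)
    then show ?thesis using subgradientD[OF g0, of z] by (simp add: h_def algebra_simps)
  qed
  have "continuous_on (cball 0 r) h" unfolding h_def
    by (intro continuous_intros continuous_on_subset[OF contG]) auto
  then obtain z where z: "z \<in> cball 0 r" "\<And>w. w \<in> cball 0 r \<Longrightarrow> h z \<le> h w"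
    using continuous_attains_inf[of "cball 0 r" h] by (auto simp: r_def)
  have zmin: "h z \<le> h w" for w
    using z(2)[of w] z(2)[of 0] out[of w] by (cases "norm w \<le> r") (auto simp: r_def)
  have "G z + (y - z) \<bullet> (w - z) \<le> G w" for w
  proof -
    define d where "d = w - z"
    have "(y - z) \<bullet> d + G z - G w \<le> t / 2 * (norm d)\<^sup>2" if t: "0 < t" "t < 1" for t
    proof -
      have "G (z + t *\<^sub>R d) \<le> (1 - t) * G z + t * G w"
        using convex_onD[OF cvx, of t z w] t by (simp add: d_def algebra_simps)
      moreover have "(norm (z + t *\<^sub>R d))\<^sup>2 = (norm z)\<^sup>2 + 2 * t * (z \<bullet> d) + t\<^sup>2 * (norm d)\<^sup>2"
        unfolding power2_norm_eq_inner
        by (simp add: inner_add_left inner_add_right inner_commute algebra_simps power2_eq_square)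
      ultimately have "t * ((y - z) \<bullet> d + G z - G w) \<le> t * (t / 2 * (norm d)\<^sup>2)"
      proof -
        assume 1: "G (z + t *\<^sub>R d) \<le> (1 - t) * G z + t * G w"
          and 2: "(norm (z + t *\<^sub>R d))\<^sup>2 = (norm z)\<^sup>2 + 2 * t * (z \<bullet> d) + t\<^sup>2 * (norm d)\<^sup>2"
        have "G z + (norm z)\<^sup>2 / 2 - y \<bullet> z
            \<le> G (z + t *\<^sub>R d) + (norm (z + t *\<^sub>R d))\<^sup>2 / 2 - (y \<bullet> z + t * (y \<bullet> d))"
          using zmin[of "z + t *\<^sub>R d"] by (simp add: h_def inner_add_right)
        moreover have "t * ((y - z) \<bullet> d + G z - G w) = t * (y \<bullet> d) - t * (z \<bullet> d) + t * G z - t * G w"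
          "t * (t / 2 * (norm d)\<^sup>2) = t\<^sup>2 * (norm d)\<^sup>2 / 2"
          by (simp_all add: inner_diff_left algebra_simps power2_eq_square)
        moreover have "(1 - t) * G z = G z - t * G z" by (simp add: algebra_simps)
        ultimately show ?thesis using 1 2 by linarith
      qed
      then show ?thesis using t by (simp add: mult_le_cancel_left)
    qed
    then have "\<forall>\<^sub>F t in at_right 0. (y - z) \<bullet> d + G z - G w \<le> t / 2 * (norm d)\<^sup>2"
      by (intro eventually_at_rightI[of 0 1]) auto
    moreover have "((\<lambda>t. t / 2 * (norm d)\<^sup>2) \<longlongrightarrow> 0 / 2 * (norm d)\<^sup>2) (at_right 0)"
      by (intro tendsto_intros) simp
    ultimately have "(y - z) \<bullet> d + G z - G w \<le> 0"
      using tendsto_lowerbound by fastforce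
    then show ?thesis by (simp add: d_def)
  qed
  then show ?thesis by (auto simp: subgradient_def)
qed

text \<open>The sum of the two subgradient inequalities, each tested at the other point, bounds |x -
  z|^2 by an inner product; Cauchy-Schwarz finishes.\<close>

lemma prox_nonexpansive:
  assumes x: "subgradient G x (y - x)" and z: "subgradient G z (w - z)"
  shows "norm (x - z) \<le> norm (y - w)"
proof -
  have "(norm (x - z))\<^sup>2 \<le> (y - w) \<bullet> (x - z)"
    using subgradientD[OF x, of z] subgradientD[OF z, of x]
    by (simp add: power2_norm_eq_inner algebra_simps inner_commute)
  also have "\<dots> \<le> norm (y - w) * norm (x - z)" by (rule norm_cauchy_schwarz)
  finally have "norm (x - z) * norm (x - z) \<le> norm (y - w) * norm (x - z)"
    by (simp add: power2_eq_square)
  then show ?thesis by (cases "x = z") (auto simp: mult_le_cancel_right)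
qed

text \<open>The difference \<open>v\<close> of the two slopes satisfies v e \<le> C |e|^2 for every
  \<open>e\<close>, and the choice e = v / (2 C) forces v = 0.\<close>

lemma subgradient_if_touched_above:
  assumes g: "subgradient G z g" and C: "0 < C" and up: "\<And>e. G (z + e) \<le> G z + a \<bullet> e + C * (norm e)\<^sup>2"
  shows "subgradient G z a"
proof -
  define v where "v = g - a"
  have "v \<bullet> e \<le> C * (norm e)\<^sup>2" for e
    using subgradientD[OF g, of "z + e"] up[of e] by (simp add: v_def algebra_simps)
  from this[of "(1 / (2 * C)) *\<^sub>R v"] have "(norm v)\<^sup>2 \<le> 0"
    using C by (simp add: power_mult_distrib power2_norm_eq_inner[symmetric] power2_eq_square field_simps)
  then show ?thesis using g by (simp add: v_def)
qed

text \<open>The subgradient at \<open>z + e\<close> is tested at a further displacement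
  \<open>w\<close> of length |e| in the direction of \<open>g - a\<close>, which gives |e| |g - a|
  \<le> C (2 |e|)^2. For \<open>e = 0\<close> this degenerates, and the argument of the preceding
  lemma gives uniqueness instead.\<close>

lemma subgradient_close_if_touched_above:
  assumes a: "subgradient G z a" and C: "0 < C" and up: "\<And>e. G (z + e) \<le> G z + a \<bullet> e + C * (norm e)\<^sup>2"
    and g: "subgradient G (z + e) g"
  shows "norm (g - a) \<le> 4 * C * norm e"
proof (cases "g = a")
  case False
  define n where "n = norm (g - a)"
  have n: "n > 0" using False by (simp add: n_def)
  have *: "(g - a) \<bullet> w \<le> C * (norm (e + w))\<^sup>2" for w
    using subgradientD[OF g, of "z + (e + w)"] up[of "e + w"] subgradientD[OF a, of "z + e"]
    by (simp add: algebra_simps)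
  show ?thesis
  proof (cases "e = 0")
    case True
    define v where "v = g - a"
    have "v \<bullet> ((1 / (2 * C)) *\<^sub>R v) \<le> C * (norm ((1 / (2 * C)) *\<^sub>R v))\<^sup>2"
      using *[of "(1 / (2 * C)) *\<^sub>R v"] True unfolding v_def by simp
    then have "n\<^sup>2 \<le> 0"
      using C by (simp add: n_def v_def[symmetric] power_mult_distrib power2_norm_eq_inner[symmetric] power2_eq_square field_simps)
    then show ?thesis using n by simp
  next
    case e: False
    define w where "w = (norm e / n) *\<^sub>R (g - a)"
    have nw: "norm w = norm e" using n by (simp add: w_def n_def)
    have "(g - a) \<bullet> w = norm e * n"
      using n by (simp add: w_def n_def power2_norm_eq_inner[symmetric] power2_eq_square)
    moreover have "(norm (e + w))\<^sup>2 \<le> (2 * norm e)\<^sup>2"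
      using norm_triangle_ineq[of e w] nw by (intro power_mono) auto
    ultimately have "norm e * n \<le> C * (2 * norm e)\<^sup>2"
      using *[of w] C by (smt (verit) mult_left_mono)
    then have "norm e * n \<le> norm e * (4 * C * norm e)" by (simp add: power2_eq_square algebra_simps)
    then show ?thesis using e by (simp add: n_def mult_le_cancel_left)
  qed
qed (use C in simp)

section \<open>From subgradient expansions to second-order expansions\<close>

text \<open>A mean value inequality without derivatives: over \<open>n\<close> equal steps the
  errors quadratic in the step length sum to K / n.\<close>

lemma increment_le_if_small_increments_le:
  fixes \<phi> :: "real \<Rightarrow> real"
  assumes "\<And>s t. 0 \<le> s \<Longrightarrow> s < t \<Longrightarrow> t \<le> 1 \<Longrightarrow> \<phi> t - \<phi> s \<le> (t - s) * (c + (t - s) * K)"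
  shows "\<phi> 1 - \<phi> 0 \<le> c"
proof -
  have *: "\<phi> 1 - \<phi> 0 \<le> c + K * inverse (real (Suc n))" for n
  proof -
    define m where "m = real (Suc n)"
    have m: "m > 0" by (simp add: m_def)
    have "\<phi> 1 - \<phi> 0 = (\<Sum>i<Suc n. \<phi> (real (Suc i) / m) - \<phi> (real i / m))"
      using m sum_lessThan_telescope[of "\<lambda>i. \<phi> (real i / m)" "Suc n"] by (simp add: m_def)
    also have "\<dots> \<le> (\<Sum>i<Suc n. (1 / m) * (c + (1 / m) * K))"
    proof (rule sum_mono)
      fix i assume i: "i \<in> {..<Suc n}"
      have "real (Suc i) / m - real i / m = 1 / m" using m by (simp add: field_simps)
      moreover have "real (Suc i) / m \<le> 1" using i m by (simp add: m_def)
      ultimately show "\<phi> (real (Suc i) / m) - \<phi> (real i / m) \<le> (1 / m) * (c + (1 / m) * K)"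
        using assms[of "real i / m" "real (Suc i) / m"] m by (simp add: divide_strict_right_mono)
    qed
    also have "\<dots> = c + K * inverse m"
      using m by (simp add: m_def[symmetric] del: of_nat_Suc) (simp add: m_def[symmetric] field_simps)
    finally show ?thesis by (simp add: m_def)
  qed
  have "(\<lambda>n. c + K * inverse (real (Suc n))) \<longlonglongrightarrow> c + K * 0"
    by (intro tendsto_intros LIMSEQ_inverse_real_of_nat)
  then show ?thesis using LIMSEQ_le_const[of _ "c + K * 0"] * by auto
qed

text \<open>After removal of the expected quadratic polynomial along the segment, the subgradients
  at the two ends of a short subinterval bound the increment from above and below, which integrates
  the first-order expansion of the subgradients.\<close>

lemma second_order_expansion_if_subgradient_expansion:
  assumes sub: "\<And>z. \<exists>g. subgradient G z g" and M: "linear M"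
    and exp: "\<And>e g. norm e < d \<Longrightarrow> subgradient G (z + e) g \<Longrightarrow> norm (g - a - M e) \<le> \<epsilon> * norm e"
    and e: "norm e < d" and \<epsilon>: "0 \<le> \<epsilon>"
  shows "\<bar>G (z + e) - G z - a \<bullet> e - e \<bullet> M e / 2\<bar> \<le> \<epsilon> * (norm e)\<^sup>2"
proof -
  define \<phi> where "\<phi> t = G (z + t *\<^sub>R e) - t * (a \<bullet> e) - t\<^sup>2 / 2 * (e \<bullet> M e)" for t
  have grad: "\<bar>g \<bullet> e - a \<bullet> e - t * (e \<bullet> M e)\<bar> \<le> \<epsilon> * (norm e)\<^sup>2"
    if t: "0 \<le> t" "t \<le> 1" and g: "subgradient G (z + t *\<^sub>R e) g" for t g
  proof -
    have te: "norm (t *\<^sub>R e) \<le> norm e" using t by (simp add: mult_left_le_one_le)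
    have "norm (g - a - M (t *\<^sub>R e)) \<le> \<epsilon> * norm (t *\<^sub>R e)"
      using te e by (intro exp g) auto
    also have "\<dots> \<le> \<epsilon> * norm e" using te \<epsilon> by (intro mult_left_mono)
    finally have "norm (g - a - M (t *\<^sub>R e)) * norm e \<le> \<epsilon> * norm e * norm e"
      by (intro mult_right_mono) auto
    moreover have "\<bar>(g - a - M (t *\<^sub>R e)) \<bullet> e\<bar> \<le> norm (g - a - M (t *\<^sub>R e)) * norm e"
      by (rule Cauchy_Schwarz_ineq2)
    moreover have "(g - a - M (t *\<^sub>R e)) \<bullet> e = g \<bullet> e - a \<bullet> e - t * (e \<bullet> M e)"
      by (simp add: linear_scale[OF M] inner_diff_left inner_commute[of "M e" e])
    ultimately show ?thesis by (simp add: power2_eq_square)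
  qed
  have "\<phi> t - \<phi> s \<le> (t - s) * (\<epsilon> * (norm e)\<^sup>2 + (t - s) * \<bar>e \<bullet> M e\<bar>) \<and>
      \<phi> s - \<phi> t \<le> (t - s) * (\<epsilon> * (norm e)\<^sup>2 + (t - s) * \<bar>e \<bullet> M e\<bar>)"
    if st: "0 \<le> s" "s < t" "t \<le> 1" for s t
  proof
    define m where "m = e \<bullet> M e"
    have sq: "t\<^sup>2 / 2 * m - s\<^sup>2 / 2 * m = (t - s) * ((t + s) / 2 * m)"
      by (simp add: power2_eq_square algebra_simps)
    have half: "\<bar>(t - s) / 2 * m\<bar> \<le> (t - s) * \<bar>m\<bar>" using st by (simp add: abs_mult mult_right_mono)
    obtain gt where gt: "subgradient G (z + t *\<^sub>R e) gt" using sub by blast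
    have "G (z + t *\<^sub>R e) - G (z + s *\<^sub>R e) \<le> (t - s) * (gt \<bullet> e)"
      using subgradientD[OF gt, of "z + s *\<^sub>R e"] by (simp add: algebra_simps)
    then have "\<phi> t - \<phi> s \<le> (t - s) * (gt \<bullet> e) - (t - s) * (a \<bullet> e) - (t\<^sup>2 / 2 * m - s\<^sup>2 / 2 * m)"
      by (simp add: \<phi>_def m_def algebra_simps)
    also have "\<dots> = (t - s) * ((gt \<bullet> e - a \<bullet> e - t * m) + (t - s) / 2 * m)"
      unfolding sq by (simp add: algebra_simps field_simps)
    also have "\<dots> \<le> (t - s) * (\<epsilon> * (norm e)\<^sup>2 + (t - s) * \<bar>m\<bar>)"
      using grad[OF _ _ gt] half st by (intro mult_left_mono add_mono) (auto simp: m_def abs_le_iff)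
    finally show "\<phi> t - \<phi> s \<le> (t - s) * (\<epsilon> * (norm e)\<^sup>2 + (t - s) * \<bar>e \<bullet> M e\<bar>)" by (simp add: m_def)
    obtain gs where gs: "subgradient G (z + s *\<^sub>R e) gs" using sub by blast
    have "G (z + s *\<^sub>R e) - G (z + t *\<^sub>R e) \<le> - ((t - s) * (gs \<bullet> e))"
      using subgradientD[OF gs, of "z + t *\<^sub>R e"] by (simp add: algebra_simps)
    then have "\<phi> s - \<phi> t \<le> - ((t - s) * (gs \<bullet> e)) + (t - s) * (a \<bullet> e) + (t\<^sup>2 / 2 * m - s\<^sup>2 / 2 * m)"
      by (simp add: \<phi>_def m_def algebra_simps)
    also have "\<dots> = (t - s) * (- (gs \<bullet> e - a \<bullet> e - s * m) + (t - s) / 2 * m)"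
      unfolding sq by (simp add: algebra_simps field_simps)
    also have "\<dots> \<le> (t - s) * (\<epsilon> * (norm e)\<^sup>2 + (t - s) * \<bar>m\<bar>)"
      using grad[OF _ _ gs] half st by (intro mult_left_mono add_mono) (auto simp: m_def abs_le_iff)
    finally show "\<phi> s - \<phi> t \<le> (t - s) * (\<epsilon> * (norm e)\<^sup>2 + (t - s) * \<bar>e \<bullet> M e\<bar>)" by (simp add: m_def)
  qed
  note incr = this
  have "\<phi> 1 - \<phi> 0 \<le> \<epsilon> * (norm e)\<^sup>2"
    by (rule increment_le_if_small_increments_le) (use incr in blast)
  moreover have "- \<phi> 1 - - \<phi> 0 \<le> \<epsilon> * (norm e)\<^sup>2"
    by (rule increment_le_if_small_increments_le[of "\<lambda>t. - \<phi> t"]) (use incr in fastforce)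
  ultimately show ?thesis by (simp add: \<phi>_def abs_le_iff)
qed

text \<open>The \<open>+ 1\<close> in the denominator takes care of \<open>e = 0\<close>.\<close>

lemma scale_below:
  fixes e :: "'a::real_normed_vector"
  assumes "0 < (d::real)"
  shows "0 < d / (norm e + 1)" "d / (norm e + 1) * norm e < d"
proof -
  have "0 < norm e + 1" using norm_ge_zero[of e] by linarith
  then show "0 < d / (norm e + 1)" "d / (norm e + 1) * norm e < d"
    using assms by (simp_all add: field_simps)
qed

text \<open>By homogeneity of degree 2 an inequality near 0 with error o(|e|^2) holds everywhere
  without error.\<close>

lemma quadratic_nonpos_if_small:
  fixes q :: "'a::real_normed_vector \<Rightarrow> real"
  assumes scale: "\<And>t e. q (t *\<^sub>R e) = t\<^sup>2 * q e"
    and small: "\<And>\<epsilon>. 0 < \<epsilon> \<Longrightarrow> \<exists>d>0. \<forall>e. norm e < d \<longrightarrow> q e \<le> \<epsilon> * (norm e)\<^sup>2"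
  shows "q e \<le> 0"
proof (rule field_le_epsilon)
  fix \<epsilon> :: real assume "0 < \<epsilon>"
  define \<eta> where "\<eta> = \<epsilon> / ((norm e)\<^sup>2 + 1)"
  have n: "0 < (norm e)\<^sup>2 + 1" using zero_le_power2[of "norm e"] by linarith
  have \<eta>: "0 < \<eta>" "\<eta> * (norm e)\<^sup>2 \<le> \<epsilon>" using \<open>0 < \<epsilon>\<close> n by (simp_all add: \<eta>_def field_simps)
  obtain d where d: "d > 0" "\<And>e. norm e < d \<Longrightarrow> q e \<le> \<eta> * (norm e)\<^sup>2" using small[OF \<eta>(1)] by blast
  define t where "t = d / (norm e + 1)"
  have t: "0 < t" "norm (t *\<^sub>R e) < d" using d(1) scale_below[OF d(1), of e] by (simp_all add: t_def)
  have "t\<^sup>2 * q e \<le> t\<^sup>2 * (\<eta> * (norm e)\<^sup>2)"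
    using d(2)[OF t(2)] by (simp add: scale power_mult_distrib mult.left_commute)
  then show "q e \<le> 0 + \<epsilon>" using t \<eta>(2) by simp
qed

text \<open>The lemmas of Jensen and Alexandrov in one: differentiability of the resolvent at one
  well-chosen point suffices. The margin \<open>\<kappa>\<close> makes 0 a strict maximum point of
  \<open>G\<close> minus the quadratic form \<open>\<Psi>\<close>, so a nearby maximum point
  survives every small linear perturbation.\<close>

theorem jensen_alexandrov:
  fixes G :: "'a::euclidean_space \<Rightarrow> real" and B :: "'a \<Rightarrow> 'a"
  assumes sub: "\<And>z. \<exists>g. subgradient G z g"
    and B: "linear B" "\<And>x y. B x \<bullet> y = x \<bullet> B y"
    and touch: "\<And>z. G z \<le> G 0 + z \<bullet> B z / 2"
    and pos: "0 < \<kappa>" "0 < \<delta>"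
  obtains z a M where "norm z < \<delta>" "norm a < \<delta>" "linear M" "subgradient G z a"
    "\<And>g. subgradient G z g \<Longrightarrow> g = a"
    "\<And>e. 0 \<le> e \<bullet> M e" "\<And>e. e \<bullet> M e \<le> e \<bullet> B e + \<kappa> * (norm e)\<^sup>2"
    "\<And>\<epsilon>. 0 < \<epsilon> \<Longrightarrow> \<exists>d>0. \<forall>e. norm e < d \<longrightarrow>
      \<bar>G (z + e) - G z - a \<bullet> e - e \<bullet> M e / 2\<bar> \<le> \<epsilon> * (norm e)\<^sup>2"
proof -
  have contG: "continuous_on UNIV G"
    using convex_on_continuous[OF open_UNIV convex_on_if_subgradients[OF sub]] .
  obtain KB where KB: "0 < KB" "\<And>x. norm (B x) \<le> KB * norm x" using linear_bounded_pos[OF B(1)] by blast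
  define \<Psi> where "\<Psi> e = e \<bullet> B e / 2 + \<kappa> / 2 * (norm e)\<^sup>2" for e
  define P where "P z = B z + \<kappa> *\<^sub>R z" for z
  define C where "C = KB / 2 + \<kappa> / 2"
  have C: "0 < C" using KB pos by (simp add: C_def)
  have \<Psi>C: "\<Psi> e \<le> C * (norm e)\<^sup>2" for e
  proof -
    have "e \<bullet> B e \<le> norm e * norm (B e)" by (rule norm_cauchy_schwarz)
    also have "\<dots> \<le> norm e * (KB * norm e)" using KB by (intro mult_left_mono) auto
    finally show ?thesis by (simp add: \<Psi>_def C_def power2_eq_square algebra_simps)
  qed
  have \<Psi>_add: "\<Psi> (z + e) = \<Psi> z + P z \<bullet> e + \<Psi> e" for z e
  proof -
    have "e \<bullet> B z = z \<bullet> B e" using B(2)[of z e] by (simp add: inner_commute)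
    then have "(z + e) \<bullet> B (z + e) = z \<bullet> B z + 2 * (z \<bullet> B e) + e \<bullet> B e"
      by (simp add: linear_add[OF B(1)] inner_add_left inner_add_right)
    moreover have "(norm (z + e))\<^sup>2 = (norm z)\<^sup>2 + 2 * (z \<bullet> e) + (norm e)\<^sup>2"
      unfolding power2_norm_eq_inner by (simp add: inner_add_left inner_add_right inner_commute)
    moreover have "P z \<bullet> e = z \<bullet> B e + \<kappa> * (z \<bullet> e)" by (simp add: P_def inner_add_left B(2))
    ultimately show ?thesis by (simp add: \<Psi>_def field_simps)
  qed
  have Pnorm: "norm (P z) \<le> 2 * C * norm z" for z
    unfolding P_def C_def using KB(2)[of z] pos norm_triangle_ineq[of "B z" "\<kappa> *\<^sub>R z"]
    by (simp add: algebra_simps)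
  have Pdiff: "P x - P y = P (x - y)" for x y
    by (simp add: P_def linear_diff[OF B(1)] algebra_simps)
  \<comment> \<open>Since \<open>P\<close> is bounded by \<open>2 * C\<close>, the bounds |z| \<le>
    \<open>\<delta>'\<close> and |q| \<le> \<open>\<kappa> * \<delta>'\<close> keep both
    \<open>z\<close> and \<open>a = P z + q\<close> below \<open>\<delta>\<close>.\<close>
  define \<delta>' where "\<delta>' = \<delta> / (2 * (2 * C + \<kappa> + 1))"
  have \<delta>': "0 < \<delta>'" "\<delta>' < \<delta>" "2 * C * \<delta>' + \<kappa> * \<delta>' < \<delta>"
  proof -
    have "2 * (2 * C + \<kappa> + 1) * \<delta>' = \<delta>" using C pos by (simp add: \<delta>'_def)
    then have eq: "2 * (2 * C * \<delta>' + \<kappa> * \<delta>') + 2 * \<delta>' = \<delta>" by (simp add: algebra_simps)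
    show d0: "0 < \<delta>'" using C pos by (simp add: \<delta>'_def)
    have "0 \<le> 2 * C * \<delta>' + \<kappa> * \<delta>'" using C pos d0 by simp
    then show "\<delta>' < \<delta>" "2 * C * \<delta>' + \<kappa> * \<delta>' < \<delta>" using eq d0 by auto
  qed
  \<comment> \<open>For |q| < \<open>\<rho>\<close> and |w| > \<open>\<delta>'\<close> the linear
    term is at most the margin \<open>\<kappa> / 2\<close> |w|^2, so no point outside the ball beats
    0.\<close>
  define \<rho> where "\<rho> = \<kappa> * \<delta>' / 2"
  have \<rho>: "0 < \<rho>" using pos \<delta>' by (simp add: \<rho>_def)
  have "\<exists>J. \<forall>y. subgradient G (J y) (y - J y)" using prox_exists[OF sub] by metis
  then obtain J where J: "\<And>y. subgradient G (J y) (y - J y)" by blast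
  have JL: "norm (J x - J y) \<le> norm (x - y)" for x y using prox_nonexpansive[OF J J] .
  have J_eq: "J (z + g) = z" if "subgradient G z g" for z g
    using prox_nonexpansive[OF J[of "z + g"], of z "z + g"] that by simp

  text \<open>A maximum point of \<open>G\<close> minus a perturbed quadratic form is a point of differentiability,
    and the perturbation is recovered from the image point of the resolvent \<open>J\<close>.\<close>
  have maxpt: "\<exists>z. norm z \<le> \<delta>' \<and> (\<forall>e. G (z + e) \<le> G z + (P z + q) \<bullet> e + C * (norm e)\<^sup>2)
      \<and> (\<forall>e. G (z + e) \<le> G z + (P z + q) \<bullet> e + \<Psi> e)" if q: "norm q < \<rho>" for q
  proof -
    define H where "H z = G z - \<Psi> z - q \<bullet> z" for z
    have "continuous_on (cball 0 \<delta>') H"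
      unfolding H_def \<Psi>_def
      by (intro continuous_intros continuous_on_subset[OF contG] linear_continuous_on
          linear_linear[THEN iffD2] B(1)) (auto simp: linear_conv_bounded_linear[symmetric] B(1))
    then obtain z where z: "z \<in> cball 0 \<delta>'" "\<And>w. w \<in> cball 0 \<delta>' \<Longrightarrow> H w \<le> H z"
      using continuous_attains_sup[of "cball 0 \<delta>'" H] \<delta>' by auto
    have out: "H w \<le> H 0" if w: "\<delta>' < norm w" for w
    proof -
      have "- (q \<bullet> w) \<le> norm q * norm w" using norm_cauchy_schwarz[of "- q" w] by simp
      also have "\<dots> \<le> (\<kappa> / 2 * norm w) * norm w"
      proof (intro mult_right_mono)
        have "\<kappa> * \<delta>' \<le> \<kappa> * norm w" using w pos by (intro mult_left_mono) auto
        then show "norm q \<le> \<kappa> / 2 * norm w" using q by (simp add: \<rho>_def)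
      qed auto
      finally show ?thesis using touch[of w] by (simp add: H_def \<Psi>_def power2_eq_square linear_0[OF B(1)])
    qed
    have Hz: "H w \<le> H z" for w
      using out[of w] z(2)[of w] z(2)[of 0] \<delta>' by (cases "norm w \<le> \<delta>'") auto
    have up: "G (z + e) \<le> G z + (P z + q) \<bullet> e + \<Psi> e" for e
      using Hz[of "z + e"] \<Psi>_add[of z e] by (simp add: H_def inner_add_left inner_add_right)
    have "G (z + e) \<le> G z + (P z + q) \<bullet> e + C * (norm e)\<^sup>2" for e
      using up[of e] \<Psi>C[of e] by linarith
    then show ?thesis using z(1) up by (intro exI[of _ z]) auto
  qed

  \<comment> \<open>At y = z + a with a = P z + q one has J y = z and therefore T y = q. As
    \<open>T\<close> is Lipschitz, the perturbations coming from points where \<open>J\<close> is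
    not differentiable form a null set and cannot fill a ball.\<close>
  define T where "T y = y - J y - P (J y)" for y
  have TL: "norm (T x - T y) \<le> (2 + 2 * C) * norm (x - y)" for x y
  proof -
    have "T x - T y = (x - y) - (J x - J y) - P (J x - J y)"
      unfolding T_def Pdiff[symmetric] by simp
    then have "norm (T x - T y) \<le> norm (x - y) + norm (J x - J y) + norm (P (J x - J y))"
      using norm_triangle_ineq4[of "(x - y) - (J x - J y)" "P (J x - J y)"]
        norm_triangle_ineq4[of "x - y" "J x - J y"] by simp
    moreover have "norm (P (J x - J y)) \<le> 2 * C * norm (x - y)"
    proof (rule order_trans[OF Pnorm])
      show "2 * C * norm (J x - J y) \<le> 2 * C * norm (x - y)" using JL C by (intro mult_left_mono) auto
    qed
    ultimately show ?thesis using JL[of x y] by (simp add: algebra_simps)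
  qed
  define N where "N = {y. \<not> J differentiable (at y)}"
  have "1-lipschitz_on UNIV J" using JL by (intro lipschitz_onI) (auto simp: dist_norm)
  then have "negligible N" unfolding N_def by (rule rademacher)
  then have "negligible (T ` N)"
    using TL by (intro negligible_locally_Lipschitz_image) (auto intro!: exI[of _ UNIV])
  then have "\<not> ball 0 \<rho> \<subseteq> T ` N"
    using \<rho> by (metis negligible_subset open_ball open_not_negligible ball_eq_empty not_le)
  then obtain q where q: "norm q < \<rho>" "q \<notin> T ` N" unfolding subset_iff mem_ball_0 by blast
  obtain z where z: "norm z \<le> \<delta>'"
    and up: "\<And>e. G (z + e) \<le> G z + (P z + q) \<bullet> e + C * (norm e)\<^sup>2"
    and up': "\<And>e. G (z + e) \<le> G z + (P z + q) \<bullet> e + \<Psi> e"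
    using maxpt[OF q(1)] by blast
  define a where "a = P z + q"
  note up = up[folded a_def] and up' = up'[folded a_def]
  obtain g0 where "subgradient G z g0" using sub by blast
  then have a: "subgradient G z a" by (rule subgradient_if_touched_above[OF _ C up])
  define y where "y = z + a"
  have Jy: "J y = z" using J_eq[OF a] by (simp add: y_def)
  have "T y = q" by (simp add: T_def Jy) (simp add: y_def a_def)
  then have "J differentiable (at y)" using q(2) by (auto simp: N_def)
  then obtain D where D: "(J has_derivative D) (at y)" by (auto simp: differentiable_def)
  have linD: "linear D" using has_derivative_linear[OF D] .
  have Jexp: "\<exists>d>0. \<forall>w. norm w < d \<longrightarrow> norm (J (y + w) - z - D w) \<le> \<epsilon> * norm w" if "0 < \<epsilon>" for \<epsilon>
  proof -
    obtain d where "d > 0" "\<forall>x. norm (x - y) < d \<longrightarrow> norm (J x - J y - D (x - y)) \<le> \<epsilon> * norm (x - y)"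
      using D[unfolded has_derivative_at_alt] \<open>0 < \<epsilon>\<close> by meson
    then have "norm (J (y + w) - z - D w) \<le> \<epsilon> * norm w" if "norm w < d" for w
      using that by (auto simp: Jy dest: spec[of _ "y + w"])
    then show ?thesis using \<open>d > 0\<close> by blast
  qed
  \<comment> \<open>\<open>e + g - a\<close> is the displacement of the argument that moves the
    value of \<open>J\<close> by \<open>e\<close>; its bound by \<open>C1 * norm e\<close> turns
    errors small relative to it into errors small relative to \<open>e\<close>.\<close>
  define C1 where "C1 = 1 + 4 * C"
  have C1: "0 < C1" using C by (simp add: C1_def)
  have wbound: "norm (e + g - a) \<le> C1 * norm e" if "subgradient G (z + e) g" for e g
    using subgradient_close_if_touched_above[OF a C up that] norm_triangle_ineq[of e "g - a"]
    by (simp add: C1_def algebra_simps)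
  have Jw: "J (y + (e + g - a)) = z + e" if "subgradient G (z + e) g" for e g
    using J_eq[OF that] by (simp add: y_def algebra_simps)
  have key: "\<exists>d>0. \<forall>e g. norm e < d \<longrightarrow> subgradient G (z + e) g \<longrightarrow>
      norm (e - D (e + g - a)) \<le> \<epsilon> * norm e" if \<epsilon>: "0 < \<epsilon>" for \<epsilon>
  proof -
    obtain d where d: "d > 0" "\<And>w. norm w < d \<Longrightarrow> norm (J (y + w) - z - D w) \<le> \<epsilon> / C1 * norm w"
      using Jexp[of "\<epsilon> / C1"] \<epsilon> C1 by auto
    have "norm (e - D (e + g - a)) \<le> \<epsilon> * norm e" if e: "norm e < d / C1" and g: "subgradient G (z + e) g" for e g
    proof -
      have w: "norm (e + g - a) \<le> C1 * norm e" using wbound[OF g] .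
      also have "\<dots> < d" using e C1 by (simp add: field_simps)
      finally have "norm (e - D (e + g - a)) \<le> \<epsilon> / C1 * norm (e + g - a)"
        using d(2)[of "e + g - a"] Jw[OF g] by simp
      also have "\<dots> \<le> \<epsilon> / C1 * (C1 * norm e)" using w \<epsilon> C1 by (intro mult_left_mono) auto
      finally show ?thesis using C1 by simp
    qed
    then show ?thesis using d(1) C1 by (intro exI[of _ "d / C1"]) auto
  qed
  \<comment> \<open>Rescaled by \<open>1 / t\<close>, \<open>key\<close> exhibits every
    \<open>e\<close> as a limit of points of the range of \<open>D\<close>, and a subspace of finite
    dimension is closed.\<close>
  have "surj D"
  proof -
    have "e \<in> range D" for e
    proof -
      have "closed (range D)" using linD by (intro closed_subspace linear_subspace_image) auto
      moreover have "e \<in> closure (range D)"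
        unfolding closure_approachable
      proof (intro allI impI)
        fix \<epsilon> :: real assume \<epsilon>: "0 < \<epsilon>"
        define \<eta> where "\<eta> = \<epsilon> / (norm e + 1)"
        have \<eta>: "0 < \<eta>" "\<eta> * norm e < \<epsilon>"
          using scale_below[OF \<epsilon>] by (simp_all add: \<eta>_def)
        obtain d where d: "d > 0" "\<And>e g. norm e < d \<Longrightarrow> subgradient G (z + e) g \<Longrightarrow>
            norm (e - D (e + g - a)) \<le> \<eta> * norm e" using key[OF \<eta>(1)] by blast
        define t where "t = d / (norm e + 1)"
        have t: "0 < t" "norm (t *\<^sub>R e) < d" using d(1) scale_below[OF d(1), of e] by (simp_all add: t_def)
        obtain g where g: "subgradient G (z + t *\<^sub>R e) g" using sub by blast
        define w where "w = t *\<^sub>R e + g - a"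
        have "norm (t *\<^sub>R e - D w) \<le> \<eta> * (t * norm e)" using d(2)[OF t(2) g] t by (simp add: w_def)
        moreover have "t *\<^sub>R e - D w = t *\<^sub>R (e - D ((1 / t) *\<^sub>R w))"
          using t by (simp add: linear_scale[OF linD] scaleR_diff_right)
        ultimately have "t * norm (e - D ((1 / t) *\<^sub>R w)) \<le> t * (\<eta> * norm e)"
          using t by (simp only: norm_scaleR abs_of_pos mult.left_commute)
        then have "norm (e - D ((1 / t) *\<^sub>R w)) \<le> \<eta> * norm e" using t by simp
        then show "\<exists>y\<in>range D. dist y e < \<epsilon>"
          using \<eta> by (intro bexI[of _ "D ((1 / t) *\<^sub>R w)"]) (auto simp: dist_norm norm_minus_commute)
      qed
      ultimately show ?thesis by (simp add: closure_closed)
    qed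
    then show ?thesis by auto
  qed
  then obtain E where E: "linear E" "\<And>x. E (D x) = x"
    using linear_surjective_isomorphism[OF linD] by blast
  obtain KE where KE: "0 < KE" "\<And>x. norm (E x) \<le> KE * norm x" using linear_bounded_pos[OF E(1)] by blast
  \<comment> \<open>\<open>D\<close> is the derivative of the inverse of identity plus
    subdifferential, so its own inverse \<open>E\<close> is identity plus Hessian.\<close>
  define M where "M e = E e - e" for e
  have M: "linear M" unfolding M_def by (intro linear_compose_sub E(1) linear_id[unfolded id_def])
  have expansion: "\<exists>d>0. \<forall>e. norm e < d \<longrightarrow>
      \<bar>G (z + e) - G z - a \<bullet> e - e \<bullet> M e / 2\<bar> \<le> \<epsilon> * (norm e)\<^sup>2" if \<epsilon>: "0 < \<epsilon>" for \<epsilon>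
  proof -
    obtain d where d: "d > 0" "\<And>e g. norm e < d \<Longrightarrow> subgradient G (z + e) g \<Longrightarrow>
        norm (e - D (e + g - a)) \<le> \<epsilon> / KE * norm e" using key[of "\<epsilon> / KE"] \<epsilon> KE by auto
    have "norm (g - a - M e) \<le> \<epsilon> * norm e" if e: "norm e < d" and g: "subgradient G (z + e) g" for e g
    proof -
      have "g - a - M e = - E (e - D (e + g - a))"
        by (simp add: linear_diff[OF E(1)] E(2) M_def)
      then have "norm (g - a - M e) \<le> KE * norm (e - D (e + g - a))" using KE(2) by simp
      also have "\<dots> \<le> KE * (\<epsilon> / KE * norm e)" using d(2)[OF e g] KE by (intro mult_left_mono) auto
      finally show ?thesis using KE by simp
    qed
    note grad = this
    show ?thesis
      using second_order_expansion_if_subgradient_expansion[OF sub M grad] d(1) \<epsilon> by (intro exI[of _ d]) auto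
  qed
  have bound: "e \<bullet> M e \<le> e \<bullet> B e + \<kappa> * (norm e)\<^sup>2" for e
  proof -
    have "e \<bullet> M e / 2 - \<Psi> e \<le> 0"
    proof (rule quadratic_nonpos_if_small[where q = "\<lambda>e. e \<bullet> M e / 2 - \<Psi> e"])
      fix \<epsilon> :: real assume "0 < \<epsilon>"
      then obtain d where "d > 0" and d: "\<And>e. norm e < d \<Longrightarrow>
        \<bar>G (z + e) - G z - a \<bullet> e - e \<bullet> M e / 2\<bar> \<le> \<epsilon> * (norm e)\<^sup>2" using expansion by blast
      have "e \<bullet> M e / 2 - \<Psi> e \<le> \<epsilon> * (norm e)\<^sup>2" if "norm e < d" for e
        using d[OF that] up'[of e] by (simp add: abs_le_iff)
      then show "\<exists>d>0. \<forall>e. norm e < d \<longrightarrow> e \<bullet> M e / 2 - \<Psi> e \<le> \<epsilon> * (norm e)\<^sup>2"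
        using \<open>d > 0\<close> by blast
    qed (simp add: \<Psi>_def linear_scale[OF M] linear_scale[OF B(1)] power2_eq_square algebra_simps)
    then show ?thesis by (simp add: \<Psi>_def)
  qed
  have nonneg: "0 \<le> e \<bullet> M e" for e
  proof -
    have "- (e \<bullet> M e / 2) \<le> 0"
    proof (rule quadratic_nonpos_if_small[where q = "\<lambda>e. - (e \<bullet> M e / 2)"])
      fix \<epsilon> :: real assume "0 < \<epsilon>"
      then obtain d where "d > 0" and d: "\<And>e. norm e < d \<Longrightarrow>
        \<bar>G (z + e) - G z - a \<bullet> e - e \<bullet> M e / 2\<bar> \<le> \<epsilon> * (norm e)\<^sup>2" using expansion by blast
      have "- (e \<bullet> M e / 2) \<le> \<epsilon> * (norm e)\<^sup>2" if "norm e < d" for e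
        using d[OF that] subgradientD[OF a, of "z + e"] by (simp add: abs_le_iff)
      then show "\<exists>d>0. \<forall>e. norm e < d \<longrightarrow> - (e \<bullet> M e / 2) \<le> \<epsilon> * (norm e)\<^sup>2"
        using \<open>d > 0\<close> by blast
    qed (simp add: linear_scale[OF M] power2_eq_square)
    then show ?thesis by simp
  qed
  have unique: "g = a" if "subgradient G z g" for g
    using subgradient_close_if_touched_above[OF a C up, of 0 g] that by simp
  have "norm a < \<delta>"
  proof -
    have "norm a \<le> norm (P z) + norm q" unfolding a_def by (rule norm_triangle_ineq)
    also have "\<dots> \<le> 2 * C * norm z + norm q" using Pnorm by simp
    also have "\<dots> \<le> 2 * C * \<delta>' + \<kappa> * \<delta>'"
    proof (intro add_mono mult_left_mono z)
      have "\<rho> \<le> \<kappa> * \<delta>'" using pos(1) \<delta>'(1) by (simp add: \<rho>_def)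
      then show "norm q \<le> \<kappa> * \<delta>'" using q by simp
    qed (use C in auto)
    finally show ?thesis using \<delta>' by simp
  qed
  then show thesis using that[OF _ _ M a unique nonneg bound expansion] z \<delta>' by auto
qed

section \<open>Sup-convolutions and the theorem on sums\<close>

definition usc_on :: "'a::topological_space set \<Rightarrow> ('a \<Rightarrow> real) \<Rightarrow> bool"
  where "usc_on K a \<longleftrightarrow> (\<forall>x\<in>K. \<forall>c>a x. \<forall>\<^sub>F y in at x within K. a y < c)"

lemma usc_onD: "usc_on K a \<Longrightarrow> x \<in> K \<Longrightarrow> a x < c \<Longrightarrow> \<forall>\<^sub>F y in at x within K. a y < c"
  by (simp add: usc_on_def)

lemma usc_on_add:
  assumes "usc_on K a" "usc_on K b"
  shows "usc_on K (\<lambda>x. a x + b x)"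
  unfolding usc_on_def
proof (intro ballI allI impI)
  fix x c assume x: "x \<in> K" and "a x + b x < c"
  define e where "e = (c - a x - b x) / 2"
  have e: "0 < e" "a x + e + (b x + e) = c" using \<open>a x + b x < c\<close> by (auto simp: e_def field_simps)
  have "\<forall>\<^sub>F y in at x within K. a y < a x + e" "\<forall>\<^sub>F y in at x within K. b y < b x + e"
    using e(1) by (auto intro!: usc_onD[OF assms(1) x] usc_onD[OF assms(2) x])
  then show "\<forall>\<^sub>F y in at x within K. a y + b y < c"
    by eventually_elim (use e in linarith)
qed

lemma usc_on_continuous:
  assumes "continuous_on K f"
  shows "usc_on K f"
  using assms unfolding usc_on_def continuous_on_def by (auto intro: order_tendstoD)

lemma usc_on_compose:
  assumes a: "usc_on K a" and h: "continuous_on S h" "h ` S \<subseteq> K"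
  shows "usc_on S (\<lambda>x. a (h x))"
  unfolding usc_on_def
proof (intro ballI allI impI)
  fix x c assume x: "x \<in> S" and c: "a (h x) < c"
  have "\<forall>\<^sub>F y in at (h x) within K. a y < c" using usc_onD[OF a _ c] x h(2) by auto
  then obtain U where U: "open U" "h x \<in> U" "\<And>y. y \<in> U \<Longrightarrow> y \<in> K \<Longrightarrow> y \<noteq> h x \<Longrightarrow> a y < c"
    by (auto simp: eventually_at_topological)
  have "(h \<longlongrightarrow> h x) (at x within S)" using h(1) x by (simp add: continuous_on_def)
  then have "\<forall>\<^sub>F y in at x within S. h y \<in> U" using U(1,2) by (rule topological_tendstoD)
  moreover have "\<forall>\<^sub>F y in at x within S. y \<in> S" by (simp add: eventually_at_topological) blast
  ultimately show "\<forall>\<^sub>F y in at x within S. a (h y) < c"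
    by eventually_elim (use U(3) c h(2) in \<open>metis image_subset_iff\<close>)
qed

text \<open>Without a maximum every \<open>x\<close> is beaten by some \<open>s x\<close>, and by
  semicontinuity so is a neighborhood of \<open>x\<close>. Among the finitely many
  \<open>s x\<close> of a subcover the best one lies in some neighborhood of the cover and is beaten
  again.\<close>

lemma usc_on_attains_sup:
  assumes K: "compact K" "K \<noteq> {}" and a: "usc_on K a"
  shows "\<exists>x\<in>K. \<forall>y\<in>K. a y \<le> a x"
proof (rule ccontr)
  assume "\<not> ?thesis"
  then have "\<forall>x\<in>K. \<exists>y\<in>K. a x < a y" by (auto simp: not_le)
  then obtain s where s: "\<And>x. x \<in> K \<Longrightarrow> s x \<in> K \<and> a x < a (s x)" by metis
  have "\<exists>U. open U \<and> x \<in> U \<and> (\<forall>y\<in>U \<inter> K. a y < a (s x))" if x: "x \<in> K" for x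
  proof -
    have "a x < a (s x)" using s[OF x] by simp
    then obtain U where "open U" "x \<in> U" "\<forall>y\<in>U. y \<noteq> x \<longrightarrow> y \<in> K \<longrightarrow> a y < a (s x)"
      using usc_onD[OF a x] by (auto simp: eventually_at_topological)
    then show ?thesis using s[OF x] by (intro exI[of _ U]) auto
  qed
  then obtain U where U: "\<And>x. x \<in> K \<Longrightarrow> open (U x) \<and> x \<in> U x \<and> (\<forall>y\<in>U x \<inter> K. a y < a (s x))"
    by metis
  obtain F where F: "F \<subseteq> K" "finite F" "K \<subseteq> (\<Union>x\<in>F. U x)"
    using compactE_image[OF K(1), of K U] U by blast
  then have "F \<noteq> {}" using K(2) by auto
  then obtain x where x: "x \<in> F" "\<And>z. z \<in> F \<Longrightarrow> a (s z) \<le> a (s x)"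
    using F(2) obtains_MAX[of F "\<lambda>z. a (s z)"] by (metis Max_ge finite_imageI imageI)
  obtain z where "z \<in> F" "s x \<in> U z" using s F(1,3) x(1) by blast
  then have "a (s x) < a (s z)" using U F(1) s x(1) by blast
  then show False using x(2)[OF \<open>z \<in> F\<close>] by simp
qed

text \<open>Up to the term \<open>L / 2 * |\<xi>|\<^sup>2\<close>, the function \<open>C\<close> is the sup-convolution of \<open>a\<close>,
  and \<open>m \<xi>\<close> is a point where the supremum is attained.\<close>

lemma sup_convolution_exists:
  fixes a :: "'a::euclidean_space \<Rightarrow> real"
  assumes K: "compact K" "K \<noteq> {}" and a: "usc_on K a"
  shows "\<exists>C m. \<forall>\<xi>. m \<xi> \<in> K \<and> C \<xi> = a (m \<xi>) - L / 2 * (norm (m \<xi>))\<^sup>2 + L * (m \<xi> \<bullet> \<xi>) \<and>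
    (\<forall>y\<in>K. a y - L / 2 * (norm y)\<^sup>2 + L * (y \<bullet> \<xi>) \<le> C \<xi>)"
proof -
  have "\<exists>x\<in>K. \<forall>y\<in>K. a y + (- L / 2 * (norm y)\<^sup>2 + L * (y \<bullet> \<xi>)) \<le> a x + (- L / 2 * (norm x)\<^sup>2 + L * (x \<bullet> \<xi>))" for \<xi>
    by (intro usc_on_attains_sup K usc_on_add a usc_on_continuous continuous_intros)
  then obtain m where m: "\<And>\<xi>. m \<xi> \<in> K" "\<And>\<xi> y. y \<in> K \<Longrightarrow>
      a y + (- L / 2 * (norm y)\<^sup>2 + L * (y \<bullet> \<xi>)) \<le> a (m \<xi>) + (- L / 2 * (norm (m \<xi>))\<^sup>2 + L * (m \<xi> \<bullet> \<xi>))"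
    by metis
  have "a y - L / 2 * (norm y)\<^sup>2 + L * (y \<bullet> \<xi>) \<le> a (m \<xi>) - L / 2 * (norm (m \<xi>))\<^sup>2 + L * (m \<xi> \<bullet> \<xi>)"
    if "y \<in> K" for y \<xi> using m(2)[OF that, of \<xi>] by simp
  with m(1) show ?thesis by (intro exI allI conjI ballI) auto
qed

text \<open>The supremum at \<open>\<xi> + e\<close> is tested with the equally shifted maximizer
  \<open>m \<xi> + e\<close>, which keeps the distance to the base point fixed. The corrections
  \<open>L *\<^sub>R \<xi>\<close> and \<open>L / 2 * (norm e)\<^sup>2\<close> come from the term L
  / 2 |\<xi>|^2 that \<open>C\<close> carries in addition to the sup-convolution.\<close>

lemma sup_convolution_touching:
  fixes a :: "'a::euclidean_space \<Rightarrow> real"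
  assumes "\<And>\<xi>. m \<xi> \<in> K"
    and C: "\<And>\<xi>. C \<xi> = a (m \<xi>) - L / 2 * (norm (m \<xi>))\<^sup>2 + L * (m \<xi> \<bullet> \<xi>)"
    and ge: "\<And>\<xi> y. y \<in> K \<Longrightarrow> a y - L / 2 * (norm y)\<^sup>2 + L * (y \<bullet> \<xi>) \<le> C \<xi>"
    and e: "m \<xi> + e \<in> K" and exp: "C (\<xi> + e) \<le> C \<xi> + g \<bullet> e + q"
  shows "a (m \<xi> + e) \<le> a (m \<xi>) + (g - L *\<^sub>R \<xi>) \<bullet> e + (q - L / 2 * (norm e)\<^sup>2)"
proof -
  define x where "x = m \<xi>"
  have 1: "a (x + e) - L / 2 * (norm (x + e))\<^sup>2 + L * ((x + e) \<bullet> (\<xi> + e)) \<le> C (\<xi> + e)"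
    using ge[OF e] by (simp add: x_def)
  have 2: "C \<xi> = a x - L / 2 * (norm x)\<^sup>2 + L * (x \<bullet> \<xi>)" by (simp add: C x_def)
  have n: "(norm (x + e))\<^sup>2 = (norm x)\<^sup>2 + 2 * (x \<bullet> e) + (norm e)\<^sup>2"
    unfolding power2_norm_eq_inner by (simp add: inner_add_left inner_add_right inner_commute)
  have "L * ((x + e) \<bullet> (\<xi> + e)) = L * (x \<bullet> \<xi>) + L * (x \<bullet> e) + L * (\<xi> \<bullet> e) + L * (norm e)\<^sup>2"
    unfolding power2_norm_eq_inner by (simp add: inner_add_left inner_add_right inner_commute distrib_left)
  moreover have "L / 2 * (norm (x + e))\<^sup>2 = L / 2 * (norm x)\<^sup>2 + L * (x \<bullet> e) + L / 2 * (norm e)\<^sup>2"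
    unfolding n by (simp add: field_simps)
  moreover have "(g - L *\<^sub>R \<xi>) \<bullet> e = g \<bullet> e - L * (\<xi> \<bullet> e)" by (simp add: inner_diff_left)
  ultimately show ?thesis using 1 2 exp unfolding x_def by argo
qed

section \<open>The theorem on sums near a maximum point\<close>

lemma norm_Pair_sq: "(norm (x, y))\<^sup>2 = (norm x)\<^sup>2 + (norm y)\<^sup>2"
  by (simp add: norm_Pair)

text \<open>The factor 3 is the origin of the parameter \<open>L = 3 * \<alpha>\<close> and of the
  constant in the matrix bounds.\<close>

lemma three_squares:
  fixes d e f :: "'a::real_inner"
  shows "(norm (d + e + f))\<^sup>2 \<le> 3 * ((norm d)\<^sup>2 + (norm e)\<^sup>2 + (norm f)\<^sup>2)"
proof -
  have "0 \<le> (norm (d - e))\<^sup>2 + (norm (e - f))\<^sup>2 + (norm (d - f))\<^sup>2" by simp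
  then show ?thesis unfolding power2_norm_eq_inner
    by (simp add: inner_add_left inner_add_right inner_diff_left inner_diff_right inner_commute)
qed

text \<open>The theorem on sums up to an error \<open>\<kappa>\<close>, at points near the maximum point,
  which is normalized to be the origin.\<close>

lemma sums_approx:
  fixes a b :: "'a::euclidean_space \<Rightarrow> real"
  assumes A: "compact A" "0 \<in> A" "usc_on A a" "a 0 = 0" and B: "compact B" "0 \<in> B" "usc_on B b" "b 0 = 0"
    and le: "\<And>x y. x \<in> A \<Longrightarrow> y \<in> B \<Longrightarrow> a x + b y \<le> \<alpha> / 2 * (norm (x - y))\<^sup>2"
    and pos: "0 < \<alpha>" "0 < \<kappa>" "0 < \<delta>"
  obtains x y p q X Y where "x \<in> A" "y \<in> B" "norm x < \<delta>" "norm y < \<delta>" "norm p < \<delta>" "norm q < \<delta>"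
    "\<bar>a x\<bar> < \<delta>" "\<bar>b y\<bar> < \<delta>" "linear X" "linear Y"
    "\<And>\<epsilon>. 0 < \<epsilon> \<Longrightarrow> \<exists>d>0. \<forall>e. norm e < d \<longrightarrow> x + e \<in> A \<longrightarrow>
      a (x + e) \<le> a x + p \<bullet> e + e \<bullet> X e / 2 + \<epsilon> * (norm e)\<^sup>2"
    "\<And>\<epsilon>. 0 < \<epsilon> \<Longrightarrow> \<exists>d>0. \<forall>e. norm e < d \<longrightarrow> y + e \<in> B \<longrightarrow>
      b (y + e) \<le> b y + q \<bullet> e + e \<bullet> Y e / 2 + \<epsilon> * (norm e)\<^sup>2"
    "\<And>e. - 3 * \<alpha> * (norm e)\<^sup>2 \<le> e \<bullet> X e" "\<And>e. - 3 * \<alpha> * (norm e)\<^sup>2 \<le> e \<bullet> Y e"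
    "\<And>e f. e \<bullet> X e + f \<bullet> Y f \<le> 3 * \<alpha> * (norm (e - f))\<^sup>2 + \<kappa> * ((norm e)\<^sup>2 + (norm f)\<^sup>2)"
proof -
  define L where "L = 3 * \<alpha>"
  have L: "0 < L" using pos by (simp add: L_def)
  have "A \<noteq> {}" "B \<noteq> {}" using A B by auto
  then obtain Ca m where m: "\<And>\<xi>. m \<xi> \<in> A"
      "\<And>\<xi>. Ca \<xi> = a (m \<xi>) - L / 2 * (norm (m \<xi>))\<^sup>2 + L * (m \<xi> \<bullet> \<xi>)"
      "\<And>\<xi> y. y \<in> A \<Longrightarrow> a y - L / 2 * (norm y)\<^sup>2 + L * (y \<bullet> \<xi>) \<le> Ca \<xi>"
    using sup_convolution_exists[of A a L] A by blast
  obtain Cb n where n: "\<And>\<xi>. n \<xi> \<in> B"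
      "\<And>\<xi>. Cb \<xi> = b (n \<xi>) - L / 2 * (norm (n \<xi>))\<^sup>2 + L * (n \<xi> \<bullet> \<xi>)"
      "\<And>\<xi> y. y \<in> B \<Longrightarrow> b y - L / 2 * (norm y)\<^sup>2 + L * (y \<bullet> \<xi>) \<le> Cb \<xi>"
    using sup_convolution_exists[of B b L] B \<open>B \<noteq> {}\<close> by blast
  define G where "G = (\<lambda>z. Ca (fst z) + Cb (snd z))"
  define Q where "Q = (\<lambda>z::'a \<times> 'a. (L *\<^sub>R (fst z - snd z) + L *\<^sub>R fst z, L *\<^sub>R (snd z - fst z) + L *\<^sub>R snd z))"
  have subCa: "Ca \<xi> + L *\<^sub>R m \<xi> \<bullet> (\<xi>' - \<xi>) \<le> Ca \<xi>'" for \<xi> \<xi>'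
    using m(3)[OF m(1)[of \<xi>], of \<xi>'] m(2)[of \<xi>] by (simp add: inner_diff_right algebra_simps)
  have subCb: "Cb \<xi> + L *\<^sub>R n \<xi> \<bullet> (\<xi>' - \<xi>) \<le> Cb \<xi>'" for \<xi> \<xi>'
    using n(3)[OF n(1)[of \<xi>], of \<xi>'] n(2)[of \<xi>] by (simp add: inner_diff_right algebra_simps)
  have subG: "subgradient G z (L *\<^sub>R m (fst z), L *\<^sub>R n (snd z))" for z
    unfolding subgradient_def
  proof
    fix w
    show "G z + (L *\<^sub>R m (fst z), L *\<^sub>R n (snd z)) \<bullet> (w - z) \<le> G w"
      using subCa[of "fst z" "fst w"] subCb[of "snd z" "snd w"] by (simp add: G_def inner_prod_def)
  qed
  have quad: "z \<bullet> Q z = L * (norm (fst z - snd z))\<^sup>2 + L * ((norm (fst z))\<^sup>2 + (norm (snd z))\<^sup>2)" for z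
    unfolding power2_norm_eq_inner Q_def
    by (simp add: inner_prod_def inner_add_right inner_diff_left inner_diff_right inner_commute algebra_simps)
  \<comment> \<open>The difference x - y is split through \<xi> and \<eta>. With
    \<open>L = 3 * \<alpha>\<close> the squares of x - \<xi> and \<eta> - y cancel against the
    penalties in \<open>Ca\<close> and \<open>Cb\<close>.\<close>
  have G_le: "G z \<le> z \<bullet> Q z / 2" for z
  proof -
    define \<xi> \<eta> where "\<xi> = fst z" and "\<eta> = snd z"
    define x y where "x = m \<xi>" and "y = n \<eta>"
    have "a x + b y \<le> \<alpha> / 2 * (norm ((\<xi> - \<eta>) + (x - \<xi>) + (\<eta> - y)))\<^sup>2"
      using le[of x y] m(1) n(1) by (simp add: x_def y_def)
    also have "\<dots> \<le> \<alpha> / 2 * (3 * ((norm (\<xi> - \<eta>))\<^sup>2 + (norm (x - \<xi>))\<^sup>2 + (norm (\<eta> - y))\<^sup>2))"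
      using pos by (intro mult_left_mono three_squares) auto
    also have "\<dots> = L / 2 * (norm (\<xi> - \<eta>))\<^sup>2 + L / 2 * (norm (x - \<xi>))\<^sup>2 + L / 2 * (norm (\<eta> - y))\<^sup>2"
      by (simp add: L_def algebra_simps)
    finally have 1: "a x + b y \<le> L / 2 * (norm (\<xi> - \<eta>))\<^sup>2 + L / 2 * (norm (x - \<xi>))\<^sup>2 + L / 2 * (norm (\<eta> - y))\<^sup>2" .
    have 2: "L / 2 * (norm (x - \<xi>))\<^sup>2 = L / 2 * (norm x)\<^sup>2 - L * (x \<bullet> \<xi>) + L / 2 * (norm \<xi>)\<^sup>2"
      "L / 2 * (norm (\<eta> - y))\<^sup>2 = L / 2 * (norm y)\<^sup>2 - L * (y \<bullet> \<eta>) + L / 2 * (norm \<eta>)\<^sup>2"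
      unfolding power2_norm_eq_inner
      by (simp_all add: inner_diff_left inner_diff_right inner_commute field_simps)
    have "G z = a x - L / 2 * (norm x)\<^sup>2 + L * (x \<bullet> \<xi>) + (b y - L / 2 * (norm y)\<^sup>2 + L * (y \<bullet> \<eta>))"
      using m(2)[of \<xi>] n(2)[of \<eta>] by (simp add: G_def x_def y_def \<xi>_def \<eta>_def)
    moreover have "z \<bullet> Q z / 2 = L / 2 * (norm (\<xi> - \<eta>))\<^sup>2 + L / 2 * (norm \<xi>)\<^sup>2 + L / 2 * (norm \<eta>)\<^sup>2"
      unfolding quad by (simp add: \<xi>_def \<eta>_def field_simps)
    ultimately show ?thesis using 1 2 by argo
  qed
  \<comment> \<open>Each value is at least 0 by testing with the origin, and their sum is at most 0
    by \<open>G_le\<close>.\<close>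
  have "0 \<le> Ca 0" "0 \<le> Cb 0" using m(3)[OF A(2), of 0] n(3)[OF B(2), of 0] A B by simp_all
  moreover have "Ca 0 + Cb 0 \<le> 0" using G_le[of 0] by (simp add: G_def)
  ultimately have C0: "Ca 0 = 0" "Cb 0 = 0" by auto
  have "bounded (A \<union> B)" using A(1) B(1) by (simp add: compact_imp_bounded)
  then obtain R where R: "0 < R" "\<And>x. x \<in> A \<union> B \<Longrightarrow> norm x \<le> R" by (metis bounded_pos)
  \<comment> \<open>The summands collect the factors by which \<open>\<delta>'\<close> enters the
    bounds for points, gradients and values; \<open>R\<close> bounds the maximizers.\<close>
  define c where "c = 1 + 1 / L + L + 2 * L * R + R"
  have c: "1 < c" using L R by (simp add: c_def add_pos_pos)
  define \<delta>' where "\<delta>' = \<delta> / c"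
  have \<delta>': "0 < \<delta>'" using pos c by (simp add: \<delta>'_def)
  have \<delta>_eq: "\<delta> = \<delta>' + \<delta>' / L + L * \<delta>' + 2 * L * R * \<delta>' + R * \<delta>'"
  proof -
    have "\<delta> = \<delta>' * c" using c by (simp add: \<delta>'_def)
    then show ?thesis by (simp add: c_def algebra_simps)
  qed
  have nn: "0 < \<delta>' / L" "0 < L * \<delta>'" "0 < 2 * L * R * \<delta>'" "0 < R * \<delta>'" using \<delta>' L R by auto
  have linQ: "linear Q" unfolding Q_def
    by (intro linearI) (auto simp: algebra_simps)
  have symQ: "Q x \<bullet> y = x \<bullet> Q y" for x y
    by (simp add: Q_def inner_prod_def algebra_simps inner_add_left inner_add_right)
  have touchG: "G z \<le> G 0 + z \<bullet> Q z / 2" for z using G_le[of z] by (simp add: G_def C0)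
  have exG: "\<exists>g. subgradient G z g" for z using subG by blast
  obtain z g M where z: "norm z < \<delta>'" "norm g < \<delta>'" "linear M"
    and gz: "subgradient G z g"
    and uniq: "\<And>g'. subgradient G z g' \<Longrightarrow> g' = g"
    and M0: "\<And>e. 0 \<le> e \<bullet> M e" and MQ: "\<And>e. e \<bullet> M e \<le> e \<bullet> Q e + \<kappa> * (norm e)\<^sup>2"
    and exp: "\<And>\<epsilon>. 0 < \<epsilon> \<Longrightarrow> \<exists>d>0. \<forall>e. norm e < d \<longrightarrow>
      \<bar>G (z + e) - G z - g \<bullet> e - e \<bullet> M e / 2\<bar> \<le> \<epsilon> * (norm e)\<^sup>2"
  proof (rule jensen_alexandrov[OF exG linQ symQ touchG pos(2) \<delta>'], goal_cases)
    case (1 z g M)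
    show ?case by (rule that; fact 1)
  qed
  define \<xi> \<eta> where "\<xi> = fst z" and "\<eta> = snd z"
  define x y where "x = m \<xi>" and "y = n \<eta>"
  \<comment> \<open>Uniqueness identifies the gradient with \<open>L\<close> times the maximizers,
    so its smallness puts \<open>x\<close> and \<open>y\<close> near the origin.\<close>
  have g: "g = (L *\<^sub>R x, L *\<^sub>R y)" using uniq[OF subG] by (simp add: x_def y_def \<xi>_def \<eta>_def)
  have "norm \<xi> \<le> norm z" "norm \<eta> \<le> norm z"
    using norm_fst_le[of "fst z" "snd z"] norm_snd_le[of "snd z" "fst z"] by (simp_all add: \<xi>_def \<eta>_def)
  then have small: "norm \<xi> < \<delta>'" "norm \<eta> < \<delta>'" using z(1) by auto
  have Lx: "norm (L *\<^sub>R x) < \<delta>'" "norm (L *\<^sub>R y) < \<delta>'"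
    using norm_fst_le[of "L *\<^sub>R x" "L *\<^sub>R y"] norm_snd_le[of "L *\<^sub>R y" "L *\<^sub>R x"] z(2) by (auto simp: g)
  then have xy: "norm x < \<delta>' / L" "norm y < \<delta>' / L" using L by (auto simp: field_simps)
  \<comment> \<open>As \<open>a\<close> and \<open>b\<close> are only semicontinuous, nearness of
    the points says nothing about the values. These are recovered from the sup-convolutions, whose
    subgradients at 0 and \<xi> are bounded by \<open>L * R\<close>.\<close>
  have value_small: "\<bar>f x\<bar> < \<delta>" if C: "C \<xi> = f x - L / 2 * (norm x)\<^sup>2 + L * (x \<bullet> \<xi>)" "C 0 = 0"
      "C \<xi> + L *\<^sub>R x \<bullet> (0 - \<xi>) \<le> C 0" "C 0 + L *\<^sub>R w \<bullet> (\<xi> - 0) \<le> C \<xi>"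
    and bd: "norm w \<le> R" "norm x \<le> R" "norm x < \<delta>' / L" "norm \<xi> < \<delta>'"
    for f C :: "'a \<Rightarrow> real" and \<xi> x w
  proof -
    have "\<bar>x \<bullet> \<xi>\<bar> \<le> R * \<delta>'" "\<bar>w \<bullet> \<xi>\<bar> \<le> R * \<delta>'"
      using bd R(1) by (auto intro!: order_trans[OF Cauchy_Schwarz_ineq2] mult_mono)
    then have LR: "\<bar>L * (x \<bullet> \<xi>)\<bar> \<le> L * (R * \<delta>')" "\<bar>L * (w \<bullet> \<xi>)\<bar> \<le> L * (R * \<delta>')"
      using L by (auto simp: abs_mult)
    have "norm x * norm x \<le> R * (\<delta>' / L)" using bd R(1) by (intro mult_mono) auto
    then have "L * (norm x)\<^sup>2 \<le> L * (R * (\<delta>' / L))"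
      using L by (intro mult_left_mono) (auto simp: power2_eq_square)
    then have "L * (norm x)\<^sup>2 \<le> R * \<delta>'" using L by simp
    moreover have "0 \<le> L * (norm x)\<^sup>2" using L by simp
    ultimately show ?thesis using C LR \<delta>_eq nn \<delta>' by (simp add: abs_le_iff abs_less_iff; argo)
  qed
  have bnd_a: "\<bar>a x\<bar> < \<delta>"
    by (rule value_small[where C = Ca and \<xi> = \<xi> and w = "m 0"])
      (use m(2)[of \<xi>] C0 subCa[of \<xi> 0] subCa[of 0 \<xi>] R m(1) xy small in \<open>auto simp: x_def\<close>)
  have bnd_b: "\<bar>b y\<bar> < \<delta>"
    by (rule value_small[where C = Cb and \<xi> = \<eta> and w = "n 0"])
      (use n(2)[of \<eta>] C0 subCb[of \<eta> 0] subCb[of 0 \<eta>] R n(1) xy small in \<open>auto simp: y_def\<close>)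
  \<comment> \<open>Subtracting \<open>L\<close> undoes the extra term L / 2 |\<xi>|^2. From the
    form \<open>Q\<close> it removes exactly the two separate squares, leaving
    \<open>3 * \<alpha>\<close> |e - f|^2, and from M \<ge> 0 it gives the lower bound
    \<open>- 3 * \<alpha>\<close>.\<close>
  define X where "X e = fst (M (e, 0)) - L *\<^sub>R e" for e
  define Y where "Y f = snd (M (0, f)) - L *\<^sub>R f" for f
  have lin: "linear X" "linear Y"
  proof -
    have pairs: "(e + f, 0::'a) = (e, 0) + (f, 0)" "(0::'a, e + f) = (0, e) + (0, f)"
      "(r *\<^sub>R e, 0::'a) = r *\<^sub>R (e, 0)" "(0::'a, r *\<^sub>R e) = r *\<^sub>R (0, e)" for e f :: 'a and r by simp_all
    show "linear X" "linear Y" unfolding X_def Y_def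
      by (intro linearI; simp add: pairs linear_add[OF z(3)] linear_scale[OF z(3)] scaleR_diff_right
          scaleR_add_right del: add_Pair scaleR_Pair)+
  qed
  have MX: "(e, 0) \<bullet> M (e, 0) = e \<bullet> X e + L * (norm e)\<^sup>2" for e
    by (simp add: X_def inner_prod_def inner_diff_right power2_norm_eq_inner)
  have MY: "(0, f) \<bullet> M (0, f) = f \<bullet> Y f + L * (norm f)\<^sup>2" for f
    by (simp add: Y_def inner_prod_def inner_diff_right power2_norm_eq_inner)
  text \<open>\<open>G\<close> is a sum of functions of the two variables, so its Hessian is block diagonal.\<close>
  have split: "w \<bullet> M w = (fst w, 0) \<bullet> M (fst w, 0) + (0, snd w) \<bullet> M (0, snd w)" for w
  proof -
    define q where "q w = w \<bullet> M w - (fst w, 0) \<bullet> M (fst w, 0) - (0, snd w) \<bullet> M (0, snd w)" for w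
    have scale: "q (t *\<^sub>R w) = t\<^sup>2 * q w" for t w
    proof -
      have pairs: "(fst (t *\<^sub>R w), 0::'a) = t *\<^sub>R (fst w, 0)" "(0::'a, snd (t *\<^sub>R w)) = t *\<^sub>R (0, snd w)"
        by simp_all
      show ?thesis
        unfolding q_def pairs linear_scale[OF z(3)] inner_scaleR_left inner_scaleR_right
        by (simp add: power2_eq_square algebra_simps)
    qed
    have small: "\<exists>d>0. \<forall>w. norm w < d \<longrightarrow> \<bar>q w\<bar> \<le> \<epsilon> * (norm w)\<^sup>2" if "0 < \<epsilon>" for \<epsilon>
    proof -
      obtain d where d: "d > 0" "\<And>e. norm e < d \<Longrightarrow>
          \<bar>G (z + e) - G z - g \<bullet> e - e \<bullet> M e / 2\<bar> \<le> \<epsilon> / 4 * (norm e)\<^sup>2"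
        using exp[of "\<epsilon> / 4"] \<open>0 < \<epsilon>\<close> by auto
      have "\<bar>q w\<bar> \<le> \<epsilon> * (norm w)\<^sup>2" if w: "norm w < d" for w
      proof -
        define u v where "u = (fst w, 0::'a)" and "v = (0::'a, snd w)"
        have nw: "(norm w)\<^sup>2 = (norm u)\<^sup>2 + (norm v)\<^sup>2" by (cases w) (simp add: u_def v_def norm_Pair)
        have "norm u \<le> norm w" "norm v \<le> norm w"
          using norm_fst_le[of "fst w" "snd w"] norm_snd_le[of "snd w" "fst w"] by (simp_all add: u_def v_def norm_Pair)
        then have "norm u < d" "norm v < d" using w by auto
        note E = d(2)[OF w] d(2)[OF this(1)] d(2)[OF this(2)]
        \<comment> \<open>The mixed second difference of a sum of functions of separate variables
          vanishes.\<close>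
        have "G (z + w) - G (z + u) - G (z + v) + G z = 0"
          by (simp add: G_def u_def v_def)
        moreover have "g \<bullet> w = g \<bullet> u + g \<bullet> v" by (simp add: u_def v_def inner_prod_def)
        moreover have "\<epsilon> / 4 * (norm w)\<^sup>2 = \<epsilon> / 4 * (norm u)\<^sup>2 + \<epsilon> / 4 * (norm v)\<^sup>2"
          unfolding nw by (simp add: distrib_left)
        ultimately show ?thesis using E unfolding q_def u_def[symmetric] v_def[symmetric] by argo
      qed
      then show ?thesis using d(1) by blast
    qed
    have "q w \<le> 0"
    proof (rule quadratic_nonpos_if_small[where q = q, OF scale])
      fix \<epsilon> :: real assume "0 < \<epsilon>"
      from small[OF this] show "\<exists>d>0. \<forall>e. norm e < d \<longrightarrow> q e \<le> \<epsilon> * (norm e)\<^sup>2"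
        by (auto simp: abs_le_iff)
    qed
    moreover have "- q w \<le> 0"
    proof (rule quadratic_nonpos_if_small[where q = "\<lambda>w. - q w"])
      fix \<epsilon> :: real assume "0 < \<epsilon>"
      from small[OF this] show "\<exists>d>0. \<forall>e. norm e < d \<longrightarrow> - q e \<le> \<epsilon> * (norm e)\<^sup>2"
        by (auto simp: abs_le_iff)
    qed (simp add: scale)
    ultimately show ?thesis by (simp add: q_def)
  qed
  have touchX: "\<exists>d>0. \<forall>e. norm e < d \<longrightarrow> x + e \<in> A \<longrightarrow>
      a (x + e) \<le> a x + (L *\<^sub>R x - L *\<^sub>R \<xi>) \<bullet> e + e \<bullet> X e / 2 + \<epsilon> * (norm e)\<^sup>2" if "0 < \<epsilon>" for \<epsilon>
  proof -
    obtain d where d: "d > 0" "\<And>e. norm e < d \<Longrightarrow>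
      \<bar>G (z + e) - G z - g \<bullet> e - e \<bullet> M e / 2\<bar> \<le> \<epsilon> * (norm e)\<^sup>2" using exp[OF \<open>0 < \<epsilon>\<close>] by blast
    have "a (x + e) \<le> a x + (L *\<^sub>R x - L *\<^sub>R \<xi>) \<bullet> e + e \<bullet> X e / 2 + \<epsilon> * (norm e)\<^sup>2"
      if e: "norm e < d" "x + e \<in> A" for e
    proof -
      have "G (z + (e, 0)) - G z = Ca (\<xi> + e) - Ca \<xi>" by (simp add: G_def \<xi>_def)
      then have "Ca (\<xi> + e) \<le> Ca \<xi> + L *\<^sub>R x \<bullet> e + ((e \<bullet> X e + L * (norm e)\<^sup>2) / 2 + \<epsilon> * (norm e)\<^sup>2)"
        using d(2)[of "(e, 0)"] e(1) MX[of e] by (simp add: g norm_Pair abs_le_iff)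
      then show ?thesis
        using sup_convolution_touching[OF m, of \<xi> e "L *\<^sub>R x" "(e \<bullet> X e + L * (norm e)\<^sup>2) / 2 + \<epsilon> * (norm e)\<^sup>2"] e(2)
        by (simp add: x_def add_divide_distrib)
    qed
    then show ?thesis using d(1) by blast
  qed
  have touchY: "\<exists>d>0. \<forall>e. norm e < d \<longrightarrow> y + e \<in> B \<longrightarrow>
      b (y + e) \<le> b y + (L *\<^sub>R y - L *\<^sub>R \<eta>) \<bullet> e + e \<bullet> Y e / 2 + \<epsilon> * (norm e)\<^sup>2" if "0 < \<epsilon>" for \<epsilon>
  proof -
    obtain d where d: "d > 0" "\<And>e. norm e < d \<Longrightarrow>
      \<bar>G (z + e) - G z - g \<bullet> e - e \<bullet> M e / 2\<bar> \<le> \<epsilon> * (norm e)\<^sup>2" using exp[OF \<open>0 < \<epsilon>\<close>] by blast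
    have "b (y + e) \<le> b y + (L *\<^sub>R y - L *\<^sub>R \<eta>) \<bullet> e + e \<bullet> Y e / 2 + \<epsilon> * (norm e)\<^sup>2"
      if e: "norm e < d" "y + e \<in> B" for e
    proof -
      have "G (z + (0, e)) - G z = Cb (\<eta> + e) - Cb \<eta>" by (simp add: G_def \<eta>_def)
      then have "Cb (\<eta> + e) \<le> Cb \<eta> + L *\<^sub>R y \<bullet> e + ((e \<bullet> Y e + L * (norm e)\<^sup>2) / 2 + \<epsilon> * (norm e)\<^sup>2)"
        using d(2)[of "(0, e)"] e(1) MY[of e] by (simp add: g norm_Pair abs_le_iff)
      then show ?thesis
        using sup_convolution_touching[OF n, of \<eta> e "L *\<^sub>R y" "(e \<bullet> Y e + L * (norm e)\<^sup>2) / 2 + \<epsilon> * (norm e)\<^sup>2"] e(2)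
        by (simp add: y_def add_divide_distrib)
    qed
    then show ?thesis using d(1) by blast
  qed
  have grad_small: "norm (L *\<^sub>R x' - L *\<^sub>R \<xi>') < \<delta>" if "norm (L *\<^sub>R x') < \<delta>'" "norm \<xi>' < \<delta>'" for x' \<xi>' :: 'a
  proof -
    have "norm (L *\<^sub>R x' - L *\<^sub>R \<xi>') \<le> norm (L *\<^sub>R x') + norm (L *\<^sub>R \<xi>')" by (rule norm_triangle_ineq4)
    also have "norm (L *\<^sub>R \<xi>') \<le> L * \<delta>'" using that(2) L by simp
    finally show ?thesis using that(1) \<delta>_eq nn by linarith
  qed
  have lower: "- 3 * \<alpha> * (norm e)\<^sup>2 \<le> e \<bullet> X e" "- 3 * \<alpha> * (norm e)\<^sup>2 \<le> e \<bullet> Y e" for e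
    using M0[of "(e, 0)"] M0[of "(0, e)"] MX[of e] MY[of e] by (simp_all add: L_def)
  have upper: "e \<bullet> X e + f \<bullet> Y f \<le> 3 * \<alpha> * (norm (e - f))\<^sup>2 + \<kappa> * ((norm e)\<^sup>2 + (norm f)\<^sup>2)" for e f
    using MQ[of "(e, f)"] split[of "(e, f)"] MX[of e] MY[of f] quad[of "(e, f)"]
    by (simp add: norm_Pair_sq L_def distrib_left)
  have "norm x < \<delta>" "norm y < \<delta>" using xy \<delta>_eq nn \<delta>' by linarith+
  then show thesis
    using that[OF _ _ _ _ grad_small[OF Lx(1) small(1)] grad_small[OF Lx(2) small(2)] bnd_a bnd_b lin touchX touchY lower upper]
      m(1) n(1) by (simp add: x_def y_def)
qed

section \<open>Quadratic forms and symmetric matrices\<close>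

lemma block_mat_quadratic_form:
  fixes v :: "real^('n::finite + 'n)"
  defines "e \<equiv> \<chi> k. v $ Inl k" and "f \<equiv> \<chi> k. v $ Inr k"
  shows "v \<bullet> (block_mat A B C D *v v) = e \<bullet> (A *v e) + e \<bullet> (B *v f) + f \<bullet> (C *v e) + f \<bullet> (D *v f)"
proof -
  have sum_Plus: "(\<Sum>i\<in>UNIV. g i) = (\<Sum>k\<in>UNIV. g (Inl k)) + (\<Sum>k\<in>UNIV. g (Inr k))"
    for g :: "'n + 'n \<Rightarrow> real"
    by (simp add: UNIV_Plus_UNIV[symmetric] sum.Plus del: UNIV_Plus_UNIV)
  show ?thesis
    by (simp add: inner_vec_def matrix_vector_mult_def block_mat_def e_def f_def sum_Plus
        sum.distrib distrib_left)
qed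

text \<open>The expansions see a linear map only through its quadratic form, which symmetrization
  preserves; test functions need a symmetric Hessian.\<close>

lemma symmetrized_matrix:
  fixes f :: "real^'n \<Rightarrow> real^'n::finite"
  assumes f: "linear f"
  defines "S \<equiv> (1 / 2) *\<^sub>R (matrix f + transpose (matrix f))"
  shows "sym_mat S" "e \<bullet> (S *v e) = e \<bullet> f e"
proof -
  show "sym_mat S"
    by (simp add: sym_mat_def S_def transpose_def vec_eq_iff add.commute)
  have "e \<bullet> (transpose (matrix f) *v e) = e \<bullet> (matrix f *v e)"
    using dot_lmul_matrix[of e "matrix f" e] by (simp add: transpose_matrix_vector inner_commute)
  then show "e \<bullet> (S *v e) = e \<bullet> f e"
    by (simp add: S_def scaleR_matrix_vector_assoc[symmetric] matrix_vector_mult_add_rdistrib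
        inner_add_right matrix_vector_mul(2)[OF f])
qed

lemma norm_le_sum_entries:
  fixes S :: "real^'n^'m::finite"
  shows "norm S \<le> (\<Sum>i\<in>UNIV. \<Sum>j\<in>UNIV. \<bar>S $ i $ j\<bar>)"
proof -
  have "norm S \<le> (\<Sum>i\<in>UNIV. norm (S $ i))"
    unfolding norm_vec_def by (rule L2_set_le_sum) simp
  also have "\<dots> \<le> (\<Sum>i\<in>UNIV. \<Sum>j\<in>UNIV. \<bar>S $ i $ j\<bar>)"
    by (intro sum_mono norm_le_l1_cart)
  finally show ?thesis .
qed

lemma sym_mat_nth:
  assumes "sym_mat S"
  shows "S $ j $ i = S $ i $ j"
proof -
  have "transpose S $ i $ j = S $ j $ i" by (simp add: transpose_def)
  then show ?thesis using assms by (simp add: sym_mat_def)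
qed

text \<open>Polarization expresses an entry by two values of the form, and the parallelogram law
  makes the two squared norms sum to 4. This turns bounds on forms into compactness of a sequence of
  matrices.\<close>

lemma sym_mat_entry_bound:
  fixes S :: "real^'n^'n::finite"
  assumes S: "sym_mat S" and c: "\<And>e. \<bar>e \<bullet> (S *v e)\<bar> \<le> c * (norm e)\<^sup>2"
  shows "\<bar>S $ i $ j\<bar> \<le> c"
proof -
  define u v where "u = (axis i 1 :: real^'n)" and "v = (axis j 1 :: real^'n)"
  have n: "norm u = 1" "norm v = 1" by (simp_all add: u_def v_def)
  have uv: "u \<bullet> (S *v v) = S $ i $ j"
    by (simp add: u_def v_def inner_axis' matrix_vector_mul_component inner_axis)
  have "v \<bullet> (S *v u) = S $ j $ i"
    by (simp add: u_def v_def inner_axis' matrix_vector_mul_component inner_axis)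
  then have vu: "v \<bullet> (S *v u) = S $ i $ j" using sym_mat_nth[OF S] by simp
  have pol: "4 * S $ i $ j = (u + v) \<bullet> (S *v (u + v)) - (u - v) \<bullet> (S *v (u - v))"
    by (simp add: matrix_vector_right_distrib matrix_vector_mult_diff_distrib inner_add_left inner_add_right
        inner_diff_left inner_diff_right uv vu)
  have "(norm (u + v))\<^sup>2 + (norm (u - v))\<^sup>2 = 4"
    using n unfolding norm_eq_1 power2_norm_eq_inner
    by (simp add: inner_add_left inner_add_right inner_diff_left inner_diff_right)
  then have "c * (norm (u + v))\<^sup>2 + c * (norm (u - v))\<^sup>2 = c * 4" by (simp add: distrib_left[symmetric])
  then show ?thesis using c[of "u + v"] c[of "u - v"] pol by linarith
qed

lemma tendsto_quadratic_form:
  fixes S :: "nat \<Rightarrow> real^'n^'n::finite"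
  assumes "S \<longlonglongrightarrow> X"
  shows "(\<lambda>k. e \<bullet> (S k *v e)) \<longlonglongrightarrow> e \<bullet> (X *v e)"
  unfolding inner_vec_def matrix_vector_mult_def
  by (auto intro!: tendsto_intros assms)

lemma sym_mat_limit:
  fixes S :: "nat \<Rightarrow> real^'n^'n::finite"
  assumes S: "S \<longlonglongrightarrow> X" and sym: "\<And>k. sym_mat (S k)"
  shows "sym_mat X"
proof -
  have "X $ i $ j = X $ j $ i" for i j
  proof (rule LIMSEQ_unique)
    show "(\<lambda>k. S k $ i $ j) \<longlonglongrightarrow> X $ i $ j" by (intro tendsto_intros S)
    have "(\<lambda>k. S k $ j $ i) \<longlonglongrightarrow> X $ j $ i" by (intro tendsto_intros S)
    then show "(\<lambda>k. S k $ i $ j) \<longlonglongrightarrow> X $ j $ i" by (simp only: sym_mat_nth[OF sym, of _ j i])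
  qed
  then show ?thesis by (simp add: sym_mat_def transpose_def vec_eq_iff)
qed

section \<open>Second-order jets and their limits\<close>

text \<open>The inequality is strict so that the quadratic polynomial itself serves as a test
  function.\<close>

definition strictly_touched ::
  "(real^'n) set \<Rightarrow> (real^'n \<Rightarrow> real) \<Rightarrow> real^'n \<Rightarrow> real^'n \<Rightarrow> real^'n^'n \<Rightarrow> bool"
  where "strictly_touched K a x p X \<longleftrightarrow> x \<in> K \<and> sym_mat X \<and>
    (\<exists>d>0. \<forall>e. e \<noteq> 0 \<longrightarrow> norm e < d \<longrightarrow> x + e \<in> K \<longrightarrow> a (x + e) < a x + p \<bullet> e + e \<bullet> (X *v e) / 2)"

text \<open>\<open>(p, X)\<close> belongs to the closure of the second-order superjet of \<open>a\<close> at \<open>x\<close>.\<close>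

definition superjet_limit ::
  "(real^'n) set \<Rightarrow> (real^'n \<Rightarrow> real) \<Rightarrow> real^'n \<Rightarrow> real^'n \<Rightarrow> real^'n^'n \<Rightarrow> bool"
  where "superjet_limit K a x p X \<longleftrightarrow> (\<exists>xs ps Xs. (\<forall>k::nat. strictly_touched K a (xs k) (ps k) (Xs k)) \<and>
    xs \<longlonglongrightarrow> x \<and> (\<lambda>k. a (xs k)) \<longlonglongrightarrow> a x \<and> ps \<longlonglongrightarrow> p \<and> Xs \<longlonglongrightarrow> X)"

text \<open>Adding \<open>\<kappa>\<close> times the identity contributes
  \<open>\<kappa> / 2\<close> |e|^2, which strictly dominates an expansion error of
  \<open>\<kappa> / 4\<close> |e|^2. The linear term with slope \<open>p\<close> undoes the
  normalization at \<open>z\<close>.\<close>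

lemma strictly_touched_shift:
  fixes a :: "real^'n::finite \<Rightarrow> real"
  assumes X: "linear X" and x: "z + x \<in> K" and \<kappa>: "0 < \<kappa>"
    and touch: "\<And>\<epsilon>. 0 < \<epsilon> \<Longrightarrow> \<exists>d>0. \<forall>e. norm e < d \<longrightarrow> z + (x + e) \<in> K \<longrightarrow>
      a (z + (x + e)) - a z - p \<bullet> (x + e) \<le> a (z + x) - a z - p \<bullet> x + q \<bullet> e + e \<bullet> X e / 2 + \<epsilon> * (norm e)\<^sup>2"
  shows "strictly_touched K a (z + x) (p + q) ((1 / 2) *\<^sub>R (matrix X + transpose (matrix X)) + \<kappa> *\<^sub>R mat 1)"
proof -
  define S where "S = (1 / 2) *\<^sub>R (matrix X + transpose (matrix X))"
  have S: "sym_mat S" "\<And>e. e \<bullet> (S *v e) = e \<bullet> X e"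
    using symmetrized_matrix[OF X] by (simp_all add: S_def)
  have "sym_mat (S + \<kappa> *\<^sub>R mat 1)"
    using S(1) by (simp add: sym_mat_def transpose_def vec_eq_iff mat_def)
  moreover have q: "e \<bullet> ((S + \<kappa> *\<^sub>R mat 1) *v e) = e \<bullet> X e + \<kappa> * (norm e)\<^sup>2" for e
    by (simp add: matrix_vector_mult_add_rdistrib inner_add_right S(2) scaleR_matrix_vector_assoc[symmetric]
        power2_norm_eq_inner)
  moreover obtain d where d: "d > 0" "\<And>e. norm e < d \<Longrightarrow> z + (x + e) \<in> K \<Longrightarrow>
      a (z + (x + e)) - a z - p \<bullet> (x + e) \<le> a (z + x) - a z - p \<bullet> x + q \<bullet> e + e \<bullet> X e / 2 + \<kappa> / 4 * (norm e)\<^sup>2"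
    using touch[of "\<kappa> / 4"] \<kappa> by auto
  have "a (z + x + e) < a (z + x) + (p + q) \<bullet> e + e \<bullet> ((S + \<kappa> *\<^sub>R mat 1) *v e) / 2"
    if e: "e \<noteq> 0" "norm e < d" "z + x + e \<in> K" for e
  proof -
    have "0 < \<kappa> * (norm e)\<^sup>2" using \<kappa> e(1) by simp
    moreover have "z + (x + e) \<in> K" using e(3) by (simp add: add.assoc)
    note d(2)[OF e(2) this]
    ultimately show ?thesis
      unfolding q add.assoc[symmetric, of z x e] inner_add_left inner_add_right by argo
  qed
  ultimately show ?thesis unfolding strictly_touched_def S_def[symmetric] using x d(1) by blast
qed

theorem theorem_on_sums:
  fixes a b :: "real^'n::finite \<Rightarrow> real"
  assumes K: "compact K" "x \<in> K" "y \<in> K" and a: "usc_on K a" and b: "usc_on K b" and \<alpha>: "0 < \<alpha>"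
    and max: "\<And>x' y'. x' \<in> K \<Longrightarrow> y' \<in> K \<Longrightarrow>
      a x' + b y' - \<alpha> / 2 * (norm (x' - y'))\<^sup>2 \<le> a x + b y - \<alpha> / 2 * (norm (x - y))\<^sup>2"
  obtains X Y where "sym_mat X" "sym_mat Y"
    "superjet_limit K a x (\<alpha> *\<^sub>R (x - y)) X" "superjet_limit K b y (- (\<alpha> *\<^sub>R (x - y))) Y"
    "loewner_le ((- 3 * \<alpha>) *\<^sub>R block_mat (mat 1) 0 0 (mat 1)) (block_mat X 0 0 Y)"
    "loewner_le (block_mat X 0 0 Y) ((3 * \<alpha>) *\<^sub>R block_mat (mat 1) (- mat 1) (- mat 1) (mat 1))"
proof -
  define p where "p = \<alpha> *\<^sub>R (x - y)"
  define A B where "A = {e. x + e \<in> K}" and "B = {e. y + e \<in> K}"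
  \<comment> \<open>The slopes \<open>p\<close> and \<open>- p\<close> absorb the cross term in the
    expansion of the penalization at (x + e, y + f), which moves the maximum point to the
    origin.\<close>
  define a' b' where "a' e = a (x + e) - a x - p \<bullet> e" and "b' e = b (y + e) - b y - (- p) \<bullet> e" for e
  have "compact {e. z + e \<in> K}" for z
  proof -
    have "{e. z + e \<in> K} = (\<lambda>w. w - z) ` K"
    proof (intro set_eqI iffI)
      fix e assume "e \<in> {e. z + e \<in> K}"
      then show "e \<in> (\<lambda>w. w - z) ` K" by (intro image_eqI[of _ _ "z + e"]) auto
    qed auto
    then show ?thesis using K(1) by (auto intro!: compact_continuous_image continuous_intros)
  qed
  then have cAB: "compact A" "compact B" by (auto simp: A_def B_def)
  have usc: "usc_on A a'" "usc_on B b'"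
  proof -
    have "usc_on A (\<lambda>e. a (x + e) + (- a x - p \<bullet> e))"
      by (intro usc_on_add usc_on_compose[OF a] usc_on_continuous continuous_intros) (auto simp: A_def)
    moreover have "a' = (\<lambda>e. a (x + e) + (- a x - p \<bullet> e))" by (simp add: a'_def fun_eq_iff)
    ultimately show "usc_on A a'" by simp
    have "usc_on B (\<lambda>e. b (y + e) + (- b y - (- p) \<bullet> e))"
      by (intro usc_on_add usc_on_compose[OF b] usc_on_continuous continuous_intros) (auto simp: B_def)
    moreover have "b' = (\<lambda>e. b (y + e) + (- b y - (- p) \<bullet> e))" by (simp add: b'_def fun_eq_iff)
    ultimately show "usc_on B b'" by simp
  qed
  have le: "a' e + b' f \<le> \<alpha> / 2 * (norm (e - f))\<^sup>2" if "e \<in> A" "f \<in> B" for e f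
  proof -
    have eq: "x + e - (y + f) = (x - y) + (e - f)" by simp
    have "(norm (x + e - (y + f)))\<^sup>2 = (norm (x - y))\<^sup>2 + 2 * ((x - y) \<bullet> (e - f)) + (norm (e - f))\<^sup>2"
      unfolding eq power2_norm_eq_inner inner_add_left[of "x - y"] inner_add_right[of _ "x - y"]
      by (simp add: inner_commute)
    moreover have "p \<bullet> (e - f) = \<alpha> * ((x - y) \<bullet> (e - f))" by (simp add: p_def)
    ultimately have "\<alpha> / 2 * (norm (x + e - (y + f)))\<^sup>2
        = \<alpha> / 2 * (norm (x - y))\<^sup>2 + p \<bullet> (e - f) + \<alpha> / 2 * (norm (e - f))\<^sup>2"
      by (simp add: distrib_left)
    moreover have "x + e \<in> K" "y + f \<in> K" using that by (simp_all add: A_def B_def)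
    note max[OF this]
    ultimately show ?thesis unfolding a'_def b'_def inner_diff_right inner_minus_left by argo
  qed
  define \<kappa> where "\<kappa> k = inverse (real (Suc k))" for k
  have \<kappa>: "0 < \<kappa> k" "\<kappa> k \<le> 1" for k by (auto simp: \<kappa>_def field_simps)
  have \<kappa>0: "\<kappa> \<longlonglongrightarrow> 0" unfolding \<kappa>_def by (rule LIMSEQ_inverse_real_of_nat)
  define good where "good k r \<longleftrightarrow> (case r of (xa, yb, pa, pb, X, Y) \<Rightarrow>
    norm xa < \<kappa> k \<and> norm yb < \<kappa> k \<and> norm pa < \<kappa> k \<and> norm pb < \<kappa> k \<and> \<bar>a' xa\<bar> < \<kappa> k \<and> \<bar>b' yb\<bar> < \<kappa> k \<and>
    sym_mat X \<and> sym_mat Y \<and>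
    strictly_touched K a (x + xa) (p + pa) (X + \<kappa> k *\<^sub>R mat 1) \<and>
    strictly_touched K b (y + yb) (- p + pb) (Y + \<kappa> k *\<^sub>R mat 1) \<and>
    (\<forall>e. - 3 * \<alpha> * (norm e)\<^sup>2 \<le> e \<bullet> (X *v e)) \<and> (\<forall>e. - 3 * \<alpha> * (norm e)\<^sup>2 \<le> e \<bullet> (Y *v e)) \<and>
    (\<forall>e f. e \<bullet> (X *v e) + f \<bullet> (Y *v f) \<le> 3 * \<alpha> * (norm (e - f))\<^sup>2 + \<kappa> k * ((norm e)\<^sup>2 + (norm f)\<^sup>2)))"
    for k and r :: "(real^'n) \<times> (real^'n) \<times> (real^'n) \<times> (real^'n) \<times> (real^'n^'n) \<times> (real^'n^'n)"
  have "\<exists>r. good k r" for k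
  proof -
    have 0: "0 \<in> A" "0 \<in> B" "a' 0 = 0" "b' 0 = 0" using K by (auto simp: A_def B_def a'_def b'_def)
    show ?thesis
    proof (rule sums_approx[OF cAB(1) 0(1) usc(1) 0(3) cAB(2) 0(2) usc(2) 0(4) le \<alpha> \<kappa>(1)[of k] \<kappa>(1)[of k]])
      fix xa yb pa pb X Y
      assume in_AB: "xa \<in> A" "yb \<in> B" and small: "norm xa < \<kappa> k" "norm yb < \<kappa> k" "norm pa < \<kappa> k" "norm pb < \<kappa> k"
        "\<bar>a' xa\<bar> < \<kappa> k" "\<bar>b' yb\<bar> < \<kappa> k" and lin: "linear X" "linear Y"
        and tX: "\<And>\<epsilon>. 0 < \<epsilon> \<Longrightarrow> \<exists>d>0. \<forall>e. norm e < d \<longrightarrow> xa + e \<in> A \<longrightarrow>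
          a' (xa + e) \<le> a' xa + pa \<bullet> e + e \<bullet> X e / 2 + \<epsilon> * (norm e)\<^sup>2"
        and tY: "\<And>\<epsilon>. 0 < \<epsilon> \<Longrightarrow> \<exists>d>0. \<forall>e. norm e < d \<longrightarrow> yb + e \<in> B \<longrightarrow>
          b' (yb + e) \<le> b' yb + pb \<bullet> e + e \<bullet> Y e / 2 + \<epsilon> * (norm e)\<^sup>2"
        and bounds: "\<And>e. - 3 * \<alpha> * (norm e)\<^sup>2 \<le> e \<bullet> X e" "\<And>e. - 3 * \<alpha> * (norm e)\<^sup>2 \<le> e \<bullet> Y e"
        "\<And>e f. e \<bullet> X e + f \<bullet> Y f \<le> 3 * \<alpha> * (norm (e - f))\<^sup>2 + \<kappa> k * ((norm e)\<^sup>2 + (norm f)\<^sup>2)"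
      define SX SY where "SX = (1 / 2) *\<^sub>R (matrix X + transpose (matrix X))"
        and "SY = (1 / 2) *\<^sub>R (matrix Y + transpose (matrix Y))"
      have S: "sym_mat SX" "sym_mat SY" "\<And>e. e \<bullet> (SX *v e) = e \<bullet> X e" "\<And>e. e \<bullet> (SY *v e) = e \<bullet> Y e"
        using symmetrized_matrix[OF lin(1)] symmetrized_matrix[OF lin(2)] by (simp_all add: SX_def SY_def)
      have "strictly_touched K a (x + xa) (p + pa) (SX + \<kappa> k *\<^sub>R mat 1)"
        unfolding SX_def
        by (rule strictly_touched_shift[OF lin(1) _ \<kappa>(1)])
          (use in_AB tX in \<open>simp_all add: A_def a'_def\<close>)
      moreover have "strictly_touched K b (y + yb) (- p + pb) (SY + \<kappa> k *\<^sub>R mat 1)"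
        unfolding SY_def
        by (rule strictly_touched_shift[OF lin(2) _ \<kappa>(1)])
          (use in_AB tY in \<open>simp_all add: B_def b'_def\<close>)
      ultimately have "good k (xa, yb, pa, pb, SX, SY)"
        unfolding good_def using small S bounds by simp
      then show ?thesis by blast
    qed
  qed
  then obtain r where r: "\<And>k. good k (r k)" by metis
  define xs where "xs k = fst (r k)" for k
  define ys where "ys k = fst (snd (r k))" for k
  define ps where "ps k = fst (snd (snd (r k)))" for k
  define qs where "qs k = fst (snd (snd (snd (r k))))" for k
  define Xs where "Xs k = fst (snd (snd (snd (snd (r k)))))" for k
  define Ys where "Ys k = snd (snd (snd (snd (snd (r k)))))" for k
  have "good k (xs k, ys k, ps k, qs k, Xs k, Ys k)" for k
    using r[of k] by (simp add: xs_def ys_def ps_def qs_def Xs_def Ys_def)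
  note g = this[unfolded good_def prod.case]
  have small: "f \<longlonglongrightarrow> 0" if "\<And>k. norm (f k) < \<kappa> k" for f :: "nat \<Rightarrow> 'b::real_normed_vector"
    by (rule Lim_null_comparison[OF _ \<kappa>0]) (intro always_eventually allI less_imp_le that)
  have lim: "xs \<longlonglongrightarrow> 0" "ys \<longlonglongrightarrow> 0" "ps \<longlonglongrightarrow> 0" "qs \<longlonglongrightarrow> 0" "(\<lambda>k. a' (xs k)) \<longlonglongrightarrow> 0" "(\<lambda>k. b' (ys k)) \<longlonglongrightarrow> 0"
    using g by (auto intro!: small)
  \<comment> \<open>One vector set to 0 in the joint bound, together with
    \<open>\<kappa> k \<le> 1\<close>, gives this bound for each form.\<close>
  define c where "c = 3 * \<alpha> + 1"
  have "\<bar>e \<bullet> (Xs k *v e)\<bar> \<le> c * (norm e)\<^sup>2 \<and> \<bar>e \<bullet> (Ys k *v e)\<bar> \<le> c * (norm e)\<^sup>2" for e k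
  proof -
    have "e \<bullet> (Xs k *v e) + 0 \<bullet> (Ys k *v 0) \<le> 3 * \<alpha> * (norm (e - 0))\<^sup>2 + \<kappa> k * ((norm e)\<^sup>2 + (norm (0::real^'n))\<^sup>2)"
      "0 \<bullet> (Xs k *v 0) + e \<bullet> (Ys k *v e) \<le> 3 * \<alpha> * (norm (0 - e))\<^sup>2 + \<kappa> k * ((norm (0::real^'n))\<^sup>2 + (norm e)\<^sup>2)"
      "- 3 * \<alpha> * (norm e)\<^sup>2 \<le> e \<bullet> (Xs k *v e)" "- 3 * \<alpha> * (norm e)\<^sup>2 \<le> e \<bullet> (Ys k *v e)"
      using g[of k] by blast+
    then have "e \<bullet> (Xs k *v e) \<le> 3 * \<alpha> * (norm e)\<^sup>2 + \<kappa> k * (norm e)\<^sup>2"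
      "e \<bullet> (Ys k *v e) \<le> 3 * \<alpha> * (norm e)\<^sup>2 + \<kappa> k * (norm e)\<^sup>2"
      "- (e \<bullet> (Xs k *v e)) \<le> 3 * \<alpha> * (norm e)\<^sup>2" "- (e \<bullet> (Ys k *v e)) \<le> 3 * \<alpha> * (norm e)\<^sup>2"
      by simp_all
    moreover have "\<kappa> k * (norm e)\<^sup>2 \<le> 1 * (norm e)\<^sup>2" using \<kappa>(2) by (intro mult_right_mono) auto
    moreover have "c * (norm e)\<^sup>2 = 3 * \<alpha> * (norm e)\<^sup>2 + (norm e)\<^sup>2" by (simp add: c_def distrib_right)
    moreover have "0 \<le> (norm e)\<^sup>2" by simp
    ultimately show ?thesis unfolding abs_le_iff by (intro conjI; linarith)
  qed
  then have entry: "\<bar>Xs k $ i $ j\<bar> \<le> c" "\<bar>Ys k $ i $ j\<bar> \<le> c" for k i j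
    using g[of k] by (auto intro!: sym_mat_entry_bound)
  define C where "C = (\<Sum>i\<in>(UNIV::'n set). \<Sum>j\<in>(UNIV::'n set). c)"
  have "norm (Xs k) \<le> C" "norm (Ys k) \<le> C" for k
    unfolding C_def by (intro order_trans[OF norm_le_sum_entries] sum_mono entry)+
  then have "norm (Xs k, Ys k) \<le> C + C" for k
    using norm_Pair_le[of "Xs k" "Ys k"] by (meson add_mono order_trans)
  then have "bounded (range (\<lambda>k. (Xs k, Ys k)))" by (auto simp: bounded_iff)
  then obtain XY s where s: "strict_mono s" "((\<lambda>k. (Xs k, Ys k)) \<circ> s) \<longlonglongrightarrow> XY"
    using bounded_imp_convergent_subsequence by blast
  define X Y where "X = fst XY" and "Y = snd XY"
  have X: "(\<lambda>k. Xs (s k)) \<longlonglongrightarrow> X" and Y: "(\<lambda>k. Ys (s k)) \<longlonglongrightarrow> Y"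
    using tendsto_fst[OF s(2)] tendsto_snd[OF s(2)] by (simp_all add: X_def Y_def o_def)
  note sub = LIMSEQ_subseq_LIMSEQ[OF _ s(1), unfolded o_def]
  have \<kappa>s: "(\<lambda>k. \<kappa> (s k)) \<longlonglongrightarrow> 0" using sub[OF \<kappa>0] .
  have symXY: "sym_mat X" "sym_mat Y"
    using sym_mat_limit[OF X] sym_mat_limit[OF Y] g by blast+
  have XYs: "(\<lambda>k. Xs (s k) + \<kappa> (s k) *\<^sub>R mat 1) \<longlonglongrightarrow> X" "(\<lambda>k. Ys (s k) + \<kappa> (s k) *\<^sub>R mat 1) \<longlonglongrightarrow> Y"
    using tendsto_add[OF X tendsto_scaleR[OF \<kappa>s tendsto_const[of "mat 1"]]]
      tendsto_add[OF Y tendsto_scaleR[OF \<kappa>s tendsto_const[of "mat 1"]]] by simp_all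
  have shift: "(\<lambda>k. z + f (s k)) \<longlonglongrightarrow> z" if "f \<longlonglongrightarrow> 0" for f :: "nat \<Rightarrow> real^'n" and z
    using tendsto_add[OF tendsto_const[of z] sub[OF that]] by simp
  have "superjet_limit K a x p X"
    unfolding superjet_limit_def
  proof (intro exI conjI allI)
    show "strictly_touched K a (x + xs (s k)) (p + ps (s k)) (Xs (s k) + \<kappa> (s k) *\<^sub>R mat 1)" for k
      using g[of "s k"] by blast
    \<comment> \<open>Semicontinuity would give only one inequality for the limit of the values; the
      smallness of \<open>a'\<close> at the chosen points gives convergence.\<close>
    have "(\<lambda>k. a' (xs (s k)) + a x + p \<bullet> xs (s k)) \<longlonglongrightarrow> 0 + a x + p \<bullet> 0"
      by (intro tendsto_intros sub lim)
    then show "(\<lambda>k. a (x + xs (s k))) \<longlonglongrightarrow> a x" by (simp add: a'_def)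
  qed (intro shift lim XYs)+
  moreover have "superjet_limit K b y (- p) Y"
    unfolding superjet_limit_def
  proof (intro exI conjI allI)
    show "strictly_touched K b (y + ys (s k)) (- p + qs (s k)) (Ys (s k) + \<kappa> (s k) *\<^sub>R mat 1)" for k
      using g[of "s k"] by blast
    have "(\<lambda>k. b' (ys (s k)) + b y + (- p) \<bullet> ys (s k)) \<longlonglongrightarrow> 0 + b y + (- p) \<bullet> 0"
      by (intro tendsto_intros sub lim)
    then show "(\<lambda>k. b (y + ys (s k))) \<longlonglongrightarrow> b y" by (simp add: b'_def)
  qed (intro shift lim XYs)+
  moreover have lower: "- 3 * \<alpha> * (norm e)\<^sup>2 \<le> e \<bullet> (X *v e)" "- 3 * \<alpha> * (norm e)\<^sup>2 \<le> e \<bullet> (Y *v e)" for e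
    using LIMSEQ_le_const[OF tendsto_quadratic_form[OF X]] LIMSEQ_le_const[OF tendsto_quadratic_form[OF Y]] g
    by blast+
  have upper: "e \<bullet> (X *v e) + f \<bullet> (Y *v f) \<le> 3 * \<alpha> * (norm (e - f))\<^sup>2" for e f
  proof (rule LIMSEQ_le)
    show "(\<lambda>k. e \<bullet> (Xs (s k) *v e) + f \<bullet> (Ys (s k) *v f)) \<longlonglongrightarrow> e \<bullet> (X *v e) + f \<bullet> (Y *v f)"
      by (intro tendsto_add tendsto_quadratic_form X Y)
    have "(\<lambda>k. 3 * \<alpha> * (norm (e - f))\<^sup>2 + \<kappa> (s k) * ((norm e)\<^sup>2 + (norm f)\<^sup>2)) \<longlonglongrightarrow>
        3 * \<alpha> * (norm (e - f))\<^sup>2 + 0 * ((norm e)\<^sup>2 + (norm f)\<^sup>2)"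
      by (intro tendsto_intros \<kappa>s)
    then show "(\<lambda>k. 3 * \<alpha> * (norm (e - f))\<^sup>2 + \<kappa> (s k) * ((norm e)\<^sup>2 + (norm f)\<^sup>2)) \<longlonglongrightarrow> 3 * \<alpha> * (norm (e - f))\<^sup>2"
      by simp
  qed (use g in blast)
  have "loewner_le ((- 3 * \<alpha>) *\<^sub>R block_mat (mat 1) 0 0 (mat 1)) (block_mat X 0 0 Y)"
    unfolding loewner_le_def
  proof
    fix v :: "real^('n + 'n)"
    define e f where "e = (\<chi> k. v $ Inl k)" and "f = (\<chi> k. v $ Inr k)"
    show "v \<bullet> (((- 3 * \<alpha>) *\<^sub>R block_mat (mat 1) 0 0 (mat 1)) *v v) \<le> v \<bullet> (block_mat X 0 0 Y *v v)"
      unfolding scaleR_matrix_vector_assoc[symmetric] inner_scaleR_right block_mat_quadratic_form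
        e_def[symmetric] f_def[symmetric]
      using lower(1)[of e] lower(2)[of f] by (simp add: power2_norm_eq_inner algebra_simps)
  qed
  moreover have "loewner_le (block_mat X 0 0 Y) ((3 * \<alpha>) *\<^sub>R block_mat (mat 1) (- mat 1) (- mat 1) (mat 1))"
    unfolding loewner_le_def
  proof
    fix v :: "real^('n + 'n)"
    define e f where "e = (\<chi> k. v $ Inl k)" and "f = (\<chi> k. v $ Inr k)"
    have neg: "(- mat 1) *v w = - w" for w :: "real^'n"
      using scaleR_matrix_vector_assoc[of "- 1" "mat 1" w] by simp
    show "v \<bullet> (block_mat X 0 0 Y *v v) \<le> v \<bullet> (((3 * \<alpha>) *\<^sub>R block_mat (mat 1) (- mat 1) (- mat 1) (mat 1)) *v v)"
      unfolding scaleR_matrix_vector_assoc[symmetric] inner_scaleR_right block_mat_quadratic_form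
        e_def[symmetric] f_def[symmetric] neg
      using upper[of e f]
      by (simp add: power2_norm_eq_inner inner_diff_left inner_diff_right inner_commute algebra_simps)
  qed
  ultimately show thesis using that[OF symXY] by (simp add: p_def)
qed

section \<open>Envelopes and limits of jets\<close>

lemma lower_env_eq: "lower_env \<Omega> f x = - upper_env \<Omega> (\<lambda>y. - f y) x"
  using ereal_Limsup_uminus[of "inf (nhds x) (principal \<Omega>)" "\<lambda>y. ereal (f y)"]
  by (simp add: lower_env_def upper_env_def)

text \<open>\<open>real_of_ereal\<close> sends infinite values to 0, so an envelope can be estimated
  only once its Limsup is known to be finite. Below this follows from the bound on \<open>f\<close>
  and the filter being nontrivial at points of the closure, above from \<open>c\<close>.\<close>

lemma upper_env_le:
  assumes x: "x \<in> closure \<Omega>" and f: "\<And>y. y \<in> \<Omega> \<Longrightarrow> \<bar>f y\<bar> \<le> B"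
    and ev: "\<forall>\<^sub>F y in nhds x. y \<in> \<Omega> \<longrightarrow> f y \<le> c"
  shows "ereal (upper_env \<Omega> f x) = Limsup (inf (nhds x) (principal \<Omega>)) (\<lambda>y. ereal (f y))"
    and "upper_env \<Omega> f x \<le> c"
proof -
  define N where "N = inf (nhds x) (principal \<Omega>)"
  have "N \<noteq> bot"
    unfolding N_def trivial_limit_def eventually_inf_principal eventually_nhds
    using x by (auto simp: closure_iff_nhds_not_empty)
  moreover have "\<forall>\<^sub>F y in N. ereal (- B) \<le> ereal (f y)"
    unfolding N_def eventually_inf_principal using f by (intro always_eventually) (force simp: abs_le_iff)
  ultimately have "ereal (- B) \<le> Limsup N (\<lambda>y. ereal (f y))" by (rule le_Limsup)
  moreover have le: "Limsup N (\<lambda>y. ereal (f y)) \<le> ereal c"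
    unfolding N_def using ev by (intro Limsup_bounded) (simp add: eventually_inf_principal)
  ultimately show eq: "ereal (upper_env \<Omega> f x) = Limsup (inf (nhds x) (principal \<Omega>)) (\<lambda>y. ereal (f y))"
    unfolding N_def upper_env_def by (cases "Limsup (inf (nhds x) (principal \<Omega>)) (\<lambda>y. ereal (f y))") auto
  show "upper_env \<Omega> f x \<le> c" using le unfolding N_def eq[symmetric] by simp
qed

text \<open>A neighborhood on which \<open>f < c'\<close> is also a neighborhood of each of its
  points, which bounds the envelope there by \<open>c'\<close>; the gap between \<open>c'\<close>
  and \<open>c\<close> restores strictness.\<close>

lemma usc_upper_env:
  assumes f: "\<And>y. y \<in> \<Omega> \<Longrightarrow> \<bar>f y\<bar> \<le> B"
  shows "usc_on (closure \<Omega>) (upper_env \<Omega> f)"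
  unfolding usc_on_def
proof (intro ballI allI impI)
  fix x c assume x: "x \<in> closure \<Omega>" and "upper_env \<Omega> f x < c"
  then obtain c' where c': "upper_env \<Omega> f x < c'" "c' < c" using dense by blast
  have "\<forall>\<^sub>F y in nhds x. y \<in> \<Omega> \<longrightarrow> f y \<le> B" using f by (intro always_eventually) (force simp: abs_le_iff)
  from upper_env_le(1)[OF x f this]
  have "Limsup (inf (nhds x) (principal \<Omega>)) (\<lambda>y. ereal (f y)) < ereal c'" using c'(1) by (metis less_ereal.simps(1))
  then have "\<forall>\<^sub>F y in inf (nhds x) (principal \<Omega>). ereal (f y) < ereal c'" by (rule Limsup_lessD)
  then obtain U where U: "open U" "x \<in> U" "\<And>y. y \<in> U \<Longrightarrow> y \<in> \<Omega> \<Longrightarrow> f y < c'"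
    by (auto simp: eventually_inf_principal eventually_nhds)
  have "upper_env \<Omega> f z < c" if z: "z \<in> U" "z \<in> closure \<Omega>" for z
  proof -
    have "\<forall>\<^sub>F y in nhds z. y \<in> \<Omega> \<longrightarrow> f y \<le> c'"
      unfolding eventually_nhds using U z(1) by (intro exI[of _ U]) (auto intro: less_imp_le)
    from upper_env_le(2)[OF z(2) f this] show ?thesis using c'(2) by simp
  qed
  then show "\<forall>\<^sub>F y in at x within closure \<Omega>. upper_env \<Omega> f y < c"
    using U(1,2) by (auto simp: eventually_at_topological)
qed

lemma usc_upper_lower_env:
  fixes u :: "real^'n \<Rightarrow> real^'m::finite"
  assumes "bounded (u ` \<Omega>)"
  shows "usc_on (closure \<Omega>) (upper_env \<Omega> (\<lambda>y. u y $ j))" "usc_on (closure \<Omega>) (\<lambda>x. - lower_env \<Omega> (\<lambda>y. u y $ j) x)"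
proof -
  obtain B where "\<And>y. y \<in> \<Omega> \<Longrightarrow> norm (u y) \<le> B" using assms by (auto simp: bounded_iff)
  then have B: "\<bar>u y $ j\<bar> \<le> B" if "y \<in> \<Omega>" for y
    using that component_le_norm_cart[of "u y" j] order_trans by blast
  then show "usc_on (closure \<Omega>) (upper_env \<Omega> (\<lambda>y. u y $ j))" by (rule usc_upper_env)
  show "usc_on (closure \<Omega>) (\<lambda>x. - lower_env \<Omega> (\<lambda>y. u y $ j) x)"
    unfolding lower_env_eq minus_minus using B by (intro usc_upper_env[of _ _ B]) simp
qed

section \<open>Quadratic test functions\<close>

lemma sym_mat_inner: "sym_mat X \<Longrightarrow> v \<bullet> (X *v h) = h \<bullet> (X *v v)"
  using dot_lmul_matrix[of v X h] by (metis inner_commute sym_mat_def transpose_matrix_vector)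

lemma C2_on_quadratic:
  fixes X :: "real^'n^'n::finite"
  assumes "sym_mat X"
  shows "C2_on \<Omega> (\<lambda>y. c + p \<bullet> (y - x) + (y - x) \<bullet> (X *v (y - x)) / 2) (\<lambda>y. p + X *v (y - x)) (\<lambda>_. X)"
  unfolding C2_on_def
proof (intro conjI ballI continuous_intros)
  fix z
  have X: "((\<lambda>y. X *v (y - x)) has_derivative (\<lambda>h. X *v h)) (at z)" for z
  proof -
    have "((\<lambda>y. y - x) has_derivative (\<lambda>h. h)) (at z)" by (auto intro!: derivative_eq_intros)
    from bounded_linear.has_derivative[OF matrix_vector_mul_bounded_linear[of X] this] show ?thesis .
  qed
  show "((\<lambda>y. p + X *v (y - x)) has_derivative (\<lambda>h. X *v h)) (at z)"
    by (auto intro!: derivative_eq_intros X)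
  define f where "f y = (y - x) \<bullet> (X *v (y - x))" for y
  have "(f has_derivative (\<lambda>h. (z - x) \<bullet> (X *v h) + h \<bullet> (X *v (z - x)))) (at z)"
    unfolding f_def by (rule has_derivative_inner[OF _ X]) (auto intro!: derivative_eq_intros)
  then have "((\<lambda>y. c + p \<bullet> (y - x) + f y / 2) has_derivative
      (\<lambda>h. p \<bullet> h + ((z - x) \<bullet> (X *v h) + h \<bullet> (X *v (z - x))) / 2)) (at z)"
    by (auto intro!: derivative_eq_intros)
  then have "((\<lambda>y. c + p \<bullet> (y - x) + (y - x) \<bullet> (X *v (y - x)) / 2) has_derivative
      (\<lambda>h. p \<bullet> h + ((z - x) \<bullet> (X *v h) + h \<bullet> (X *v (z - x))) / 2)) (at z)"
    by (simp only: f_def)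
  then show "GDERIV (\<lambda>y. c + p \<bullet> (y - x) + (y - x) \<bullet> (X *v (y - x)) / 2) z :> p + X *v (z - x)"
    unfolding gderiv_def sym_mat_inner[OF assms, of "z - x"]
    by (simp add: inner_add_right inner_commute[of p])
qed

lemma strictly_touched_test_function:
  fixes a :: "real^'n::finite \<Rightarrow> real"
  assumes \<Omega>: "open \<Omega>" "x \<in> \<Omega>" and a: "strictly_touched (closure \<Omega>) a x p X"
  obtains \<phi> D H where "C2_on \<Omega> \<phi> D H" "touches_above \<phi> a x" "D x = p" "H x = X"
proof -
  define \<phi> where "\<phi> y = a x + p \<bullet> (y - x) + (y - x) \<bullet> (X *v (y - x)) / 2" for y
  obtain d where d: "d > 0" "\<And>e. e \<noteq> 0 \<Longrightarrow> norm e < d \<Longrightarrow> x + e \<in> closure \<Omega> \<Longrightarrow>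
      a (x + e) < a x + p \<bullet> e + e \<bullet> (X *v e) / 2"
    using a by (auto simp: strictly_touched_def)
  have "a y < \<phi> y" if y: "y \<in> ball x d \<inter> \<Omega> - {x}" for y
    using d(2)[of "y - x"] y closure_subset[of \<Omega>] by (auto simp: \<phi>_def dist_norm norm_minus_commute)
  then have "touches_above \<phi> a x"
    unfolding touches_above_def using \<Omega> d(1)
    by (intro conjI exI[of _ "ball x d \<inter> \<Omega>"]) (auto simp: \<phi>_def)
  moreover have "C2_on \<Omega> \<phi> (\<lambda>y. p + X *v (y - x)) (\<lambda>_. X)"
    unfolding \<phi>_def using a by (intro C2_on_quadratic) (simp add: strictly_touched_def)
  ultimately show thesis using that by simp
qed

lemma strictly_touched_test_function_below:
  fixes a :: "real^'n::finite \<Rightarrow> real"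
  assumes \<Omega>: "open \<Omega>" "x \<in> \<Omega>" and a: "strictly_touched (closure \<Omega>) (\<lambda>y. - a y) x p X"
  obtains \<phi> D H where "C2_on \<Omega> \<phi> D H" "touches_below \<phi> a x" "D x = - p" "H x = - X"
proof -
  define \<phi> where "\<phi> y = a x + (- p) \<bullet> (y - x) + (y - x) \<bullet> ((- X) *v (y - x)) / 2" for y
  have neg: "(- X) *v w = - (X *v w)" for w
    using scaleR_matrix_vector_assoc[of "- 1" X w] by simp
  obtain d where d: "d > 0" "\<And>e. e \<noteq> 0 \<Longrightarrow> norm e < d \<Longrightarrow> x + e \<in> closure \<Omega> \<Longrightarrow>
      - a (x + e) < - a x + p \<bullet> e + e \<bullet> (X *v e) / 2"
    using a by (auto simp: strictly_touched_def)
  have "\<phi> y < a y" if y: "y \<in> ball x d \<inter> \<Omega> - {x}" for y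
    using d(2)[of "y - x"] y closure_subset[of \<Omega>] by (auto simp: \<phi>_def neg dist_norm norm_minus_commute)
  then have "touches_below \<phi> a x"
    unfolding touches_below_def using \<Omega> d(1)
    by (intro conjI exI[of _ "ball x d \<inter> \<Omega>"]) (auto simp: \<phi>_def)
  moreover have "sym_mat (- X)"
    using a by (auto simp: strictly_touched_def sym_mat_def transpose_def vec_eq_iff)
  then have "C2_on \<Omega> \<phi> (\<lambda>y. - p + (- X) *v (y - x)) (\<lambda>_. - X)"
    unfolding \<phi>_def by (intro C2_on_quadratic)
  ultimately show thesis using that by simp
qed

section \<open>Exchange of the two groups\<close>

lemma join_same [simp]: "join J r r = r"
  by (simp add: join_def vec_eq_iff)

lemma join_nth: "join J r s $ i = (if i \<in> J then r $ i else s $ i)"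
  by (simp add: join_def)

lemma join_Compl: "join (- J) r s = join J s r"
  by (simp add: join_def vec_eq_iff)

lemma balanced_quasi_monotone_Compl:
  "balanced_quasi_monotone J \<Omega> F \<Longrightarrow> balanced_quasi_monotone (- J) \<Omega> F"
  unfolding balanced_quasi_monotone_def join_Compl double_complement by blast

text \<open>With this exchange every fact proved for sub-super solutions applies to \<open>v\<close>
  as well as to \<open>u\<close>.\<close>

lemma super_sub_solution_iff_Compl:
  "super_sub_solution J \<Omega> F v \<longleftrightarrow> sub_super_solution (- J) \<Omega> F v"
  unfolding super_sub_solution_def sub_super_solution_def join_Compl double_complement by blast

section \<open>Passage to the limit in the differential inequalities\<close>

lemma usc_on_sequentially:
  assumes a: "usc_on K a" and x: "x \<in> K" and xs: "xs \<longlonglongrightarrow> x" "\<And>k. xs k \<in> K" and c: "a x < c"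
  shows "\<forall>\<^sub>F k in sequentially. a (xs k) < c"
proof -
  obtain U where U: "open U" "x \<in> U" "\<And>y. y \<in> U \<Longrightarrow> y \<noteq> x \<Longrightarrow> y \<in> K \<Longrightarrow> a y < c"
    using usc_onD[OF a x c] by (auto simp: eventually_at_topological)
  have "\<forall>\<^sub>F k in sequentially. xs k \<in> U" using xs(1) U(1,2) by (rule topological_tendstoD)
  then show ?thesis by eventually_elim (use U(3) xs(2) c in metis)
qed

text \<open>The values \<open>a (xs k)\<close> may drop away from \<open>a x\<close>. Semicontinuity
  prevents a jump upwards and the maximum a drop, so the truncated sequence converges and can be
  inserted into a continuous operator.\<close>

lemma usc_on_max_tendsto:
  assumes a: "usc_on K a" and x: "x \<in> K" and xs: "xs \<longlonglongrightarrow> x" "\<And>k. xs k \<in> K"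
  shows "(\<lambda>k. max (a (xs k)) (a x)) \<longlonglongrightarrow> a x"
proof (rule order_tendstoI)
  fix c assume "a x < c"
  from usc_on_sequentially[OF assms this] show "\<forall>\<^sub>F k in sequentially. max (a (xs k)) (a x) < c"
    by eventually_elim (use \<open>a x < c\<close> in simp)
qed (auto simp: less_max_iff_disj)

lemma operator_tendsto:
  assumes F: "continuous_on (\<Omega> \<times> UNIV \<times> UNIV \<times> {X. sym_mat X}) (\<lambda>(x, \<xi>, p, X). F x \<xi> p X)"
    and x: "x \<in> \<Omega>" "sym_mat X" and lim: "xs \<longlonglongrightarrow> x" "\<zeta>s \<longlonglongrightarrow> \<zeta>" "ps \<longlonglongrightarrow> p" "Xs \<longlonglongrightarrow> X"
    and ev: "\<forall>\<^sub>F k in sequentially. xs k \<in> \<Omega>" "\<And>k. sym_mat (Xs k)"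
  shows "(\<lambda>k. F (xs k) (\<zeta>s k) (ps k) (Xs k) :: real) \<longlonglongrightarrow> F x \<zeta> p X"
proof -
  have "(\<lambda>k. (xs k, \<zeta>s k, ps k, Xs k)) \<longlonglongrightarrow> (x, \<zeta>, p, X)" by (intro tendsto_intros lim)
  moreover have "\<forall>\<^sub>F k in sequentially. (xs k, \<zeta>s k, ps k, Xs k) \<in> \<Omega> \<times> UNIV \<times> UNIV \<times> {X. sym_mat X}"
    using ev(1) by eventually_elim (use ev(2) in simp)
  ultimately show ?thesis using continuous_on_tendsto_compose[OF F] x by fastforce
qed

lemma balanced_quasi_monotoneD:
  assumes "balanced_quasi_monotone J \<Omega> F" "x \<in> \<Omega>" "sym_mat X"
  shows "j \<in> J \<Longrightarrow> (\<And>k. s $ k \<le> \<sigma> $ k) \<Longrightarrow> F j x (join J r s) p X \<le> F j x (join J r \<sigma>) p X"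
    and "j \<in> J \<Longrightarrow> (\<And>k. r $ k \<le> \<rho> $ k) \<Longrightarrow> r $ j = \<rho> $ j \<Longrightarrow> F j x (join J \<rho> s) p X \<le> F j x (join J r s) p X"
    and "j \<notin> J \<Longrightarrow> (\<And>k. r $ k \<le> \<rho> $ k) \<Longrightarrow> F j x (join J r s) p X \<le> F j x (join J \<rho> s) p X"
    and "j \<notin> J \<Longrightarrow> (\<And>k. s $ k \<le> \<sigma> $ k) \<Longrightarrow> s $ j = \<sigma> $ j \<Longrightarrow> F j x (join J r \<sigma>) p X \<le> F j x (join J r s) p X"
  using assms by (simp_all add: balanced_quasi_monotone_def)

text \<open>Raising the first group and lowering the second decreases \<open>F i\<close> for
  \<open>i\<close> in \<open>J\<close> and increases it for the other indices. Hence one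
  modification of the envelopes preserves both signs, and the modified vectors converge, so
  continuity of \<open>F i\<close> applies.\<close>

lemma sub_super_solution_superjet_limit:
  fixes \<Omega> :: "(real^'n) set" and J :: "'m::finite set" and F :: "('n::finite, 'm) operator"
  assumes \<Omega>: "open \<Omega>" and F: "continuous_on (\<Omega> \<times> UNIV \<times> UNIV \<times> {X. sym_mat X}) (\<lambda>(x, \<xi>, p, X). F i x \<xi> p X)"
    and mono: "balanced_quasi_monotone J \<Omega> F" and sol: "sub_super_solution J \<Omega> F u"
    and x: "x \<in> \<Omega>" and X: "sym_mat X"
  shows "i \<in> J \<Longrightarrow> superjet_limit (closure \<Omega>) (upper_env \<Omega> (\<lambda>y. u y $ i)) x p X \<Longrightarrow>
      F i x (join J (upper_env_vec \<Omega> u x) (lower_env_vec \<Omega> u x)) p X \<le> 0"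
    and "i \<notin> J \<Longrightarrow> superjet_limit (closure \<Omega>) (\<lambda>z. - lower_env \<Omega> (\<lambda>y. u y $ i) z) x (- p) X \<Longrightarrow>
      0 \<le> F i x (join J (upper_env_vec \<Omega> u x) (lower_env_vec \<Omega> u x)) p (- X)"
proof -
  define up where "up j = upper_env \<Omega> (\<lambda>y. u y $ j)" for j
  define low where "low j = lower_env \<Omega> (\<lambda>y. u y $ j)" for j
  \<comment> \<open>The component \<open>i\<close> itself stays untouched, as quasi-monotonicity
    within its own group demands; its values converge by the definition of
    \<open>superjet_limit\<close>.\<close>
  define R where "R y = (\<chi> j. if j \<in> J \<and> j = i then up j y else max (up j y) (up j x))" for y
  define S where "S y = (\<chi> j. if j \<notin> J \<and> j = i then low j y else min (low j y) (low j x))" for y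
  have bdd: "bounded (u ` \<Omega>)" using sol by (simp add: sub_super_solution_def)
  note usc = usc_upper_lower_env[OF bdd, folded up_def low_def]
  have xK: "x \<in> closure \<Omega>" using x closure_subset by blast
  have lim: "(\<lambda>k. join J (R (xs k)) (S (xs k))) \<longlonglongrightarrow> join J (upper_env_vec \<Omega> u x) (lower_env_vec \<Omega> u x)"
    if xs: "xs \<longlonglongrightarrow> x" "\<And>k. xs k \<in> closure \<Omega>"
      and i: "if i \<in> J then (\<lambda>k. up i (xs k)) \<longlonglongrightarrow> up i x else (\<lambda>k. low i (xs k)) \<longlonglongrightarrow> low i x" for xs
  proof (rule vec_tendstoI)
    fix j
    have "(\<lambda>k. - max (- low j (xs k)) (- low j x)) \<longlonglongrightarrow> - (- low j x)"
      by (intro tendsto_minus usc_on_max_tendsto[OF usc(2) xK xs])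
    then have "(\<lambda>k. min (low j (xs k)) (low j x)) \<longlonglongrightarrow> low j x"
      by (simp add: minus_max_eq_min)
    then show "(\<lambda>k. join J (R (xs k)) (S (xs k)) $ j) \<longlonglongrightarrow> join J (upper_env_vec \<Omega> u x) (lower_env_vec \<Omega> u x) $ j"
      using usc_on_max_tendsto[OF usc(1) xK xs, of j] i
      by (cases "j = i"; cases "j \<in> J")
        (auto simp: join_nth R_def S_def upper_env_vec_def lower_env_vec_def up_def[symmetric] low_def[symmetric])
  qed
  have vec: "upper_env_vec \<Omega> u y $ j = up j y" "lower_env_vec \<Omega> u y $ j = low j y" for y j
    by (simp_all add: upper_env_vec_def lower_env_vec_def up_def low_def)
  have RS: "upper_env_vec \<Omega> u y $ j \<le> R y $ j" "S y $ j \<le> lower_env_vec \<Omega> u y $ j"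
    "i \<in> J \<Longrightarrow> upper_env_vec \<Omega> u y $ i = R y $ i" "i \<notin> J \<Longrightarrow> S y $ i = lower_env_vec \<Omega> u y $ i" for y j
    by (simp_all add: vec R_def S_def)
  {
    assume i: "i \<in> J" and "superjet_limit (closure \<Omega>) (upper_env \<Omega> (\<lambda>y. u y $ i)) x p X"
    then obtain xs ps Xs where touch: "\<And>k. strictly_touched (closure \<Omega>) (up i) (xs k) (ps k) (Xs k)"
      and conv: "xs \<longlonglongrightarrow> x" "(\<lambda>k. up i (xs k)) \<longlonglongrightarrow> up i x" "ps \<longlonglongrightarrow> p" "Xs \<longlonglongrightarrow> X"
      unfolding superjet_limit_def up_def by blast
    have xs: "xs k \<in> closure \<Omega>" "sym_mat (Xs k)" for k using touch[of k] by (auto simp: strictly_touched_def)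
    have ev: "\<forall>\<^sub>F k in sequentially. xs k \<in> \<Omega>" using conv(1) \<Omega> x by (rule topological_tendstoD)
    have "F i y (join J (R y) (S y)) q Y \<le> 0"
      if y: "y \<in> \<Omega>" and t: "strictly_touched (closure \<Omega>) (up i) y q Y" for y q Y
    proof -
      obtain \<phi> D H where \<phi>: "C2_on \<Omega> \<phi> D H" "touches_above \<phi> (up i) y" "D y = q" "H y = Y"
        using strictly_touched_test_function[OF \<Omega> y t] .
      have Y: "sym_mat Y" using t by (simp add: strictly_touched_def)
      have "F i y (join J (R y) (S y)) q Y \<le> F i y (join J (R y) (lower_env_vec \<Omega> u y)) q Y"
        by (rule balanced_quasi_monotoneD(1)[OF mono y Y i RS(2)])
      also have "\<dots> \<le> F i y (join J (upper_env_vec \<Omega> u y) (lower_env_vec \<Omega> u y)) q Y"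
        by (rule balanced_quasi_monotoneD(2)[OF mono y Y i RS(1) RS(3)[OF i]])
      also have "\<dots> \<le> 0"
        using sol y i \<phi>(1,2) unfolding sub_super_solution_def up_def \<phi>(3,4)[symmetric] by blast
      finally show ?thesis .
    qed
    then have "\<forall>\<^sub>F k in sequentially. F i (xs k) (join J (R (xs k)) (S (xs k))) (ps k) (Xs k) \<le> 0"
      using ev touch by (auto elim: eventually_mono)
    moreover have "(\<lambda>k. F i (xs k) (join J (R (xs k)) (S (xs k))) (ps k) (Xs k)) \<longlonglongrightarrow>
        F i x (join J (upper_env_vec \<Omega> u x) (lower_env_vec \<Omega> u x)) p X"
      by (intro operator_tendsto[where F = "F i", OF F x X conv(1) lim conv(3,4) ev] xs conv(1)) (use i conv(2) in simp)
    ultimately show "F i x (join J (upper_env_vec \<Omega> u x) (lower_env_vec \<Omega> u x)) p X \<le> 0"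
      using tendsto_upperbound trivial_limit_sequentially by blast
  next
    assume i: "i \<notin> J" and "superjet_limit (closure \<Omega>) (\<lambda>z. - lower_env \<Omega> (\<lambda>y. u y $ i) z) x (- p) X"
    then obtain xs ps Xs where touch: "\<And>k. strictly_touched (closure \<Omega>) (\<lambda>z. - low i z) (xs k) (ps k) (Xs k)"
      and conv: "xs \<longlonglongrightarrow> x" "(\<lambda>k. - low i (xs k)) \<longlonglongrightarrow> - low i x" "ps \<longlonglongrightarrow> - p" "Xs \<longlonglongrightarrow> X"
      unfolding superjet_limit_def low_def by blast
    have xs: "xs k \<in> closure \<Omega>" "sym_mat (- Xs k)" for k
      using touch[of k] by (auto simp: strictly_touched_def sym_mat_def transpose_def vec_eq_iff)
    have mX: "sym_mat (- X)" using X by (auto simp: sym_mat_def transpose_def vec_eq_iff)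
    have conv': "(\<lambda>k. - ps k) \<longlonglongrightarrow> p" "(\<lambda>k. - Xs k) \<longlonglongrightarrow> - X" "(\<lambda>k. low i (xs k)) \<longlonglongrightarrow> low i x"
      using tendsto_minus[OF conv(3)] tendsto_minus[OF conv(4)] tendsto_minus[OF conv(2)] by simp_all
    have ev: "\<forall>\<^sub>F k in sequentially. xs k \<in> \<Omega>" using conv(1) \<Omega> x by (rule topological_tendstoD)
    have "0 \<le> F i y (join J (R y) (S y)) (- q) (- Y)"
      if y: "y \<in> \<Omega>" and t: "strictly_touched (closure \<Omega>) (\<lambda>z. - low i z) y q Y" for y q Y
    proof -
      obtain \<phi> D H where \<phi>: "C2_on \<Omega> \<phi> D H" "touches_below \<phi> (low i) y" "D y = - q" "H y = - Y"
        using strictly_touched_test_function_below[OF \<Omega> y t] .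
      have Y: "sym_mat (- Y)" using t by (auto simp: strictly_touched_def sym_mat_def transpose_def vec_eq_iff)
      have i': "i \<in> - J" using i by simp
      have "0 \<le> F i y (join J (upper_env_vec \<Omega> u y) (lower_env_vec \<Omega> u y)) (- q) (- Y)"
        using sol y i' \<phi>(1,2) unfolding sub_super_solution_def low_def \<phi>(3,4)[symmetric] by blast
      also have "\<dots> \<le> F i y (join J (R y) (lower_env_vec \<Omega> u y)) (- q) (- Y)"
        by (rule balanced_quasi_monotoneD(3)[OF mono y Y i RS(1)])
      also have "\<dots> \<le> F i y (join J (R y) (S y)) (- q) (- Y)"
        by (rule balanced_quasi_monotoneD(4)[OF mono y Y i RS(2) RS(4)[OF i]])
      finally show ?thesis .
    qed
    then have "\<forall>\<^sub>F k in sequentially. 0 \<le> F i (xs k) (join J (R (xs k)) (S (xs k))) (- ps k) (- Xs k)"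
      using ev touch by (auto elim: eventually_mono)
    moreover have "(\<lambda>k. F i (xs k) (join J (R (xs k)) (S (xs k))) (- ps k) (- Xs k)) \<longlonglongrightarrow>
        F i x (join J (upper_env_vec \<Omega> u x) (lower_env_vec \<Omega> u x)) p (- X)"
      by (intro operator_tendsto[where F = "F i", OF F x mX conv(1) lim conv'(1,2) ev] xs conv(1)) (use i conv'(3) in simp)
    ultimately show "0 \<le> F i x (join J (upper_env_vec \<Omega> u x) (lower_env_vec \<Omega> u x)) p (- X)"
      using tendsto_lowerbound trivial_limit_sequentially by blast
  }
qed

section \<open>Doubling of variables\<close>

text \<open>Maximizing over the finitely many indices at the same time is what later makes the
  active difference the maximum demanded in (i').\<close>

lemma penalized_max_exists:
  fixes A b :: "'i::finite \<Rightarrow> 'a::euclidean_space \<Rightarrow> real"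
  assumes K: "compact K" "K \<noteq> {}"
    and A: "\<And>i. usc_on K (A i)" and b: "\<And>i. usc_on K (\<lambda>y. - b i y)"
  shows "\<exists>i x y. x \<in> K \<and> y \<in> K \<and> (\<forall>j. \<forall>x'\<in>K. \<forall>y'\<in>K.
    A j x' - b j y' - \<alpha> / 2 * (norm (x' - y'))\<^sup>2 \<le> A i x - b i y - \<alpha> / 2 * (norm (x - y))\<^sup>2)"
proof -
  define \<Phi> where "\<Phi> j z = A j (fst z) + - b j (snd z) + - (\<alpha> / 2 * (norm (fst z - snd z))\<^sup>2)" for j z
  have "\<exists>z\<in>K \<times> K. \<forall>z'\<in>K \<times> K. \<Phi> j z' \<le> \<Phi> j z" for j
  proof (rule usc_on_attains_sup)
    show "usc_on (K \<times> K) (\<Phi> j)"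
      unfolding \<Phi>_def
      by (intro usc_on_add usc_on_continuous usc_on_compose[OF A] usc_on_compose[OF b] continuous_intros) auto
  qed (use K in \<open>auto intro: compact_Times\<close>)
  then obtain z where z: "\<And>j. z j \<in> K \<times> K" "\<And>j z'. z' \<in> K \<times> K \<Longrightarrow> \<Phi> j z' \<le> \<Phi> j (z j)" by metis
  define m where "m = Max (range (\<lambda>j. \<Phi> j (z j)))"
  have "m \<in> range (\<lambda>j. \<Phi> j (z j))" unfolding m_def by (rule Max_in) auto
  then obtain i where i: "m = \<Phi> i (z i)" by auto
  have "\<Phi> j (x', y') \<le> \<Phi> i (z i)" if "x' \<in> K" "y' \<in> K" for j x' y'
  proof -
    have "\<Phi> j (x', y') \<le> \<Phi> j (z j)" using that by (intro z(2)) auto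
    also have "\<dots> \<le> m" unfolding m_def by (rule Max_ge) auto
    finally show ?thesis by (simp add: i)
  qed
  then show ?thesis
    using z(1)[of i] by (intro exI[of _ i] exI[of _ "fst (z i)"] exI[of _ "snd (z i)"]) (auto simp: \<Phi>_def)
qed

lemma doubling_variables:
  fixes A b :: "'i::finite \<Rightarrow> 'a::euclidean_space \<Rightarrow> real"
  assumes K: "compact K" "x0 \<in> K"
    and A: "\<And>i. usc_on K (A i)" and b: "\<And>i. usc_on K (\<lambda>y. - b i y)"
  obtains i :: "nat \<Rightarrow> 'i" and x y \<alpha> z where "z \<in> K" "\<And>k. x k \<in> K" "\<And>k. y k \<in> K" "\<And>k. 0 < \<alpha> k"
    "\<And>k j x' y'. x' \<in> K \<Longrightarrow> y' \<in> K \<Longrightarrow> A j x' - b j y' - \<alpha> k / 2 * (norm (x' - y'))\<^sup>2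
      \<le> A (i k) (x k) - b (i k) (y k) - \<alpha> k / 2 * (norm (x k - y k))\<^sup>2"
    "x \<longlonglongrightarrow> z" "y \<longlonglongrightarrow> z" "(\<lambda>k. \<alpha> k * (norm (x k - y k))\<^sup>2 + 1 / \<alpha> k) \<longlonglongrightarrow> 0"
proof -
  \<comment> \<open>Doubling makes the gap between consecutive parameters proportional to the
    parameter itself.\<close>
  define \<alpha> :: "nat \<Rightarrow> real" where "\<alpha> k = 2 ^ k" for k
  have \<alpha>: "0 < \<alpha> k" for k by (simp add: \<alpha>_def)
  have "K \<noteq> {}" using K by auto
  have "\<exists>i x y. x \<in> K \<and> y \<in> K \<and> (\<forall>j. \<forall>x'\<in>K. \<forall>y'\<in>K. A j x' - b j y' - \<alpha> k / 2 * (norm (x' - y'))\<^sup>2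
      \<le> A i x - b i y - \<alpha> k / 2 * (norm (x - y))\<^sup>2)" for k
    by (rule penalized_max_exists[OF K(1) \<open>K \<noteq> {}\<close>]) (rule A b)+
  then obtain i x y where xy: "\<And>k. x k \<in> K" "\<And>k. y k \<in> K"
    and max: "\<And>k j x' y'. x' \<in> K \<Longrightarrow> y' \<in> K \<Longrightarrow> A j x' - b j y' - \<alpha> k / 2 * (norm (x' - y'))\<^sup>2
      \<le> A (i k) (x k) - b (i k) (y k) - \<alpha> k / 2 * (norm (x k - y k))\<^sup>2"
    by metis
  define M where "M k = A (i k) (x k) - b (i k) (y k) - \<alpha> k / 2 * (norm (x k - y k))\<^sup>2" for k
  \<comment> \<open>The maximizer for \<open>Suc k\<close> is tested in the problem for
    \<open>k\<close>. The maxima decrease and are bounded below by the value at (x0, x0), so the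
    right-hand side tends to 0.\<close>
  have step: "\<alpha> (Suc k) * (norm (x (Suc k) - y (Suc k)))\<^sup>2 \<le> 4 * (M k - M (Suc k))" for k
    using max[of "x (Suc k)" "y (Suc k)" "i (Suc k)" k] xy by (simp add: M_def \<alpha>_def)
  have "M (Suc k) \<le> M k" for k
  proof -
    have "0 \<le> \<alpha> (Suc k) * (norm (x (Suc k) - y (Suc k)))\<^sup>2" using \<alpha> by (simp add: less_imp_le)
    from order_trans[OF this step] show ?thesis by simp
  qed
  then have "decseq M" by (rule decseq_SucI)
  moreover have "A (i 0) x0 - b (i 0) x0 \<le> M k" for k
    using max[of x0 x0 "i 0" k] K by (simp add: M_def)
  ultimately obtain m where m: "M \<longlonglongrightarrow> m" by (metis decseq_convergent)
  have pen: "(\<lambda>k. \<alpha> (Suc k) * (norm (x (Suc k) - y (Suc k)))\<^sup>2) \<longlonglongrightarrow> 0"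
  proof (rule tendsto_sandwich[OF _ _ tendsto_const])
    have "(\<lambda>k. 4 * (M k - M (Suc k))) \<longlonglongrightarrow> 4 * (m - m)" by (intro tendsto_intros m LIMSEQ_Suc[OF m])
    then show "(\<lambda>k. 4 * (M k - M (Suc k))) \<longlonglongrightarrow> 0" by simp
    show "\<forall>\<^sub>F k in sequentially. 0 \<le> \<alpha> (Suc k) * (norm (x (Suc k) - y (Suc k)))\<^sup>2"
      by (intro always_eventually allI mult_nonneg_nonneg less_imp_le[OF \<alpha>] zero_le_power2)
  qed (intro always_eventually allI step)
  have inv: "(\<lambda>k. 1 / \<alpha> (Suc k)) \<longlonglongrightarrow> 0"
  proof -
    have "1 / \<alpha> n = (1 / 2) ^ n" for n by (simp add: \<alpha>_def power_divide)
    then show ?thesis using LIMSEQ_Suc[OF LIMSEQ_realpow_zero[of "1 / 2"]] by simp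
  qed
  have sq: "(norm (x (Suc k) - y (Suc k)))\<^sup>2 \<le> \<alpha> (Suc k) * (norm (x (Suc k) - y (Suc k)))\<^sup>2" for k
  proof -
    have "1 * (norm (x (Suc k) - y (Suc k)))\<^sup>2 \<le> \<alpha> (Suc k) * (norm (x (Suc k) - y (Suc k)))\<^sup>2"
      unfolding \<alpha>_def by (intro mult_right_mono one_le_power) auto
    then show ?thesis by simp
  qed
  have "(\<lambda>k. (norm (x (Suc k) - y (Suc k)))\<^sup>2) \<longlonglongrightarrow> 0"
    by (rule tendsto_sandwich[OF _ _ tendsto_const pen]) (intro always_eventually allI sq zero_le_power2)+
  then have "(\<lambda>k. sqrt ((norm (x (Suc k) - y (Suc k)))\<^sup>2)) \<longlonglongrightarrow> sqrt 0" by (rule tendsto_real_sqrt)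
  then have "(\<lambda>k. x (Suc k) - y (Suc k)) \<longlonglongrightarrow> 0" by (simp add: tendsto_norm_zero_iff)
  from tendsto_minus[OF this] have dist: "(\<lambda>k. y (Suc k) - x (Suc k)) \<longlonglongrightarrow> 0" by simp
  obtain z s where s: "z \<in> K" "strict_mono s" "((\<lambda>k. x (Suc k)) \<circ> s) \<longlonglongrightarrow> z"
    using K(1) xy(1) by (metis (no_types, lifting) compact_def)
  note sub = LIMSEQ_subseq_LIMSEQ[OF _ s(2), unfolded o_def]
  \<comment> \<open>The penalty estimate controls only successor indices.\<close>
  define t where "t k = Suc (s k)" for k
  have x: "(\<lambda>k. x (t k)) \<longlonglongrightarrow> z" using s(3) by (simp add: o_def t_def)
  have y: "(\<lambda>k. y (t k)) \<longlonglongrightarrow> z" using tendsto_add[OF x[unfolded t_def] sub[OF dist]] by (simp add: t_def)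
  have lim: "(\<lambda>k. \<alpha> (t k) * (norm (x (t k) - y (t k)))\<^sup>2 + 1 / \<alpha> (t k)) \<longlonglongrightarrow> 0"
    using tendsto_add[OF sub[OF pen] sub[OF inv]] by (simp add: t_def)
  show thesis
    by (rule that[of z "\<lambda>k. x (t k)" "\<lambda>k. y (t k)" "\<lambda>k. \<alpha> (t k)" "\<lambda>k. i (t k)"])
      (use s(1) xy \<alpha> max x y lim in blast)+
qed

section \<open>Comparison of sub-super and super-sub solutions\<close>

theorem theorem4p1:
  fixes \<Omega> :: "(real^'n) set" and J :: "'m::finite set" and F :: "('n::finite, 'm) operator"
    and u v :: "real^'n \<Rightarrow> real^'m"
  assumes "open \<Omega>" and "bounded \<Omega>" and "J \<noteq> {}"
    and "\<And>i. continuous_on (\<Omega> \<times> UNIV \<times> UNIV \<times> {X. sym_mat X}) (\<lambda>(x, \<xi>, p, X). F i x \<xi> p X)"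
    and "degenerate_elliptic \<Omega> F"
    and "balanced_quasi_monotone J \<Omega> F"
    and "\<exists>\<Lambda>>0. \<forall>r s \<rho> \<sigma> \<theta>.
        Max ({r $ j - \<rho> $ j |j. j \<in> J} \<union> {\<sigma> $ j - s $ j |j. j \<in> -J}) = \<theta> \<and> \<theta> > 0 \<longrightarrow>
        (\<forall>x\<in>\<Omega>. \<forall>p X. sym_mat X \<longrightarrow>
          (\<forall>j\<in>J. \<theta> = r $ j - \<rho> $ j \<longrightarrow>
            F j x (join J r s) p X - F j x (join J \<rho> \<sigma>) p X \<ge> \<Lambda> * (r $ j - \<rho> $ j)) \<and>
          (\<forall>j\<in>-J. \<theta> = \<sigma> $ j - s $ j \<longrightarrow>
            F j x (join J \<rho> \<sigma>) p X - F j x (join J r s) p X \<ge> \<Lambda> * (\<sigma> $ j - s $ j)))"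
    and "\<exists>\<omega>::real \<Rightarrow> real. continuous_on {0..} \<omega> \<and> (\<forall>t\<ge>0. \<omega> t \<ge> 0) \<and> \<omega> 0 = 0 \<and>
        (\<forall>X Y \<alpha>. sym_mat X \<and> sym_mat Y \<and> \<alpha> > 0 \<and>
          loewner_le ((- 3 * \<alpha>) *\<^sub>R block_mat (mat 1) 0 0 (mat 1)) (block_mat X 0 0 Y) \<and>
          loewner_le (block_mat X 0 0 Y)
            ((3 * \<alpha>) *\<^sub>R block_mat (mat 1) (- mat 1) (- mat 1) (mat 1)) \<longrightarrow>
          (\<forall>i. \<forall>x\<in>\<Omega>. \<forall>y\<in>\<Omega>. \<forall>\<xi>.
            F i y \<xi> (\<alpha> *\<^sub>R (x - y)) (- Y) - F i x \<xi> (\<alpha> *\<^sub>R (x - y)) X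
              \<le> \<omega> (\<alpha> * (norm (x - y))\<^sup>2 + 1 / \<alpha>)))"
    and "sub_super_solution J \<Omega> F u"
    and "super_sub_solution J \<Omega> F v"
    and "\<And>x j. x \<in> frontier \<Omega> \<Longrightarrow> j \<in> J \<Longrightarrow> upper_env_vec \<Omega> u x $ j \<le> lower_env_vec \<Omega> v x $ j"
    and "\<And>x j. x \<in> frontier \<Omega> \<Longrightarrow> j \<in> -J \<Longrightarrow> upper_env_vec \<Omega> v x $ j \<le> lower_env_vec \<Omega> u x $ j"
  shows "(\<forall>x\<in>\<Omega>. \<forall>j\<in>J. upper_env_vec \<Omega> u x $ j \<le> lower_env_vec \<Omega> v x $ j) \<and>
         (\<forall>x\<in>\<Omega>. \<forall>j\<in>-J. upper_env_vec \<Omega> v x $ j \<le> lower_env_vec \<Omega> u x $ j)"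
proof (rule ccontr)
  assume contra: "\<not> ?thesis"
  note \<Omega> = assms(1,2) and cont = assms(4) and mono = assms(6) and sol_u = assms(9)
  have sol_v: "sub_super_solution (- J) \<Omega> F v" using assms(10) by (simp only: super_sub_solution_iff_Compl)
  have mono': "balanced_quasi_monotone (- J) \<Omega> F" using mono by (rule balanced_quasi_monotone_Compl)
  define K where "K = closure \<Omega>"
  have K: "compact K" "\<Omega> \<subseteq> K" using \<Omega>(2) closure_subset[of \<Omega>] by (auto simp: K_def compact_closure)
  define A where "A i = upper_env \<Omega> (\<lambda>y. (if i \<in> J then u y else v y) $ i)" for i
  define b where "b i = lower_env \<Omega> (\<lambda>y. (if i \<in> J then v y else u y) $ i)" for i
  \<comment> \<open>\<open>U\<close> and \<open>V\<close> are the full vectors inserted into the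
    system for \<open>u\<close> and \<open>v\<close>. \<open>W i\<close> is the one in the
    inequality for \<open>A i\<close>, \<open>W' i\<close> the one in the inequality for
    \<open>b i\<close>.\<close>
  define U where "U x = join J (upper_env_vec \<Omega> u x) (lower_env_vec \<Omega> u x)" for x
  define V where "V x = join (- J) (upper_env_vec \<Omega> v x) (lower_env_vec \<Omega> v x)" for x
  define W where "W i x = (if i \<in> J then U x else V x)" for i x
  define W' where "W' i x = (if i \<in> J then V x else U x)" for i x
  have bdd: "bounded (u ` \<Omega>)" "bounded (v ` \<Omega>)"
    using sol_u sol_v by (simp_all add: sub_super_solution_def)
  have usc_A: "usc_on K (A i)" for i
    using usc_upper_lower_env(1)[OF bdd(1)] usc_upper_lower_env(1)[OF bdd(2)] by (cases "i \<in> J") (simp_all add: A_def K_def)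
  have usc_b: "usc_on K (\<lambda>y. - b i y)" for i
    using usc_upper_lower_env(2)[OF bdd(1)] usc_upper_lower_env(2)[OF bdd(2)] by (cases "i \<in> J") (simp_all add: b_def K_def)
  have UV: "U x $ j = (if j \<in> J then A j x else b j x)" "V x $ j = (if j \<in> J then b j x else A j x)" for x j
    by (simp_all add: U_def V_def A_def b_def join_nth upper_env_vec_def lower_env_vec_def)
  have boundary: "A i x \<le> b i x" if "x \<in> K" "x \<notin> \<Omega>" for i x
  proof -
    have "x \<in> frontier \<Omega>" using that \<Omega>(1) by (simp add: K_def frontier_def interior_open)
    then show ?thesis using assms(11)[of x i] assms(12)[of x i]
      by (cases "i \<in> J") (simp_all add: A_def b_def upper_env_vec_def lower_env_vec_def)
  qed
  have "\<exists>i x. x \<in> \<Omega> \<and> b i x < A i x"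
  proof (rule ccontr)
    assume "\<not> ?thesis"
    then have le: "A i x \<le> b i x" if "x \<in> \<Omega>" for i x using that by (meson not_le)
    have "upper_env_vec \<Omega> u x $ j \<le> lower_env_vec \<Omega> v x $ j" if "x \<in> \<Omega>" "j \<in> J" for x j
      using le[OF that(1), of j] that(2) by (simp add: A_def b_def upper_env_vec_def lower_env_vec_def)
    moreover have "upper_env_vec \<Omega> v x $ j \<le> lower_env_vec \<Omega> u x $ j" if "x \<in> \<Omega>" "j \<in> - J" for x j
      using le[OF that(1), of j] that(2) by (simp add: A_def b_def upper_env_vec_def lower_env_vec_def)
    ultimately show False using contra by blast
  qed
  then obtain i0 x0 where x0: "x0 \<in> \<Omega>" "b i0 x0 < A i0 x0" by blast
  define \<theta>0 where "\<theta>0 = A i0 x0 - b i0 x0"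
  have \<theta>0: "0 < \<theta>0" using x0 by (simp add: \<theta>0_def)
  have sub: "F i x (W i x) p X \<le> 0" if "x \<in> \<Omega>" "sym_mat X" "superjet_limit K (A i) x p X" for i x p X
    using sub_super_solution_superjet_limit(1)[OF \<Omega>(1) cont mono sol_u that(1,2), of i p]
      sub_super_solution_superjet_limit(1)[OF \<Omega>(1) cont mono' sol_v that(1,2), of i p] that(3)
    by (cases "i \<in> J") (simp_all add: W_def U_def V_def A_def K_def)
  have super: "0 \<le> F i x (W' i x) p (- X)"
    if "x \<in> \<Omega>" "sym_mat X" "superjet_limit K (\<lambda>y. - b i y) x (- p) X" for i x p X
    using sub_super_solution_superjet_limit(2)[OF \<Omega>(1) cont mono sol_u that(1,2), of i p]
      sub_super_solution_superjet_limit(2)[OF \<Omega>(1) cont mono' sol_v that(1,2), of i p] that(3)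
    by (cases "i \<in> J") (simp_all add: W'_def U_def V_def b_def K_def)
  obtain \<Lambda> where \<Lambda>: "0 < \<Lambda>" and all: "\<forall>r s \<rho> \<sigma> \<theta>.
        Max ({r $ j - \<rho> $ j |j. j \<in> J} \<union> {\<sigma> $ j - s $ j |j. j \<in> -J}) = \<theta> \<and> \<theta> > 0 \<longrightarrow>
        (\<forall>x\<in>\<Omega>. \<forall>p X. sym_mat X \<longrightarrow>
          (\<forall>j\<in>J. \<theta> = r $ j - \<rho> $ j \<longrightarrow>
            F j x (join J r s) p X - F j x (join J \<rho> \<sigma>) p X \<ge> \<Lambda> * (r $ j - \<rho> $ j)) \<and>
          (\<forall>j\<in>-J. \<theta> = \<sigma> $ j - s $ j \<longrightarrow>
            F j x (join J \<rho> \<sigma>) p X - F j x (join J r s) p X \<ge> \<Lambda> * (\<sigma> $ j - s $ j)))"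
    using assms(7) by (elim exE conjE)
  note strict = all[THEN spec, THEN spec, THEN spec, THEN spec, THEN spec, THEN mp, OF conjI,
      THEN bspec, THEN spec, THEN spec, THEN mp]

  text \<open>The two groups are compared at opposite ends: if the maximizing index is in the group of \<open>J\<close>,
    then \<open>U\<close> is evaluated at \<open>x\<close> and \<open>V\<close> at \<open>y\<close>, so for the other group the pair \<open>(y, x)\<close>
    has to be tested, which costs nothing because the penalization is symmetric.\<close>
  have gain: "\<Lambda> * \<theta> \<le> F i x (W i x) p X - F i x (W' i y) p X"
    if x: "x \<in> \<Omega>" and X: "sym_mat X" and \<theta>: "0 < \<theta>" "\<theta> = A i x - b i y"
      and le: "\<And>j. A j x - b j y \<le> \<theta>" "\<And>j. A j y - b j x \<le> \<theta>" for \<theta> i x y p X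
  proof -
    have Max: "Max ({r $ j - \<rho> $ j |j. j \<in> J} \<union> {\<rho> $ j - r $ j |j. j \<in> -J}) = \<theta>"
      if "\<And>j. j \<in> J \<Longrightarrow> r $ j - \<rho> $ j \<le> \<theta>" "\<And>j. j \<notin> J \<Longrightarrow> \<rho> $ j - r $ j \<le> \<theta>"
        "\<theta> = (if i \<in> J then r $ i - \<rho> $ i else \<rho> $ i - r $ i)" for r \<rho> :: "real^'m"
      by (rule Max_eqI) (use that in \<open>auto split: if_splits\<close>)
    show ?thesis
    proof (cases "i \<in> J")
      case True
      have "Max ({U x $ j - V y $ j |j. j \<in> J} \<union> {V y $ j - U x $ j |j. j \<in> -J}) = \<theta>"
        by (rule Max) (use le \<theta> True in \<open>simp_all add: UV\<close>)
      from strict[OF this \<theta>(1) x X, of p] have "\<Lambda> * (U x $ i - V y $ i) \<le> F i x (U x) p X - F i x (V y) p X"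
        using True \<theta>(2) by (simp add: UV)
      then show ?thesis using True \<theta>(2) by (simp add: UV W_def W'_def)
    next
      case False
      have "Max ({U y $ j - V x $ j |j. j \<in> J} \<union> {V x $ j - U y $ j |j. j \<in> -J}) = \<theta>"
        by (rule Max) (use le \<theta> False in \<open>simp_all add: UV\<close>)
      from strict[OF this \<theta>(1) x X, of p] have "\<Lambda> * (V x $ i - U y $ i) \<le> F i x (V x) p X - F i x (U y) p X"
        using False \<theta>(2) by (simp add: UV)
      then show ?thesis using False \<theta>(2) by (simp add: UV W_def W'_def)
    qed
  qed
  obtain \<omega> :: "real \<Rightarrow> real" where \<omega>: "continuous_on {0..} \<omega>" "\<omega> 0 = 0"
    and struct: "\<forall>X Y \<alpha>. sym_mat X \<and> sym_mat Y \<and> \<alpha> > 0 \<and>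
          loewner_le ((- 3 * \<alpha>) *\<^sub>R block_mat (mat 1) 0 0 (mat 1)) (block_mat X 0 0 Y) \<and>
          loewner_le (block_mat X 0 0 Y)
            ((3 * \<alpha>) *\<^sub>R block_mat (mat 1) (- mat 1) (- mat 1) (mat 1)) \<longrightarrow>
          (\<forall>i. \<forall>x\<in>\<Omega>. \<forall>y\<in>\<Omega>. \<forall>\<xi>.
            F i y \<xi> (\<alpha> *\<^sub>R (x - y)) (- Y) - F i x \<xi> (\<alpha> *\<^sub>R (x - y)) X
              \<le> \<omega> (\<alpha> * (norm (x - y))\<^sup>2 + 1 / \<alpha>))"
    using assms(8) by (elim exE conjE)
  have x0K: "x0 \<in> K" using x0 K by auto
  obtain i x y \<alpha> z where z: "z \<in> K" and xK: "\<And>k. x k \<in> K" and yK: "\<And>k. y k \<in> K" and \<alpha>: "\<And>k. 0 < \<alpha> k"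
    and max: "\<And>k j x' y'. x' \<in> K \<Longrightarrow> y' \<in> K \<Longrightarrow> A j x' - b j y' - \<alpha> k / 2 * (norm (x' - y'))\<^sup>2
      \<le> A (i k) (x k) - b (i k) (y k) - \<alpha> k / 2 * (norm (x k - y k))\<^sup>2"
    and lim: "x \<longlonglongrightarrow> z" "y \<longlonglongrightarrow> z" "(\<lambda>k. \<alpha> k * (norm (x k - y k))\<^sup>2 + 1 / \<alpha> k) \<longlonglongrightarrow> 0"
    by (rule doubling_variables[where A = A and b = b, OF K(1) x0K usc_A usc_b]) blast
  \<comment> \<open>The competitor (x0, x0) carries no penalty, so the excess at the maximum points
    never falls below \<open>\<theta>0\<close>.\<close>
  have \<theta>: "\<theta>0 \<le> A (i k) (x k) - b (i k) (y k)" for k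
  proof -
    have "0 \<le> \<alpha> k / 2 * (norm (x k - y k))\<^sup>2" using \<alpha>[of k] by simp
    then show ?thesis using max[OF x0K x0K, of i0 k] by (simp add: \<theta>0_def)
  qed
  have "z \<in> \<Omega>"
  proof (rule ccontr)
    assume "z \<notin> \<Omega>"
    \<comment> \<open>The maximizing index varies with \<open>k\<close>, so the estimate at the
      boundary is established for every \<open>j\<close> and then combined over the finitely many
      indices.\<close>
    have "\<forall>\<^sub>F k in sequentially. A j (x k) - b j (y k) < \<theta>0" for j
    proof -
      have "\<forall>\<^sub>F k in sequentially. A j (x k) < A j z + \<theta>0 / 2"
        using \<theta>0 by (intro usc_on_sequentially[OF usc_A z lim(1) xK]) simp
      moreover have "\<forall>\<^sub>F k in sequentially. - b j (y k) < - b j z + \<theta>0 / 2"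
        using \<theta>0 by (intro usc_on_sequentially[OF usc_b z lim(2) yK]) simp
      ultimately show ?thesis
        by eventually_elim (use boundary[OF z \<open>z \<notin> \<Omega>\<close>, of j] in linarith)
    qed
    then have "\<forall>\<^sub>F k in sequentially. \<forall>j. A j (x k) - b j (y k) < \<theta>0" by (simp add: eventually_all_finite)
    then obtain k where "A (i k) (x k) - b (i k) (y k) < \<theta>0" by (auto simp: eventually_sequentially)
    then show False using \<theta>[of k] by simp
  qed
  then have "\<forall>\<^sub>F k in sequentially. x k \<in> \<Omega>" "\<forall>\<^sub>F k in sequentially. y k \<in> \<Omega>"
    using topological_tendstoD[OF lim(1) \<Omega>(1)] topological_tendstoD[OF lim(2) \<Omega>(1)] by auto
  then have "\<forall>\<^sub>F k in sequentially. \<Lambda> * \<theta>0 \<le> \<omega> (\<alpha> k * (norm (x k - y k))\<^sup>2 + 1 / \<alpha> k)"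
  proof eventually_elim
    fix k assume xy: "x k \<in> \<Omega>" "y k \<in> \<Omega>"
    define p where "p = \<alpha> k *\<^sub>R (x k - y k)"
    define \<theta>k where "\<theta>k = A (i k) (x k) - b (i k) (y k)"
    obtain X Y where XY: "sym_mat X" "sym_mat Y" "superjet_limit K (A (i k)) (x k) p X"
      "superjet_limit K (\<lambda>y. - b (i k) y) (y k) (- p) Y"
      "loewner_le ((- 3 * \<alpha> k) *\<^sub>R block_mat (mat 1) 0 0 (mat 1)) (block_mat X 0 0 Y)"
      "loewner_le (block_mat X 0 0 Y) ((3 * \<alpha> k) *\<^sub>R block_mat (mat 1) (- mat 1) (- mat 1) (mat 1))"
      unfolding p_def
      by (rule theorem_on_sums[OF K(1) xK[of k] yK[of k] usc_A[of "i k"] usc_b[of "i k"] \<alpha>[of k]])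
        (use max[of _ _ "i k" k] in auto)
    have "\<Lambda> * \<theta>0 \<le> \<Lambda> * \<theta>k" using \<theta> \<Lambda> by (intro mult_left_mono) (auto simp: \<theta>k_def)
    also have "\<dots> \<le> F (i k) (x k) (W (i k) (x k)) p X - F (i k) (x k) (W' (i k) (y k)) p X"
    proof (rule gain[OF xy(1) XY(1)])
      show "0 < \<theta>k" using \<theta>0 \<theta>[of k] by (simp add: \<theta>k_def)
      show "A j (x k) - b j (y k) \<le> \<theta>k" for j using max[OF xK[of k] yK[of k], of j k] by (simp add: \<theta>k_def)
      show "A j (y k) - b j (x k) \<le> \<theta>k" for j
        using max[OF yK[of k] xK[of k], of j k] by (simp add: \<theta>k_def norm_minus_commute)
    qed (simp add: \<theta>k_def)
    \<comment> \<open>The first term is at most 0 by the inequality for \<open>A\<close>; in its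
      place stands a term that is at least 0 by the inequality for \<open>b\<close>.\<close>
    also have "\<dots> \<le> F (i k) (y k) (W' (i k) (y k)) p (- Y) - F (i k) (x k) (W' (i k) (y k)) p X"
      using sub[OF xy(1) XY(1,3)] super[OF xy(2) XY(2,4)] by simp
    \<comment> \<open>Condition (ii) compares two points with one common vector; \<open>gain\<close>
      leaves \<open>W'\<close>, taken at \<open>y k\<close>, in both terms for this purpose.\<close>
    also have "\<dots> \<le> \<omega> (\<alpha> k * (norm (x k - y k))\<^sup>2 + 1 / \<alpha> k)"
      unfolding p_def using struct XY(1,2,5,6) \<alpha>[of k] xy by simp
    finally show "\<Lambda> * \<theta>0 \<le> \<omega> (\<alpha> k * (norm (x k - y k))\<^sup>2 + 1 / \<alpha> k)" .
  qed
  moreover have "(\<lambda>k. \<omega> (\<alpha> k * (norm (x k - y k))\<^sup>2 + 1 / \<alpha> k)) \<longlonglongrightarrow> \<omega> 0"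
    by (rule continuous_on_tendsto_compose[OF \<omega>(1) lim(3)]) (use \<alpha> in \<open>auto simp: less_imp_le\<close>)
  ultimately have "\<Lambda> * \<theta>0 \<le> \<omega> 0"
    using tendsto_lowerbound trivial_limit_sequentially by blast
  then show False using \<Lambda> \<theta>0 \<omega>(2) by (simp add: mult_le_0_iff)
qed

end
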